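(* Let $T>0$ and let $b:[0,T]\times\mathbb{R}^d\to\mathbb{R}^d$ be a measurable vector field for which there exist nonnegative $C_0,C_1\in L^1([0,T])$ such that $|b(t,y)|\le C_0(t)(1+|y|)$ for a.e. $(t,y)\in[0,T]\times\mathbb{R}^d$, and $x\mapsto b(t,x)+C_1(t)x$ is increasing for a.e. $t\in[0,T]$. Set $\omega_0(t)=\int_0^tC_0(s)\,ds$ and $\omega_1(t)=\int_0^tC_1(s)\,ds$. For every $s\in[0,T]$ and for almost every $x\in\mathbb{R}^d$, there exists a unique absolutely continuous solution $[s,T]\ni t\mapsto\phi_{t,s}(x)$ of the differential inclusion $$\partial_t\phi_{t,s}(x)\in[b_*(t,\cdot),b^*(t,\cdot)](\phi_{t,s}(x)),\quad t\in[s,T],\qquad \phi_{s,s}(x)=x.$$ Moreover, $\phi_{t,s}$ satisfies the regular Lagrangian property: the map $C_c(\mathbb{R}^d)\ni h\mapsto h\circ\phi_{t,s}$ extends continuously to $h\in L^1_{\mathrm{loc}}(\mathbb{R}^d)$, and there exists $C>0$, depending only on $T$, such that, for all $R>0$, $h\in L^1_{\mathrm{loc}}(\mathbb{R}^d)$ and $t\in[s,T]$, $$\|h\circ\phi_{t,s}\|_{L^1(B_R)}\le e^{d(\omega_1(t)-\omega_1(s))}\,\|h\|_{L^1(B_{R+C(1+R)(\omega_0(t)-\omega_0(s))})}.$$ In particular, the map $(t,x)\mapsto b(t,\phi_{t,s}(x))$ on $[s,T]\times\mathbb{R}^d$ belongs to $L^1_{\mathrm{loc}}(\mathbb{R}^d,L^1([s,T]))$,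 and, for a.e. $x\in\mathbb{R}^d$, $[s,T]\ni t\mapsto\phi_{t,s}(x)$ is the unique absolutely continuous solution of the integral equation $$\phi_{t,s}(x)=x+\int_s^tb(r,\phi_{r,s}(x))\,dr.$$ Finally, if $0\le r\le s\le t\le T$, then the composition $\phi_{t,s}\circ\phi_{s,r}$ is well-defined a.e. and is equal to $\phi_{t,r}$ a.e.
   Context: For $x,y\in\mathbb{R}^n$, $x\le y$ means $x_i\le y_i$ for all $i$. A map $\psi:\mathbb{R}^d\to\mathbb{R}^m$ is increasing if $x\le y$ implies $\psi(x)\le\psi(y)$. Increasing functions are always taken to be the càdlàg representative, i.e. each component satisfies $\psi^i(x)=\limsup_{y\to x}\psi^i(y)=\limsup_{y\to x,\,y\ge x,\,y\neq x}\psi^i(y)$. $b_*(t,\cdot)$ and $b^*(t,\cdot)$ denote the coordinate-by-coordinate lower and upper semicontinuous envelopes of $b(t,\cdot)$ in the space variable only. For $\alpha\le\beta$ in $\mathbb{R}^d$, $[\alpha,\beta]=\prod_{i=1}^d[\alpha_i,\beta_i]$; the set $[b_*(t,\cdot),b^*(t,\cdot)](z)$ is the box $[b_*(t,z),b^*(t,z)]$. A solution of the differential inclusion satisfies it for a.e. $t$. $B_R$ is the ball of radius $R$ centered at $0$.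
   Formalization: C may depend on T, the fixed dimension d and an upper bound M for ω_0(T), not on T alone: with C depending only on T the estimate fails, e.g. for d=1, b(t,y)=c(1+|y|), C_0=C_1=c with c large. *)

theory Defs
  imports "HOL-Analysis.Analysis"
begin

subsection \<open>Increasing maps and semicontinuous envelopes\<close>

text \<open>
  The order on \<^typ>\<open>real^'n\<close> is the componentwise one, so \<^const>\<open>mono\<close> is the required
  monotonicity. Increasing maps are always the cadlag representative. The limits superior are
  taken over \<open>y \<noteq> x\<close> (which is what the filter \<open>at x\<close> does) and in the extended reals.
\<close>

definition increasing_cadlag :: "(real^'d::finite \<Rightarrow> real^'m::finite) \<Rightarrow> bool" where
  "increasing_cadlag \<psi> \<longleftrightarrow> mono \<psi> \<and>
     (\<forall>x i. ereal (\<psi> x $ i) = Limsup (at x) (\<lambda>y. ereal (\<psi> y $ i)) \<and>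
            ereal (\<psi> x $ i) = Limsup (at x within {y. x \<le> y}) (\<lambda>y. ereal (\<psi> y $ i)))"

text \<open>
  Envelopes are taken coordinate by coordinate. The filter \<open>nhds x\<close> includes the point \<open>x\<close>, so
  these are the largest lower (smallest upper) semicontinuous minorant (majorant). Extended real
  values avoid any convention for maps that are not locally bounded.
\<close>

definition lsc_envelope :: "(real^'n::finite \<Rightarrow> real^'n) \<Rightarrow> real^'n \<Rightarrow> 'n \<Rightarrow> ereal" where
  "lsc_envelope f x i = Liminf (nhds x) (\<lambda>y. ereal (f y $ i))"

definition usc_envelope :: "(real^'n::finite \<Rightarrow> real^'n) \<Rightarrow> real^'n \<Rightarrow> 'n \<Rightarrow> ereal" where
  "usc_envelope f x i = Limsup (nhds x) (\<lambda>y. ereal (f y $ i))"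

definition envelope_box :: "(real^'n::finite \<Rightarrow> real^'n) \<Rightarrow> real^'n \<Rightarrow> (real^'n) set" where
  "envelope_box f x =
     {v. \<forall>i. lsc_envelope f x i \<le> ereal (v $ i) \<and> ereal (v $ i) \<le> usc_envelope f x i}"

subsection \<open>Velocity fields\<close>

definition cumulative :: "(real \<Rightarrow> real) \<Rightarrow> real \<Rightarrow> real" where
  "cumulative c t = (LINT r:{0..t}|lebesgue. c r)"

definition velocity_field ::
  "real \<Rightarrow> (real \<Rightarrow> real^'n::finite \<Rightarrow> real^'n) \<Rightarrow> (real \<Rightarrow> real) \<Rightarrow> (real \<Rightarrow> real) \<Rightarrow> bool" where
  "velocity_field T b C\<^sub>0 C\<^sub>1 \<longleftrightarrow>
     (\<lambda>(t, y). b t y) \<in> borel_measurable (lebesgue_on ({0..T} \<times> (UNIV :: (real^'n) set))) \<and>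
     C\<^sub>0 absolutely_integrable_on {0..T} \<and> (AE t\<in>{0..T} in lebesgue. 0 \<le> C\<^sub>0 t) \<and>
     C\<^sub>1 absolutely_integrable_on {0..T} \<and> (AE t\<in>{0..T} in lebesgue. 0 \<le> C\<^sub>1 t) \<and>
     (AE (t, y) in lebesgue_on ({0..T} \<times> (UNIV :: (real^'n) set)).
        norm (b t y) \<le> C\<^sub>0 t * (1 + norm y)) \<and>
     (AE t\<in>{0..T} in lebesgue. increasing_cadlag (\<lambda>x. b t x + C\<^sub>1 t *\<^sub>R x))"

subsection \<open>Solutions\<close>

definition absolutely_continuous_on :: "real set \<Rightarrow> (real \<Rightarrow> 'a::metric_space) \<Rightarrow> bool" where
  "absolutely_continuous_on S \<gamma> \<longleftrightarrow>
     (\<forall>\<epsilon>>0. \<exists>\<delta>>0. \<forall>I :: (real \<times> real) set.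
        finite I \<and> (\<forall>(u, v)\<in>I. u \<le> v \<and> {u..v} \<subseteq> S) \<and>
        pairwise (\<lambda>p q. {fst p<..<snd p} \<inter> {fst q<..<snd q} = {}) I \<and>
        (\<Sum>(u, v)\<in>I. v - u) < \<delta>
        \<longrightarrow> (\<Sum>(u, v)\<in>I. dist (\<gamma> u) (\<gamma> v)) < \<epsilon>)"

definition inclusion_solution ::
  "(real \<Rightarrow> real^'n::finite \<Rightarrow> real^'n) \<Rightarrow> real \<Rightarrow> real \<Rightarrow> real^'n \<Rightarrow> (real \<Rightarrow> real^'n) \<Rightarrow> bool" where
  "inclusion_solution b s T x \<gamma> \<longleftrightarrow>
     absolutely_continuous_on {s..T} \<gamma> \<and> \<gamma> s = x \<and>
     (AE t\<in>{s..T} in lebesgue. \<exists>v\<in>envelope_box (b t) (\<gamma> t).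
        (\<gamma> has_vector_derivative v) (at t within {s..T}))"

definition integral_solution ::
  "(real \<Rightarrow> real^'n::finite \<Rightarrow> real^'n) \<Rightarrow> real \<Rightarrow> real \<Rightarrow> real^'n \<Rightarrow> (real \<Rightarrow> real^'n) \<Rightarrow> bool" where
  "integral_solution b s T x \<gamma> \<longleftrightarrow>
     absolutely_continuous_on {s..T} \<gamma> \<and>
     (\<lambda>r. b r (\<gamma> r)) absolutely_integrable_on {s..T} \<and>
     (\<forall>t\<in>{s..T}. \<gamma> t = x + (LINT r:{s..t}|lebesgue. b r (\<gamma> r)))"

text \<open>Curves on \<open>S\<close> are total functions, so uniqueness is equality on \<open>S\<close>.\<close>

definition unique_curve :: "real set \<Rightarrow> ((real \<Rightarrow> 'a) \<Rightarrow> bool) \<Rightarrow> (real \<Rightarrow> 'a) \<Rightarrow> bool" where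
  "unique_curve S P \<gamma> \<longleftrightarrow> P \<gamma> \<and> (\<forall>\<gamma>'. P \<gamma>' \<longrightarrow> (\<forall>t\<in>S. \<gamma>' t = \<gamma> t))"

text \<open>
  \<open>\<phi> t s x\<close> is \<open>\<phi>\<^sub>t\<^sub>,\<^sub>s(x)\<close>. The solution is only determined for almost every \<open>x\<close>; outside a null
  set, depending on \<open>s\<close>, the values of \<open>\<phi>\<close> are arbitrary.
\<close>

definition inclusion_flow ::
  "(real \<Rightarrow> real^'n::finite \<Rightarrow> real^'n) \<Rightarrow> real \<Rightarrow> (real \<Rightarrow> real \<Rightarrow> real^'n \<Rightarrow> real^'n) \<Rightarrow> bool" where
  "inclusion_flow b T \<phi> \<longleftrightarrow>
     (\<forall>s\<in>{0..T}. AE x in lebesgue. inclusion_solution b s T x (\<lambda>t. \<phi> t s x))"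

subsection \<open>Locally integrable functions\<close>

text \<open>Elements of the space are represented by functions; equality is equality a.e.\<close>

definition L1loc :: "('a::euclidean_space \<Rightarrow> real) \<Rightarrow> bool" where
  "L1loc h \<longleftrightarrow> (\<forall>K. compact K \<longrightarrow> h absolutely_integrable_on K)"

definition Cc :: "('a::euclidean_space \<Rightarrow> real) \<Rightarrow> bool" where
  "Cc h \<longleftrightarrow> continuous_on UNIV h \<and> compact (closure {x. h x \<noteq> 0})"

definition L1_ball :: "real \<Rightarrow> ('a::euclidean_space \<Rightarrow> real) \<Rightarrow> real" where
  "L1_ball R h = (LINT x:ball 0 R|lebesgue. \<bar>h x\<bar>)"

text \<open>
  Continuity for the topology of the seminorms \<^const>\<open>L1_ball\<close>. These increase with the radius, so
  single balls give a neighbourhood base. Taking seminorms zero shows that such a map respects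
  equality a.e.
\<close>

definition L1loc_continuous :: "(('a::euclidean_space \<Rightarrow> real) \<Rightarrow> 'a \<Rightarrow> real) \<Rightarrow> bool" where
  "L1loc_continuous \<Phi> \<longleftrightarrow>
     (\<forall>h. L1loc h \<longrightarrow> L1loc (\<Phi> h)) \<and>
     (\<forall>g. L1loc g \<longrightarrow> (\<forall>R>0. \<forall>\<epsilon>>0. \<exists>R'>0. \<exists>\<delta>>0. \<forall>h.
        L1loc h \<and> L1_ball R' (\<lambda>x. h x - g x) < \<delta> \<longrightarrow> L1_ball R (\<lambda>x. \<Phi> h x - \<Phi> g x) < \<epsilon>))"

definition continuous_L1loc_extension ::
  "(('a::euclidean_space \<Rightarrow> real) \<Rightarrow> 'a \<Rightarrow> real) \<Rightarrow> (('a \<Rightarrow> real) \<Rightarrow> 'a \<Rightarrow> real) \<Rightarrow> bool" where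
  "continuous_L1loc_extension \<Phi>\<^sub>0 \<Phi> \<longleftrightarrow>
     L1loc_continuous \<Phi> \<and> (\<forall>h. Cc h \<longrightarrow> (AE x in lebesgue. \<Phi> h x = \<Phi>\<^sub>0 h x))"

text \<open>
  Membership of \<open>x \<mapsto> (t \<mapsto> F t x)\<close> in \<open>L\<^sup>1\<^sub>l\<^sub>o\<^sub>c(\<real>\<^sup>d, L\<^sup>1(A))\<close>: joint measurability stands for strong
  measurability of the \<open>L\<^sup>1(A)\<close>-valued map.
\<close>

definition L1loc_L1 :: "real set \<Rightarrow> (real \<Rightarrow> 'a::euclidean_space \<Rightarrow> 'b::euclidean_space) \<Rightarrow> bool" where
  "L1loc_L1 A F \<longleftrightarrow>
     (\<lambda>(t, x). F t x) \<in> borel_measurable (lebesgue_on (A \<times> (UNIV :: 'a set))) \<and>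
     (AE x in lebesgue. (\<lambda>t. F t x) absolutely_integrable_on A) \<and>
     L1loc (\<lambda>x. LINT t:A|lebesgue. norm (F t x))"

end

theory Submission
  imports Defs
begin

text \<open>
  Why the theorem is true. Fix the initial time \<open>s\<close>. With the integrating factor
  \<open>exp (\<integral>\<^sub>s\<^sup>t C\<^sub>1)\<close> a solution of the inclusion becomes a solution \<open>\<Gamma>\<close> of an inclusion for a field \<open>B\<close>
  that is increasing in space, jointly Borel measurable and right continuous. Monotonicity then
  replaces compactness, mollification and the classical theory of smooth flows.

  \<^emph>\<open>Existence.\<close> Picard iteration started from an explicit upper barrier is a decreasing sequence.
  Because the cadlag representative is right continuous, its limit solves the integral equation
  \<open>\<Phi>\<^sub>t(x) = x + \<integral>\<^sub>s\<^sup>t B(r, \<Phi>\<^sub>r(x)) dr\<close>, and this for every \<open>x\<close> (\<open>exact_solutions_exist\<close>).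

  \<^emph>\<open>Uniqueness.\<close> Let \<open>\<Gamma>\<close> solve the inclusion from \<open>x\<close>, and let \<open>y\<close> be larger than \<open>x\<close> in every
  coordinate. As long as \<open>\<Gamma>\<close> is below \<open>\<Phi>(y)\<close> in every coordinate, \<open>B\<close> being increasing makes
  \<open>\<Phi>(y) - \<Gamma>\<close> nondecreasing, so the gap never closes (\<open>gap_persists\<close>). Hence every
  solution from \<open>x\<close> is caught between \<open>\<Phi>\<^sub>t(x - d1)\<close> and \<open>\<Phi>\<^sub>t(x + d1)\<close> for all \<open>d > 0\<close>, where \<open>1\<close> is the vector
  of ones. Along a diagonal line \<open>\<Phi>\<^sub>t\<close> is monotone and has countably many jumps; by Tonelli's theorem
  almost every \<open>x\<close> is not a jump (\<open>AE_jump_free_on_diagonal\<close>), and there the solution is unique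
  at time \<open>t\<close>. Countably many times suffice, by continuity.

  \<^emph>\<open>Compression.\<close> Consider the Euler scheme that updates one coordinate at a time. One such update
  translates \<open>x\<close> along a coordinate axis by an increasing function of \<open>x\<close>; it expands every line
  parallel to that axis, so that preimages of Borel sets do not gain volume
  (\<open>emeasure_directional_shift_preimage_le\<close>). The comparison argument also shows that the scheme
  converges to \<open>\<Phi>\<^sub>t\<close> at every point that is not a jump, whence \<open>\<Phi>\<^sub>t\<close> has the same property
  (\<open>emeasure_flow_preimage_le\<close>). Undoing the integrating factor contributes
  the factor \<open>exp (d \<integral>\<^sub>s\<^sup>t C\<^sub>1)\<close>; the radius of the larger ball comes from
  Gronwall's inequality.

  As \<open>b(t, y)\<close> lies in its own box of envelopes, Lebesgue's differentiation theorem shows that solutions of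
  the integral equation solve the inclusion. The existence part produces solutions of the integral
  equation; where the inclusion has only one solution, these are it. The semigroup property follows from
  uniqueness, as preimages of null sets under the flow are null.
\<close>

section \<open>Absolutely continuous curves\<close>

definition nonoverlapping_intervals :: "real set \<Rightarrow> real \<Rightarrow> (real \<times> real) set \<Rightarrow> bool" where
  "nonoverlapping_intervals S \<delta> I \<longleftrightarrow> finite I \<and> (\<forall>(u, v)\<in>I. u \<le> v \<and> {u..v} \<subseteq> S) \<and>
     pairwise (\<lambda>p q. {fst p<..<snd p} \<inter> {fst q<..<snd q} = {}) I \<and> (\<Sum>(u, v)\<in>I. v - u) < \<delta>"

lemma absolutely_continuous_on_iff:
  "absolutely_continuous_on S f \<longleftrightarrow> (\<forall>\<epsilon>>0. \<exists>\<delta>>0. \<forall>I. nonoverlapping_intervals S \<delta> I \<longrightarrow>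
     (\<Sum>(u, v)\<in>I. dist (f u) (f v)) < \<epsilon>)"
  unfolding absolutely_continuous_on_def nonoverlapping_intervals_def ..

lemma absolutely_continuous_on_subset:
  assumes "absolutely_continuous_on S f" "R \<subseteq> S"
  shows "absolutely_continuous_on R f"
proof -
  have "nonoverlapping_intervals S \<delta> I" if "nonoverlapping_intervals R \<delta> I" for \<delta> I
    using that assms(2) unfolding nonoverlapping_intervals_def by fastforce
  then show ?thesis using assms(1) unfolding absolutely_continuous_on_iff by meson
qed

text \<open>
  One statement for sums, for products of bounded factors and for Lipschitz images: all that matters
  is that the increments are controlled.
\<close>

lemma absolutely_continuous_on_dominated:
  fixes f :: "real \<Rightarrow> 'a::metric_space" and g :: "real \<Rightarrow> 'b::metric_space" and h :: "real \<Rightarrow> 'c::metric_space"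
  assumes g: "absolutely_continuous_on S g" and h: "absolutely_continuous_on S h"
    and K: "\<And>u v. u \<in> S \<Longrightarrow> v \<in> S \<Longrightarrow> dist (f u) (f v) \<le> K * (dist (g u) (g v) + dist (h u) (h v))"
  shows "absolutely_continuous_on S f"
  unfolding absolutely_continuous_on_iff
proof (intro allI impI)
  fix \<epsilon> :: real assume "\<epsilon> > 0"
  define e where "e = \<epsilon> / (2 * (\<bar>K\<bar> + 1))"
  have "e > 0" using \<open>\<epsilon> > 0\<close> by (simp add: e_def add_nonneg_pos)
  obtain d1 where d1: "d1 > 0" and D1: "\<And>I. nonoverlapping_intervals S d1 I \<Longrightarrow>
     (\<Sum>(u, v)\<in>I. dist (g u) (g v)) < e"
    using g \<open>e > 0\<close> unfolding absolutely_continuous_on_iff by meson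
  obtain d2 where d2: "d2 > 0" and D2: "\<And>I. nonoverlapping_intervals S d2 I \<Longrightarrow>
     (\<Sum>(u, v)\<in>I. dist (h u) (h v)) < e"
    using h \<open>e > 0\<close> unfolding absolutely_continuous_on_iff by meson
  show "\<exists>\<delta>>0. \<forall>I. nonoverlapping_intervals S \<delta> I \<longrightarrow> (\<Sum>(u, v)\<in>I. dist (f u) (f v)) < \<epsilon>"
  proof (intro exI[of _ "min d1 d2"] conjI allI impI)
    show "min d1 d2 > 0" using d1 d2 by simp
    fix I assume I: "nonoverlapping_intervals S (min d1 d2) I"
    have 1: "(\<Sum>(u, v)\<in>I. dist (g u) (g v)) < e"
      by (rule D1) (use I in \<open>simp add: nonoverlapping_intervals_def\<close>)
    have 2: "(\<Sum>(u, v)\<in>I. dist (h u) (h v)) < e"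
      by (rule D2) (use I in \<open>simp add: nonoverlapping_intervals_def\<close>)
    have "(\<Sum>(u, v)\<in>I. dist (f u) (f v)) \<le> (\<Sum>(u, v)\<in>I. (\<bar>K\<bar> + 1) * (dist (g u) (g v) + dist (h u) (h v)))"
    proof (rule sum_mono, clarify)
      fix u v assume "(u, v) \<in> I"
      then have "u \<in> S" "v \<in> S" using I unfolding nonoverlapping_intervals_def by fastforce+
      then have "dist (f u) (f v) \<le> K * (dist (g u) (g v) + dist (h u) (h v))" by (rule K)
      also have "\<dots> \<le> (\<bar>K\<bar> + 1) * (dist (g u) (g v) + dist (h u) (h v))"
        by (intro mult_right_mono) auto
      finally show "dist (f u) (f v) \<le> (\<bar>K\<bar> + 1) * (dist (g u) (g v) + dist (h u) (h v))" .
    qed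
    also have "\<dots> = (\<bar>K\<bar> + 1) * ((\<Sum>(u, v)\<in>I. dist (g u) (g v)) + (\<Sum>(u, v)\<in>I. dist (h u) (h v)))"
      by (simp add: sum_distrib_left sum.distrib[symmetric] split_beta)
    also have "\<dots> < (\<bar>K\<bar> + 1) * (e + e)"
      using 1 2 by (intro mult_strict_left_mono) auto
    also have "\<dots> = \<epsilon>" using abs_ge_zero[of K] unfolding e_def by (simp add: divide_simps)
    finally show "(\<Sum>(u, v)\<in>I. dist (f u) (f v)) < \<epsilon>" .
  qed
qed

lemma absolutely_continuous_on_imp_continuous_on:
  fixes f :: "real \<Rightarrow> 'a::metric_space"
  assumes "absolutely_continuous_on {a..b} f"
  shows "continuous_on {a..b} f"
  unfolding continuous_on_iff
proof (intro ballI allI impI)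
  fix x \<epsilon> :: real assume x: "x \<in> {a..b}" and "\<epsilon> > 0"
  then obtain d where d: "d > 0" and D: "\<And>I. nonoverlapping_intervals {a..b} d I \<Longrightarrow>
     (\<Sum>(u, v)\<in>I. dist (f u) (f v)) < \<epsilon>"
    using assms unfolding absolutely_continuous_on_iff by meson
  show "\<exists>d>0. \<forall>x'\<in>{a..b}. dist x' x < d \<longrightarrow> dist (f x') (f x) < \<epsilon>"
  proof (intro exI[of _ d] conjI ballI impI d)
    fix y assume y: "y \<in> {a..b}" "dist y x < d"
    have "(\<Sum>(u, v)\<in>{(min x y, max x y)}. dist (f u) (f v)) < \<epsilon>"
      by (rule D) (use x y in \<open>auto simp: dist_real_def nonoverlapping_intervals_def\<close>)
    then show "dist (f y) (f x) < \<epsilon>"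
      by (auto simp: min_def max_def dist_commute split: if_splits)
  qed
qed

text \<open>
  Integrability of the derivative is part of the conclusion. The gauge is chosen by differentiability off \<open>N\<close>;
  on \<open>N\<close> it forces the tagged intervals into an open set so short that, by absolute
  continuity, \<open>f\<close> changes little over all of them together.
\<close>

theorem fundamental_theorem_of_calculus_absolutely_continuous:
  fixes f :: "real \<Rightarrow> 'a::euclidean_space"
  assumes ab: "a \<le> b" and ac: "absolutely_continuous_on {a..b} f" and N: "negligible N"
    and der: "\<And>x. x \<in> {a..b} - N \<Longrightarrow> (f has_vector_derivative f' x) (at x within {a..b})"
  shows "(f' has_integral (f b - f a)) {a..b}"
proof -
  define g where "g x = (if x \<in> N then 0 else f' x)" for x
  have "(g has_integral (f b - f a)) {a..b}"
    unfolding has_integral_real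
  proof (intro allI impI)
    fix e :: real assume "e > 0"
    define \<eta> where "\<eta> = e / (2 * (b - a + 1))"
    have "\<eta> > 0" using \<open>e > 0\<close> ab by (simp add: \<eta>_def)
    have "\<exists>d>0. x \<in> {a..b} - N \<longrightarrow>
         (\<forall>y\<in>{a..b}. norm (y-x) < d \<longrightarrow> norm (f y - f x - (y-x) *\<^sub>R f' x) \<le> \<eta> * norm (y-x))" for x
    proof (cases "x \<in> {a..b} - N")
      case True
      then show ?thesis
        using der[OF True, unfolded has_vector_derivative_def has_derivative_within_alt] \<open>\<eta> > 0\<close> by blast
    next
      case False
      show ?thesis by (rule exI[of _ 1]) (use False in auto)
    qed
    then obtain d where "\<forall>x. 0 < d x \<and> (x \<in> {a..b} - N \<longrightarrow>
         (\<forall>y\<in>{a..b}. norm (y-x) < d x \<longrightarrow> norm (f y - f x - (y-x) *\<^sub>R f' x) \<le> \<eta> * norm (y-x)))"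
      using choice[of "\<lambda>x d. 0 < d \<and> (x \<in> {a..b} - N \<longrightarrow>
         (\<forall>y\<in>{a..b}. norm (y-x) < d \<longrightarrow> norm (f y - f x - (y-x) *\<^sub>R f' x) \<le> \<eta> * norm (y-x)))"] by blast
    then have d: "\<And>x. 0 < d x"
      "\<And>x y. \<lbrakk>x \<in> {a..b} - N; y \<in> {a..b}; norm (y-x) < d x\<rbrakk>
              \<Longrightarrow> norm (f y - f x - (y-x) *\<^sub>R f' x) \<le> \<eta> * norm (y-x)"
      by blast+
    obtain \<delta> where "\<delta> > 0" and \<delta>: "\<And>I. nonoverlapping_intervals {a..b} \<delta> I \<Longrightarrow>
        (\<Sum>(u, v)\<in>I. dist (f u) (f v)) < e / 2"
      using ac half_gt_zero[OF \<open>e > 0\<close>] unfolding absolutely_continuous_on_iff by meson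
    have "N \<in> sets lebesgue" "emeasure lebesgue N = 0"
      using N by (auto simp: negligible_iff_null_sets)
    obtain U where U: "open U" "N \<subseteq> U" "U - N \<in> lmeasurable" "emeasure lebesgue (U - N) < ennreal \<delta>"
      using sets_lebesgue_outer_open[OF \<open>N \<in> sets lebesgue\<close> \<open>\<delta> > 0\<close>] by metis
    have UN: "U = (U - N) \<union> N" using U by blast
    have Um: "U \<in> lmeasurable"
      by (subst UN) (intro fmeasurable.Un U negligible_imp_measurable N)
    have "emeasure lebesgue (U - N \<union> N) = emeasure lebesgue (U - N)"
      using emeasure_Un_null_set[of "U - N" lebesgue N] U N
      by (simp add: negligible_iff_null_sets fmeasurableD)
    then have Ueq: "emeasure lebesgue U < ennreal \<delta>"
      using U(4) UN by metis
    have Uless: "measure lebesgue U < \<delta>"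
      using Ueq Um \<open>\<delta> > 0\<close> by (simp add: emeasure_eq_measure2 ennreal_less_iff)
    \<comment> \<open>The tags in the null set are confined to the short open set \<open>U\<close>.\<close>
    define \<gamma> where "\<gamma> x = (if x \<in> N then U else ball x (d x))" for x
    have "gauge \<gamma>"
      using U d by (auto simp: gauge_def \<gamma>_def)
    show "\<exists>\<gamma>. gauge \<gamma> \<and> (\<forall>\<D>. \<D> tagged_division_of {a..b} \<and> \<gamma> fine \<D> \<longrightarrow>
            norm ((\<Sum>(x, k)\<in>\<D>. measure lborel k *\<^sub>R g x) - (f b - f a)) < e)"
    proof (intro exI[of _ \<gamma>] conjI allI impI)
      show "gauge \<gamma>" by fact
      fix p assume p: "p tagged_division_of {a..b} \<and> \<gamma> fine p"
      then have ptag: "p tagged_division_of {a..b}" and fine: "\<gamma> fine p" by auto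
      have finp: "finite p" using ptag by blast
      define q where "q = {xk \<in> p. fst xk \<in> N}"
      have K: "\<exists>u v. K = {u..v} \<and> u \<le> v \<and> x \<in> {u..v} \<and> {u..v} \<subseteq> {a..b}" if "(x, K) \<in> p" for x K
        using tagged_division_ofD(2-4)[OF ptag that] by (auto simp: box_real)
      have ba: "f b - f a = (\<Sum>(x,K)\<in>p. f(Sup K) - f(Inf K))" "b - a = (\<Sum>(x,K)\<in>p. Sup K - Inf K)"
        using additive_tagged_division_1[where f= "\<lambda>x. x"] additive_tagged_division_1[where f= f]
            ab ptag by auto
      have "norm ((\<Sum>(x, k)\<in>p. measure lborel k *\<^sub>R g x) - (f b - f a))
          = norm (\<Sum>(x, k)\<in>p. measure lborel k *\<^sub>R g x - (f (Sup k) - f (Inf k)))"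
        by (simp add: ba(1) sum_subtractf split_beta)
      also have "\<dots> \<le> (\<Sum>(x,k)\<in>p. \<eta> * (Sup k - Inf k) + (if x \<in> N then dist (f (Inf k)) (f (Sup k)) else 0))"
      proof (rule sum_norm_le, clarify)
        fix x k assume xk: "(x, k) \<in> p"
        then obtain u v where uv: "k = {u..v}" "u \<le> v" "x \<in> {u..v}" "{u..v} \<subseteq> {a..b}" using K by blast
        show "norm (measure lborel k *\<^sub>R g x - (f (Sup k) - f (Inf k)))
              \<le> \<eta> * (Sup k - Inf k) + (if x \<in> N then dist (f (Inf k)) (f (Sup k)) else 0)"
        proof (cases "x \<in> N")
          case True
          then show ?thesis using uv \<open>\<eta> > 0\<close> by (simp add: g_def dist_norm norm_minus_commute)
        next
          case False
          have "k \<subseteq> ball x (d x)" using fine xk False by (force simp: fine_def \<gamma>_def)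
          then have dl: "norm (u - x) < d x" "norm (v - x) < d x"
            using subsetD[OF \<open>k \<subseteq> ball x (d x)\<close>, of u] subsetD[OF \<open>k \<subseteq> ball x (d x)\<close>, of v] uv
            by (simp_all add: dist_real_def)
          have xab: "x \<in> {a..b} - N" "u \<in> {a..b}" "v \<in> {a..b}" using uv False by auto
          have "norm ((v - u) *\<^sub>R f' x - (f v - f u)) = norm ((f u - f x - (u-x) *\<^sub>R f' x) - (f v - f x - (v-x) *\<^sub>R f' x))"
            by (simp add: algebra_simps)
          also have "\<dots> \<le> \<eta> * norm (u - x) + \<eta> * norm (v - x)"
            by (intro order_trans[OF norm_triangle_ineq4] add_mono d(2) dl xab)
          also have "\<dots> = \<eta> * (v - u)" using uv by (simp add: algebra_simps)
          finally show ?thesis using False uv by (simp add: g_def)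
        qed
      qed
      also have "\<dots> = \<eta> * (b - a) + (\<Sum>(x,k)\<in>q. dist (f (Inf k)) (f (Sup k)))"
      proof -
        have "(\<Sum>(x,k)\<in>p. (if x \<in> N then dist (f (Inf k)) (f (Sup k)) else 0)) = (\<Sum>(x,k)\<in>q. dist (f (Inf k)) (f (Sup k)))"
          unfolding q_def using finp by (simp add: split_beta sum.inter_filter)
        then show ?thesis unfolding ba(2) by (simp add: sum.distrib sum_distrib_left split_beta)
      qed
      also have "(\<Sum>(x,k)\<in>q. dist (f (Inf k)) (f (Sup k))) < e / 2"
      proof -
        have qp: "q \<subseteq> p" by (auto simp: q_def)
        have qtag: "q tagged_partial_division_of {a..b}"
          using ptag qp by (meson tagged_division_of_def tagged_partial_division_subset)
        have injs: "inj_on (\<lambda>(x,k). (Inf k, Sup k)) q"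
        proof (rule inj_onI, clarify)
          fix x k y l assume xk: "(x, k) \<in> q" and yl: "(y, l) \<in> q" and eq: "Inf k = Inf l" "Sup k = Sup l"
          obtain u v where uv: "k = {u..v}" "u \<le> v" "x \<in> {u..v}" using K xk qp by blast
          obtain u' v' where uv': "l = {u'..v'}" "u' \<le> v'" "y \<in> {u'..v'}" using K yl qp by blast
          have kl: "k = l" using eq uv uv' by simp
          have "x = y"
          proof (rule ccontr)
            assume "x \<noteq> y"
            then have "interior k \<inter> interior l = {}"
              using tagged_partial_division_ofD(5)[OF qtag xk yl] by auto
            then have "u = v" using kl uv by (auto simp: )
            then show False using uv uv' kl \<open>x \<noteq> y\<close> by auto
          qed
          then show "x = y \<and> k = l" using kl by simp
        qed
        define I where "I = (\<lambda>(x,k). (Inf k, Sup k)) ` q"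
        have "(\<Sum>(u,v)\<in>I. dist (f u) (f v)) < e / 2"
        proof (rule \<delta>, unfold nonoverlapping_intervals_def, intro conjI)
          show "finite I" unfolding I_def q_def using finp by auto
          show "\<forall>(u, v)\<in>I. u \<le> v \<and> {u..v} \<subseteq> {a..b}"
          proof clarify
            fix u v assume "(u, v) \<in> I"
            then obtain x k where xk: "(x, k) \<in> q" and uv: "u = Inf k" "v = Sup k"
              unfolding I_def by auto
            from xk qp have "(x, k) \<in> p" by auto
            from K[OF this] show "u \<le> v \<and> {u..v} \<subseteq> {a..b}" using uv by auto
          qed
          show "pairwise (\<lambda>p q. {fst p<..<snd p} \<inter> {fst q<..<snd q} = {}) I"
          proof (rule pairwiseI)
            fix P Q assume PQ: "P \<in> I" "Q \<in> I" "P \<noteq> Q"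
            from PQ(1) obtain x k where xk: "(x, k) \<in> q" and P: "P = (Inf k, Sup k)" unfolding I_def by auto
            from PQ(2) obtain y l where yl: "(y, l) \<in> q" and Q: "Q = (Inf l, Sup l)" unfolding I_def by auto
            have ne: "(x, k) \<noteq> (y, l)" using PQ P Q by auto
            obtain u v where uv: "k = {u..v}" "u \<le> v" "x \<in> {u..v}" using K xk qp by blast
            obtain u' v' where uv': "l = {u'..v'}" "u' \<le> v'" "y \<in> {u'..v'}" using K yl qp by blast
            have "interior k \<inter> interior l = {}"
              using tagged_partial_division_ofD(5)[OF qtag xk yl] ne by metis
            then show "{fst P<..<snd P} \<inter> {fst Q<..<snd Q} = {}"
              using uv uv' P Q by simp
          qed
          have "(\<Sum>(u,v)\<in>I. v - u) = (\<Sum>(x,k)\<in>q. Sup k - Inf k)"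
            unfolding I_def by (subst sum.reindex[OF injs]) (simp add: split_beta comp_def)
          also have "\<dots> = (\<Sum>(x,k)\<in>q. measure lebesgue k)"
          proof (rule sum.cong[OF refl], clarify)
            fix x k assume "(x, k) \<in> q"
            then have "(x, k) \<in> p" using qp by auto
            from K[OF this] obtain u v where "k = {u..v}" "u \<le> v" by blast
            then show "Sup k - Inf k = measure lebesgue k" by simp
          qed
          also have "\<dots> = (\<Sum>k\<in>snd ` q. measure lebesgue k)"
            using injs by (subst sum.reindex) (auto simp: inj_on_def split_beta comp_def)
          also have "\<dots> = measure lebesgue (\<Union> (snd ` q))"
            by (rule content_division[OF partial_division_of_tagged_division[OF qtag]])
          also have "\<dots> \<le> measure lebesgue U"
          proof (rule measure_mono_fmeasurable[OF _ _ Um])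
            show "\<Union> (snd ` q) \<subseteq> U" using fine qp by (force simp: fine_def \<gamma>_def q_def)
            show "\<Union> (snd ` q) \<in> sets lebesgue"
              by (rule fmeasurableD[OF lmeasurable_division[OF partial_division_of_tagged_division[OF qtag]]])
          qed
          also have "\<dots> < \<delta>" by (rule Uless)
          finally show "(\<Sum>(u,v)\<in>I. v - u) < \<delta>" .
        qed
        then show ?thesis
          unfolding I_def by (subst (asm) sum.reindex[OF injs]) (simp add: split_beta comp_def)
      qed
      also have "\<eta> * (b - a) + e / 2 \<le> e"
        using ab \<open>e > 0\<close> by (simp add: \<eta>_def field_simps)
      finally show "norm ((\<Sum>(x, k)\<in>p. measure lborel k *\<^sub>R g x) - (f b - f a)) < e" by simp
    qed
  qed
  then show ?thesis
    by (rule has_integral_spike[OF N, rotated]) (auto simp: g_def)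
qed

section \<open>Lebesgue differentiation on the line\<close>

text \<open>
  Henstock's lemma bounds the sum of the errors \<open>|(v - u) f t - \<integral>\<^sub>u\<^sup>v f|\<close> over any fine family of
  nonoverlapping tagged intervals, hence the total length of those whose error exceeds \<open>\<alpha> (v - u)\<close>. Vitali's
  covering theorem turns this into a bound for the outer measure of the set of their tags.
\<close>

lemma negligible_bad_difference_quotients:
  fixes f :: "real \<Rightarrow> 'a::euclidean_space"
  assumes int: "f integrable_on {a..b}" and "\<alpha> > 0"
  shows "negligible {t. \<forall>d>0. \<exists>u v. a \<le> u \<and> u < v \<and> v \<le> b \<and> t \<in> {u..v} \<and> v - u < d \<and>
           \<alpha> * (v - u) < norm ((v - u) *\<^sub>R f t - integral {u..v} f)}" (is "negligible ?S")
  unfolding negligible_outer_le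
proof (intro allI impI)
  fix e :: real assume "e > 0"
  \<comment> \<open>The factor 2 is the ratio between the length of a ball around the tag that contains the interval and that of the interval.\<close>
  define \<epsilon> where "\<epsilon> = e * \<alpha> / 2"
  have "\<epsilon> > 0" using \<open>e > 0\<close> \<open>\<alpha> > 0\<close> by (simp add: \<epsilon>_def)
  have int': "f integrable_on cbox a b" using int by simp
  obtain \<gamma> where \<gamma>: "gauge \<gamma>" and hen: "\<And>p. p tagged_partial_division_of (cbox a b) \<Longrightarrow> \<gamma> fine p \<Longrightarrow>
     (\<Sum>(x,k)\<in>p. norm (measure lborel k *\<^sub>R f x - integral k f)) < \<epsilon>"
    by (rule Henstock_lemma[OF int' \<open>\<epsilon> > 0\<close>]) blast
  define K where "K = {(t,u,v). a \<le> u \<and> u < v \<and> v \<le> b \<and> t \<in> {u..v} \<and> {u..v} \<subseteq> \<gamma> t \<and>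
           \<alpha> * (v - u) < norm ((v - u) *\<^sub>R f t - integral {u..v} f)}"
  define ctr :: "real \<times> real \<times> real \<Rightarrow> real" where "ctr = (\<lambda>(t,u,v). t)"
  define rad :: "real \<times> real \<times> real \<Rightarrow> real" where "rad = (\<lambda>(t,u,v). v - u)"
  have vit: "\<exists>i. i \<in> K \<and> t \<in> ball (ctr i) (rad i) \<and> rad i < d" if t: "t \<in> ?S" and d: "0 < d" for t d
  proof -
    from \<gamma> have "open (\<gamma> t)" "t \<in> \<gamma> t" by (auto simp: gauge_def)
    then obtain r where r: "r > 0" "ball t r \<subseteq> \<gamma> t" using open_contains_ball by blast
    have "min d r > 0" using d r by simp
    with t obtain u v where uv: "a \<le> u" "u < v" "v \<le> b" "t \<in> {u..v}" "v - u < min d r"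
           "\<alpha> * (v - u) < norm ((v - u) *\<^sub>R f t - integral {u..v} f)"
      by blast
    have "{u..v} \<subseteq> ball t r" using uv by (auto simp: dist_real_def)
    then have "(t,u,v) \<in> K" using uv r by (auto simp: K_def)
    then show ?thesis using uv by (intro exI[of _ "(t,u,v)"]) (auto simp: ctr_def rad_def)
  qed
  obtain C where C: "countable C" "C \<subseteq> K"
     "pairwise (\<lambda>i j. disjnt (ball (ctr i) (rad i)) (ball (ctr j) (rad j))) C"
     "negligible (?S - (\<Union>i \<in> C. ball (ctr i) (rad i)))"
    by (rule Vitali_covering_theorem_balls[of ?S K ctr rad, OF vit])
  have bnd: "measure lebesgue (\<Union>i\<in>C'. ball (ctr i) (rad i)) \<le> e" if C': "C' \<subseteq> C" "finite C'" for C'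
  proof -
    define \<phi> where "\<phi> = (\<lambda>(t,u,v). (t::real, {u..v::real}))"
    have inj: "inj_on \<phi> C'"
      using C' C(2) by (auto simp: inj_on_def \<phi>_def K_def)
    have tag: "\<phi> ` C' tagged_partial_division_of (cbox a b)"
      unfolding tagged_partial_division_of_def
    proof (intro conjI allI impI)
      show "finite (\<phi> ` C')" using C' by simp
      show "x \<in> k" if "(x,k) \<in> \<phi> ` C'" for x k
        using that C' C(2) by (force simp: \<phi>_def K_def)
      show "k \<subseteq> cbox a b" if "(x,k) \<in> \<phi> ` C'" for x k
        using that C' C(2) by (force simp: \<phi>_def K_def)
      show "\<exists>a b. k = cbox a b" if "(x,k) \<in> \<phi> ` C'" for x k
        using that by (force simp: \<phi>_def)
      show "interior k1 \<inter> interior k2 = {}"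
        if "(x1,k1) \<in> \<phi> ` C' \<and> (x2,k2) \<in> \<phi> ` C' \<and> (x1,k1) \<noteq> (x2,k2)" for x1 k1 x2 k2
      proof -
        from that obtain i j where ij: "i \<in> C'" "j \<in> C'" "(x1,k1) = \<phi> i" "(x2,k2) = \<phi> j" by blast
        then have "i \<noteq> j" using that by auto
        then have dis: "disjnt (ball (ctr i) (rad i)) (ball (ctr j) (rad j))"
          using C(3) ij C' unfolding pairwise_def by blast
        have sub: "interior k \<subseteq> ball (ctr l) (rad l)" if "l \<in> C'" "(x,k) = \<phi> l" for l x k
        proof -
          obtain t u v where l: "l = (t,u,v)" by (cases l)
          have "(t,u,v) \<in> K" using that l C' C(2) by auto
          then show ?thesis using that l
            by (auto simp: \<phi>_def K_def ctr_def rad_def dist_real_def)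
        qed
        show ?thesis using dis sub[OF ij(1,3)] sub[OF ij(2,4)] unfolding disjnt_def by blast
      qed
    qed
    have fine: "\<gamma> fine \<phi> ` C'"
      using C' C(2) by (fastforce simp: fine_def \<phi>_def K_def)
    have "measure lebesgue (\<Union>i\<in>C'. ball (ctr i) (rad i)) \<le> (\<Sum>i\<in>C'. measure lebesgue (ball (ctr i) (rad i)))"
      by (rule measure_UNION_le) (use C' in auto)
    also have "\<dots> = (\<Sum>i\<in>C'. 2 * rad i)"
    proof (rule sum.cong[OF refl])
      fix i assume "i \<in> C'"
      then have "rad i > 0" using C' C(2) by (auto simp: K_def rad_def)
      then show "measure lebesgue (ball (ctr i) (rad i)) = 2 * rad i"
        by (simp add: ball_eq_greaterThanLessThan)
    qed
    also have "\<dots> \<le> (\<Sum>i\<in>C'. (2 / \<alpha>) * (case \<phi> i of (x,k) \<Rightarrow> norm (measure lborel k *\<^sub>R f x - integral k f)))"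
    proof (rule sum_mono)
      fix i assume "i \<in> C'"
      moreover obtain t u v where l: "i = (t,u,v)" by (cases i)
      ultimately have "(t,u,v) \<in> K" using C' C(2) by auto
      then have "\<alpha> * (v - u) \<le> norm ((v - u) *\<^sub>R f t - integral {u..v} f)" "u < v" by (auto simp: K_def)
      then have "(2 / \<alpha>) * (\<alpha> * (v - u)) \<le> (2 / \<alpha>) * norm ((v - u) *\<^sub>R f t - integral {u..v} f)"
        using \<open>\<alpha> > 0\<close> by (intro mult_left_mono) auto
      then show "2 * rad i \<le> (2 / \<alpha>) * (case \<phi> i of (x,k) \<Rightarrow> norm (measure lborel k *\<^sub>R f x - integral k f))"
        using \<open>\<alpha> > 0\<close> \<open>u < v\<close> by (simp add: l rad_def \<phi>_def)
    qed
    also have "\<dots> = (2 / \<alpha>) * (\<Sum>(x,k)\<in>\<phi> ` C'. norm (measure lborel k *\<^sub>R f x - integral k f))"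
      by (subst sum.reindex[OF inj]) (simp add: sum_distrib_left comp_def)
    also have "\<dots> \<le> (2 / \<alpha>) * \<epsilon>"
      by (rule mult_left_mono[OF less_imp_le[OF hen[OF tag fine]]]) (use \<open>\<alpha> > 0\<close> in simp)
    also have "\<dots> = e" using \<open>\<alpha> > 0\<close> by (simp add: \<epsilon>_def)
    finally show ?thesis .
  qed
  define T where "T = (\<Union>i\<in>C. ball (ctr i) (rad i))"
  have Tm: "T \<in> lmeasurable" and Te: "measure lebesgue T \<le> e"
    unfolding T_def
    by (rule fmeasurable_UN_bound[OF C(1) _ bnd] measure_UN_bound[OF C(1) _ bnd]; simp)+
  show "\<exists>T. ?S \<subseteq> T \<and> T \<in> lmeasurable \<and> measure lebesgue T \<le> e"
  proof (intro exI conjI)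
    show "?S \<subseteq> T \<union> (?S - T)" by blast
    have neg: "negligible (?S - T)" using C(4) by (simp add: T_def)
    show "T \<union> (?S - T) \<in> lmeasurable"
      by (intro fmeasurable.Un Tm negligible_imp_measurable neg)
    have "measure lebesgue (T \<union> (?S - T)) \<le> measure lebesgue T + measure lebesgue (?S - T)"
      by (intro measure_Un_le fmeasurableD Tm negligible_imp_measurable neg)
    then show "measure lebesgue (T \<union> (?S - T)) \<le> e"
      using Te negligible_imp_measure0[OF neg] by simp
  qed
qed

theorem Lebesgue_differentiation_indefinite_integral:
  fixes f :: "real \<Rightarrow> 'a::euclidean_space"
  assumes int: "f integrable_on {a..b}"
  obtains N where "negligible N"
    "\<And>t. t \<in> {a..b} - N \<Longrightarrow> ((\<lambda>u. integral {a..u} f) has_vector_derivative f t) (at t within {a..b})"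
proof
  define S where "S \<alpha> = {t. \<forall>d>0. \<exists>u v. a \<le> u \<and> u < v \<and> v \<le> b \<and> t \<in> {u..v} \<and> v - u < d \<and>
           \<alpha> * (v - u) < norm ((v - u) *\<^sub>R f t - integral {u..v} f)}" for \<alpha>
  show "negligible (\<Union>n. S (inverse (real (Suc n))))"
    unfolding S_def by (intro negligible_countable_Union[of "range _"] negligible_Union_nat negligible_bad_difference_quotients[OF int]) simp
  fix t assume t: "t \<in> {a..b} - (\<Union>n. S (inverse (real (Suc n))))"
  show "((\<lambda>u. integral {a..u} f) has_vector_derivative f t) (at t within {a..b})"
    unfolding has_vector_derivative_def has_derivative_within_alt
  proof (intro conjI allI impI)
    show "bounded_linear (\<lambda>x. x *\<^sub>R f t)" by (rule bounded_linear_scaleR_left)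
    fix e :: real assume "e > 0"
    obtain n where n: "inverse (real (Suc n)) < e" using reals_Archimedean[OF \<open>e > 0\<close>] by blast
    have "t \<notin> S (inverse (real (Suc n)))" using t by blast
    then obtain d where "d > 0" and nd: "\<not> (\<exists>u v. a \<le> u \<and> u < v \<and> v \<le> b \<and> t \<in> {u..v} \<and> v - u < d \<and>
           inverse (real (Suc n)) * (v - u) < norm ((v - u) *\<^sub>R f t - integral {u..v} f))"
      unfolding S_def by blast
    from nd have d: "\<And>u v. a \<le> u \<Longrightarrow> u < v \<Longrightarrow> v \<le> b \<Longrightarrow> t \<in> {u..v} \<Longrightarrow> v - u < d \<Longrightarrow>
        norm ((v - u) *\<^sub>R f t - integral {u..v} f) \<le> inverse (real (Suc n)) * (v - u)"
      by (meson not_less)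
    have int2: "f integrable_on {u..v}" if "a \<le> u" "v \<le> b" for u v
      by (rule integrable_on_subinterval[OF int]) (use that in auto)
    show "\<exists>d>0. \<forall>y\<in>{a..b}. norm (y - t) < d \<longrightarrow>
            norm (integral {a..y} f - integral {a..t} f - (y - t) *\<^sub>R f t) \<le> e * norm (y - t)"
    proof (intro exI[of _ d] conjI ballI impI \<open>d > 0\<close>)
      fix y assume y: "y \<in> {a..b}" and yd: "norm (y - t) < d"
      consider "y = t" | "t < y" | "y < t" by linarith
      then show "norm (integral {a..y} f - integral {a..t} f - (y - t) *\<^sub>R f t) \<le> e * norm (y - t)"
      proof cases
        case 1 then show ?thesis by simp
      next
        case 2
        have "integral {a..t} f + integral {t..y} f = integral {a..y} f"
          by (rule Henstock_Kurzweil_Integration.integral_combine) (use 2 t y int2 in auto)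
        then have "norm (integral {a..y} f - integral {a..t} f - (y - t) *\<^sub>R f t) = norm ((y - t) *\<^sub>R f t - integral {t..y} f)"
          by (metis add_diff_cancel_left' norm_minus_commute)
        also have "\<dots> \<le> inverse (real (Suc n)) * (y - t)"
          by (rule d) (use 2 t y yd in auto)
        also have "\<dots> \<le> e * norm (y - t)" using n 2 by (simp add: mult_right_mono)
        finally show ?thesis .
      next
        case 3
        have "integral {a..y} f + integral {y..t} f = integral {a..t} f"
          by (rule Henstock_Kurzweil_Integration.integral_combine) (use 3 t y int2 in auto)
        then have "integral {a..y} f - integral {a..t} f - (y - t) *\<^sub>R f t = (t - y) *\<^sub>R f t - integral {y..t} f"
          by (simp add: algebra_simps)
        then have "norm (integral {a..y} f - integral {a..t} f - (y - t) *\<^sub>R f t) = norm ((t - y) *\<^sub>R f t - integral {y..t} f)"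
          by simp
        also have "\<dots> \<le> inverse (real (Suc n)) * (t - y)"
          by (rule d) (use 3 t y yd in auto)
        also have "\<dots> \<le> e * norm (y - t)" using n 3 by (simp add: mult_right_mono)
        finally show ?thesis .
      qed
    qed
  qed
qed

section \<open>Indefinite integrals, exponential weights and Gronwall\<close>

lemma sum_integral_nonoverlapping_le:
  fixes w :: "real \<Rightarrow> real"
  assumes w: "w integrable_on {a..b}" "\<And>x. x \<in> {a..b} \<Longrightarrow> 0 \<le> w x"
    and I: "nonoverlapping_intervals {a..b} \<delta> I"
  shows "(\<Sum>(u,v)\<in>I. integral {u..v} w) \<le> integral {a..b} w"
proof -
  have fin: "finite I" and sub: "\<And>u v. (u,v) \<in> I \<Longrightarrow> u \<le> v \<and> {u..v} \<subseteq> {a..b}"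
    and pw: "pairwise (\<lambda>p q. {fst p<..<snd p} \<inter> {fst q<..<snd q} = {}) I"
    using I unfolding nonoverlapping_intervals_def by auto
  define J where "J p = {fst p<..<snd p}" for p :: "real \<times> real"
  have wJ: "(\<lambda>x. if x \<in> J p then w x else 0) integrable_on {a..b}"
       "integral {fst p..snd p} w = integral {a..b} (\<lambda>x. if x \<in> J p then w x else 0)" if "p \<in> I" for p
  proof -
    obtain u v where p: "p = (u,v)" by (cases p)
    have uv: "{u..v} \<subseteq> {a..b}" "{u<..<v} \<subseteq> {a..b}" using sub[of u v] that p by fastforce+
    have "w integrable_on {u..v}" by (rule integrable_on_subinterval[OF w(1) uv(1)])
    then have "w integrable_on {u<..<v}" by (simp add: integrable_on_open_interval_real)
    then have "(\<lambda>x. if x \<in> {u<..<v} then w x else 0) integrable_on {a..b}"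
      using integrable_restrict_Int[of "{u<..<v}" w "{a..b}"] uv(2) by (simp add: Int_absorb2)
    then show "(\<lambda>x. if x \<in> J p then w x else 0) integrable_on {a..b}" by (simp add: J_def p)
    have "integral {u<..<v} w = integral {a..b} (\<lambda>x. if x \<in> {u<..<v} then w x else 0)"
      using Henstock_Kurzweil_Integration.integral_restrict_Int[of "{a..b}" "{u<..<v}" w] uv(2) by (simp add: Int_absorb2)
    then show "integral {fst p..snd p} w = integral {a..b} (\<lambda>x. if x \<in> J p then w x else 0)"
      by (simp add: J_def p integral_open_interval_real)
  qed
  have "(\<Sum>(u,v)\<in>I. integral {u..v} w) = (\<Sum>p\<in>I. integral {a..b} (\<lambda>x. if x \<in> J p then w x else 0))"
    by (rule sum.cong) (auto simp: wJ(2)[symmetric])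
  also have "\<dots> = integral {a..b} (\<lambda>x. \<Sum>p\<in>I. if x \<in> J p then w x else 0)"
    by (rule integral_sum[symmetric]) (use fin wJ in auto)
  also have "\<dots> \<le> integral {a..b} w"
  proof (rule integral_le[OF integrable_sum[OF fin wJ(1)] w(1)])
    fix x assume x: "x \<in> {a..b}"
    show "(\<Sum>p\<in>I. if x \<in> J p then w x else 0) \<le> w x"
    proof (cases "\<exists>p\<in>I. x \<in> J p")
      case False
      then have "(\<Sum>p\<in>I. if x \<in> J p then w x else 0) = 0" by (intro sum.neutral) auto
      then show ?thesis using w(2)[OF x] by simp
    next
      case True
      then obtain p where p: "p \<in> I" "x \<in> J p" by blast
      have "x \<notin> J q" if "q \<in> I - {p}" for q
        using pw p that unfolding pairwise_def J_def by blast
      then have "(\<Sum>q\<in>I. if x \<in> J q then w x else 0) = w x"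
        using p fin by (subst sum.remove[of I p]) auto
      then show ?thesis by simp
    qed
  qed
  finally show ?thesis .
qed

text \<open>
  Split \<open>|f|\<close> into its truncation at a level \<open>k\<close> and a remainder of small integral: the truncation
  contributes at most \<open>k\<close> times the total length.
\<close>

lemma absolutely_continuous_on_integral:
  fixes f :: "real \<Rightarrow> 'a::euclidean_space"
  assumes f: "f absolutely_integrable_on {a..b}"
  shows "absolutely_continuous_on {a..b} (\<lambda>t. integral {a..t} f)"
  unfolding absolutely_continuous_on_iff
proof (intro allI impI)
  fix \<epsilon> :: real assume "\<epsilon> > 0"
  define g where "g x = norm (f x)" for x
  define h where "h k x = min (g x) (real k)" for k x
  have fint: "f integrable_on {a..b}" and gint: "g integrable_on {a..b}"
    using f by (auto simp: absolutely_integrable_on_def g_def[abs_def])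
  have gabs: "g absolutely_integrable_on {a..b}"
    using absolutely_integrable_norm[OF f] by (simp add: g_def[abs_def] comp_def)
  have hint: "h k integrable_on {a..b}" for k
    unfolding h_def
    by (rule set_lebesgue_integral_eq_integral(1), rule absolutely_integrable_min_1[OF gabs]) (rule absolutely_integrable_on_const, simp)
  have "(\<lambda>k. integral {a..b} (h k)) \<longlonglongrightarrow> integral {a..b} g"
  proof (rule dominated_convergence(2)[OF hint gint])
    show "norm (h k x) \<le> g x" if "x \<in> {a..b}" for k x by (auto simp: h_def g_def min_def)
    show "(\<lambda>k. h k x) \<longlonglongrightarrow> g x" if "x \<in> {a..b}" for x
    proof (rule tendsto_eventually)
      obtain m where "g x \<le> real m" using real_arch_simple by blast
      then show "\<forall>\<^sub>F k in sequentially. h k x = g x"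
        unfolding h_def by (intro eventually_sequentiallyI[of m]) auto
    qed
  qed
  then have "\<forall>\<^sub>F k in sequentially. integral {a..b} g - \<epsilon>/2 < integral {a..b} (h k)"
    by (rule order_tendstoD) (use \<open>\<epsilon> > 0\<close> in simp)
  then obtain k where k: "integral {a..b} g - \<epsilon>/2 < integral {a..b} (h k)"
    by (auto simp: eventually_sequentially)
  define w where "w x = g x - h k x" for x
  have wint: "w integrable_on {a..b}" "integral {a..b} w < \<epsilon>/2"
    unfolding w_def using k gint hint[of k] by (auto intro: integrable_diff simp: integral_diff)
  show "\<exists>\<delta>>0. \<forall>I. nonoverlapping_intervals {a..b} \<delta> I \<longrightarrow>
          (\<Sum>(u, v)\<in>I. dist (integral {a..u} f) (integral {a..v} f)) < \<epsilon>"
  proof (intro exI[of _ "\<epsilon> / (2 * (real k + 1))"] conjI allI impI)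
    show "0 < \<epsilon> / (2 * (real k + 1))" using \<open>\<epsilon> > 0\<close> by (simp add: add_nonneg_pos)
    fix I assume I: "nonoverlapping_intervals {a..b} (\<epsilon> / (2 * (real k + 1))) I"
    then have sub: "\<And>u v. (u,v) \<in> I \<Longrightarrow> u \<le> v \<and> {u..v} \<subseteq> {a..b}"
      and tot: "(\<Sum>(u, v)\<in>I. v - u) < \<epsilon> / (2 * (real k + 1))"
      unfolding nonoverlapping_intervals_def by auto
    have "(\<Sum>(u, v)\<in>I. dist (integral {a..u} f) (integral {a..v} f))
        \<le> (\<Sum>(u, v)\<in>I. (real k + 1) * (v - u) + integral {u..v} w)"
    proof (rule sum_mono, clarify)
      fix u v assume "(u,v) \<in> I"
      then have uv: "u \<le> v" "a \<le> u" "v \<le> b" "{u..v} \<subseteq> {a..b}" using sub[of u v] by auto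
      have fi: "f integrable_on {a..v}" "f integrable_on {u..v}"
        by (rule integrable_on_subinterval[OF fint]; use uv in auto)+
      have gi: "g integrable_on {u..v}" "w integrable_on {u..v}"
        by (rule integrable_on_subinterval[OF gint uv(4)] integrable_on_subinterval[OF wint(1) uv(4)])+
      have "integral {a..u} f + integral {u..v} f = integral {a..v} f"
        by (rule Henstock_Kurzweil_Integration.integral_combine) (use uv fi in auto)
      then have "dist (integral {a..u} f) (integral {a..v} f) = norm (integral {u..v} f)"
        by (metis add_diff_cancel_left' dist_norm norm_minus_commute)
      also have "\<dots> \<le> integral {u..v} g"
        by (rule integral_norm_bound_integral) (use fi gi in \<open>auto simp: g_def\<close>)
      also have "\<dots> \<le> integral {u..v} (\<lambda>x. (real k + 1) + w x)"
        by (rule integral_le[OF gi(1) integrable_add[OF integrable_const_ivl gi(2)]]) (auto simp: w_def h_def)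
      also have "\<dots> = (real k + 1) * (v - u) + integral {u..v} w"
        using gi(2) uv(1) by (subst integral_add) auto
      finally show "dist (integral {a..u} f) (integral {a..v} f) \<le> (real k + 1) * (v - u) + integral {u..v} w" .
    qed
    also have "\<dots> = (real k + 1) * (\<Sum>(u, v)\<in>I. v - u) + (\<Sum>(u, v)\<in>I. integral {u..v} w)"
      by (simp add: sum.distrib sum_distrib_left split_beta)
    also have "\<dots> \<le> (real k + 1) * (\<epsilon> / (2 * (real k + 1))) + integral {a..b} w"
      by (intro add_mono mult_left_mono sum_integral_nonoverlapping_le[OF wint(1) _ I])
        (use tot in \<open>auto simp: w_def h_def\<close>)
    also have "(real k + 1) * (\<epsilon> / (2 * (real k + 1))) = \<epsilon> / 2" by (simp add: divide_simps)
    also have "\<epsilon> / 2 + integral {a..b} w < \<epsilon> / 2 + \<epsilon> / 2" using wint(2) by simp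
    finally show "(\<Sum>(u, v)\<in>I. dist (integral {a..u} f) (integral {a..v} f)) < \<epsilon>" by simp
  qed
qed

lemma has_vector_derivative_exp_scaleR:
  fixes G :: "real \<Rightarrow> 'a::real_normed_vector"
  assumes "(w has_vector_derivative c) (at t within S)" "(G has_vector_derivative v) (at t within S)"
  shows "((\<lambda>t. exp (k * w t) *\<^sub>R G t) has_vector_derivative
      exp (k * w t) *\<^sub>R v + (k * c * exp (k * w t)) *\<^sub>R G t) (at t within S)"
proof -
  have "(w has_real_derivative c) (at t within S)"
    using assms(1) by (simp add: has_real_derivative_iff_has_vector_derivative)
  then have "((\<lambda>t. exp (k * w t)) has_real_derivative k * c * exp (k * w t)) (at t within S)"
    by (auto intro!: derivative_eq_intros)
  from has_vector_derivative_scaleR[OF this assms(2)] show ?thesis .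
qed

lemma exp_diff_le:
  fixes x y B :: real
  assumes "\<bar>x\<bar> \<le> B" "\<bar>y\<bar> \<le> B"
  shows "\<bar>exp x - exp y\<bar> \<le> exp B * \<bar>x - y\<bar>"
proof -
  have *: "exp x - exp y \<le> exp B * (x - y)" if "y \<le> x" "x \<le> B" for x y :: real
  proof -
    have "1 - exp (y - x) \<le> x - y" using exp_ge_add_one_self[of "y - x"] by linarith
    then have "exp x * (1 - exp (y - x)) \<le> exp x * (x - y)" by (intro mult_left_mono) auto
    also have "\<dots> \<le> exp B * (x - y)" using that by (intro mult_right_mono) auto
    finally show ?thesis by (simp add: algebra_simps flip: exp_add)
  qed
  have "x \<le> B" "y \<le> B" using assms by linarith+
  then show ?thesis using *[of x y] *[of y x]
    by (cases "x \<le> y") auto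
qed

lemma absolutely_continuous_on_exp_scaleR:
  fixes G :: "real \<Rightarrow> 'a::real_normed_vector" and w :: "real \<Rightarrow> real"
  assumes w: "absolutely_continuous_on {a..b} w" and G: "absolutely_continuous_on {a..b} G"
  shows "absolutely_continuous_on {a..b} (\<lambda>t. exp (k * w t) *\<^sub>R G t)"
proof -
  have cw: "continuous_on {a..b} (\<lambda>t. k * w t)" and cG: "continuous_on {a..b} G"
    by (intro continuous_intros absolutely_continuous_on_imp_continuous_on w G)+
  obtain B where B: "\<And>t. t \<in> {a..b} \<Longrightarrow> \<bar>k * w t\<bar> \<le> B"
    using compact_imp_bounded[OF compact_continuous_image[OF cw compact_Icc]]
    unfolding bounded_iff real_norm_def by blast
  obtain D where D: "\<And>t. t \<in> {a..b} \<Longrightarrow> norm (G t) \<le> D"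
    using compact_imp_bounded[OF compact_continuous_image[OF cG compact_Icc]]
    unfolding bounded_iff by blast
  show ?thesis
  proof (rule absolutely_continuous_on_dominated[OF w G])
    fix u v assume uv: "u \<in> {a..b}" "v \<in> {a..b}"
    have "D \<ge> 0" using D[OF uv(1)] norm_ge_zero[of "G u"] by linarith
    have "dist (exp (k * w u) *\<^sub>R G u) (exp (k * w v) *\<^sub>R G v)
      = norm ((exp (k * w u) - exp (k * w v)) *\<^sub>R G u + exp (k * w v) *\<^sub>R (G u - G v))"
      by (simp add: dist_norm algebra_simps)
    also have "\<dots> \<le> \<bar>exp (k * w u) - exp (k * w v)\<bar> * norm (G u) + exp (k * w v) * norm (G u - G v)"
      by (rule norm_triangle_le) simp
    also have "\<dots> \<le> (exp B * \<bar>k * w u - k * w v\<bar>) * D + exp B * norm (G u - G v)"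
      using B[OF uv(1)] B[OF uv(2)] D[OF uv(1)] \<open>D \<ge> 0\<close>
      by (intro add_mono mult_mono exp_diff_le) auto
    also have "\<dots> = (exp B * \<bar>k\<bar> * D) * \<bar>w u - w v\<bar> + exp B * norm (G u - G v)"
      by (simp add: abs_mult flip: right_diff_distrib)
    also have "\<dots> \<le> (exp B * (\<bar>k\<bar> * D + 1)) * \<bar>w u - w v\<bar> + (exp B * (\<bar>k\<bar> * D + 1)) * norm (G u - G v)"
      using \<open>D \<ge> 0\<close> by (intro add_mono mult_right_mono) (auto simp: algebra_simps)
    also have "\<dots> = (exp B * (\<bar>k\<bar> * D + 1)) * (dist (w u) (w v) + dist (G u) (G v))"
      by (simp add: dist_norm dist_real_def algebra_simps)
    finally show "dist (exp (k * w u) *\<^sub>R G u) (exp (k * w v) *\<^sub>R G v) \<le> \<dots>" .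
  qed
qed

text \<open>
  The substitution rule for \<open>exp\<close> of an indefinite integral, with a weight that is merely integrable.
\<close>

lemma has_integral_exp_indefinite_integral:
  fixes c :: "real \<Rightarrow> real"
  assumes c: "c absolutely_integrable_on {a..b}" and "a \<le> b"
  shows "((\<lambda>r. k * c r * exp (k * integral {a..r} c)) has_integral (exp (k * integral {a..b} c) - 1)) {a..b}"
proof -
  have ci: "c integrable_on {a..b}" using c by (simp add: absolutely_integrable_on_def)
  obtain N where N: "negligible N"
    "\<And>t. t \<in> {a..b} - N \<Longrightarrow> ((\<lambda>u. integral {a..u} c) has_vector_derivative c t) (at t within {a..b})"
    by (rule Lebesgue_differentiation_indefinite_integral[OF ci]) blast
  have one: "absolutely_continuous_on {a..b} (\<lambda>_. 1::real)"
    unfolding absolutely_continuous_on_iff by (auto intro!: exI[of _ 1] simp: split_beta)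
  have ac: "absolutely_continuous_on {a..b} (\<lambda>t. exp (k * integral {a..t} c) *\<^sub>R (1::real))"
    by (rule absolutely_continuous_on_exp_scaleR[OF absolutely_continuous_on_integral[OF c] one])
  have "((\<lambda>r. k * c r * exp (k * integral {a..r} c)) has_integral
    (exp (k * integral {a..b} c) *\<^sub>R (1::real) - exp (k * integral {a..a} c) *\<^sub>R (1::real))) {a..b}"
  proof (rule fundamental_theorem_of_calculus_absolutely_continuous[OF \<open>a \<le> b\<close> ac N(1)])
    fix t assume "t \<in> {a..b} - N"
    from has_vector_derivative_exp_scaleR[OF N(2)[OF this] has_vector_derivative_const[of "1::real"], of k]
    show "((\<lambda>t. exp (k * integral {a..t} c) *\<^sub>R (1::real)) has_vector_derivative
         k * c t * exp (k * integral {a..t} c)) (at t within {a..b})" by simp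
  qed
  then show ?thesis by simp
qed

text \<open>
  First crossing: the comparison function with the slightly larger initial value \<open>A'\<close> solves the
  integral equation with equality, so \<open>g\<close> can never reach it.
\<close>

lemma Gronwall_integrable:
  fixes c g :: "real \<Rightarrow> real"
  assumes c: "c absolutely_integrable_on {a..b}" and c0: "\<And>r. r \<in> {a..b} \<Longrightarrow> 0 \<le> c r"
    and g: "continuous_on {a..b} g"
    and cg: "\<And>t. t \<in> {a..b} \<Longrightarrow> g t \<le> A + integral {a..t} (\<lambda>r. c r * g r)"
    and cgi: "(\<lambda>r. c r * g r) integrable_on {a..b}"
    and t: "t \<in> {a..b}"
  shows "g t \<le> A * exp (integral {a..t} c)"
proof (rule field_le_epsilon)
  fix e :: real assume "e > 0"
  \<comment> \<open>Chosen such that the perturbation amounts to exactly \<open>e\<close> at time \<open>t\<close>.\<close>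
  define A' where "A' = A + e * exp (- integral {a..t} c)"
  have "A' > A" using \<open>e > 0\<close> by (simp add: A'_def)
  define u where "u r = A' * exp (integral {a..r} c)" for r
  have ci: "c integrable_on {a..b}" using c by (simp add: absolutely_integrable_on_def)
  have cu: "continuous_on {a..b} u"
    unfolding u_def by (intro continuous_intros absolutely_continuous_on_imp_continuous_on absolutely_continuous_on_integral c)
  have uint: "((\<lambda>r. c r * u r) has_integral (u s - A')) {a..s}" if s: "s \<in> {a..b}" for s
  proof -
    have "c absolutely_integrable_on {a..s}"
      by (rule absolutely_integrable_on_subinterval[OF c]) (use s in auto)
    from has_integral_mult_right[OF has_integral_exp_indefinite_integral[OF this, of 1], of A'] s
    show ?thesis by (simp add: u_def algebra_simps)
  qed
  have less: "g s < u s" if "s \<in> {a..b}" for s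
  proof (rule ccontr)
    assume "\<not> g s < u s"
    define Z where "Z = {s \<in> {a..b}. u s - g s \<le> 0}"
    have "compact Z"
    proof -
      have "closed Z" unfolding Z_def
        by (rule continuous_on_closed_Collect_le) (intro continuous_intros cu g closed_atLeastAtMost)+
      moreover have "Z \<subseteq> {a..b}" by (auto simp: Z_def)
      ultimately show ?thesis
        using bounded_subset[OF bounded_closed_interval] compact_eq_bounded_closed by blast
    qed
    moreover have "Z \<noteq> {}" using \<open>\<not> g s < u s\<close> that by (auto simp: Z_def)
    ultimately obtain z where z: "z \<in> Z" "\<And>y. y \<in> Z \<Longrightarrow> z \<le> y"
      using compact_attains_inf[of Z] by blast
    have zab: "z \<in> {a..b}" using z by (simp add: Z_def)
    have "g z \<le> A + integral {a..z} (\<lambda>r. c r * g r)" by (rule cg[OF zab])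
    also have "integral {a..z} (\<lambda>r. c r * g r) = integral {a..z} (\<lambda>r. c r * (if r = z then u r else g r))"
      by (rule integral_spike[of "{z}"]) auto
    also have "\<dots> \<le> integral {a..z} (\<lambda>r. c r * u r)"
    proof (rule integral_le)
      have "(\<lambda>r. c r * g r) integrable_on {a..z}"
        by (rule integrable_on_subinterval[OF cgi]) (use zab in auto)
      then show "(\<lambda>r. c r * (if r = z then u r else g r)) integrable_on {a..z}"
        by (rule integrable_spike[of _ _ "{z}"]) auto
      show "(\<lambda>r. c r * u r) integrable_on {a..z}" using uint[OF zab] by blast
      fix r assume r: "r \<in> {a..z}"
      have "g r \<le> u r" if "r \<noteq> z"
      proof -
        have "r \<notin> Z" using z(2)[of r] r that by auto
        then show ?thesis using r zab by (auto simp: Z_def)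
      qed
      then show "c r * (if r = z then u r else g r) \<le> c r * u r"
        using c0[of r] r zab by (intro mult_left_mono) auto
    qed
    also have "\<dots> = u z - A'" using uint[OF zab] by blast
    finally have "g z < u z" using \<open>A' > A\<close> by simp
    then show False using z(1) by (simp add: Z_def)
  qed
  have "g t < u t" by (rule less[OF t])
  also have "u t = A * exp (integral {a..t} c) + e" by (simp add: u_def A'_def algebra_simps exp_minus)
  finally show "g t \<le> A * exp (integral {a..t} c) + e" by simp
qed

section \<open>Order, monotone functions and volume\<close>

text \<open>
  Strict inequality in every coordinate, unlike the strict part of the componentwise order, is an open
  condition; this is what lets comparisons survive small errors.
\<close>

definition strictly_below :: "real^'n::finite \<Rightarrow> real^'n \<Rightarrow> bool" (infix "\<lless>" 50) where
  "x \<lless> y \<longleftrightarrow> (\<forall>i. x $ i < y $ i)"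

text \<open>
  The hypothesis says that the gap does not shrink while it exceeds \<open>\<rho>\<close>. At the first time when some
  coordinate drops to \<open>\<rho>\<close> the gap would, by continuity, still be at least the initial one, which is larger than \<open>\<rho>\<close>.
\<close>

lemma gap_persists:
  fixes D :: "real \<Rightarrow> real^'n::finite"
  assumes cont: "continuous_on {a..b} D" and init: "\<And>i. \<rho> < D a $ i"
    and step: "\<And>v. v \<in> {a..b} \<Longrightarrow> (\<And>u i. u \<in> {a..v} \<Longrightarrow> \<rho> < D u $ i) \<Longrightarrow> D a \<le> D v"
    and v: "v \<in> {a..b}"
  shows "D a \<le> D v"
proof (rule step[OF v])
  fix u i assume u: "u \<in> {a..v}"
  show "\<rho> < D u $ i"
  proof (rule ccontr)
    assume neg: "\<not> \<rho> < D u $ i"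
    define Z where "Z = (\<Union>j. {r \<in> {a..b}. D r $ j \<le> \<rho>})"
    have "closed Z" unfolding Z_def
      by (intro closed_UN ballI continuous_on_closed_Collect_le) (intro finite continuous_intros cont closed_atLeastAtMost)+
    moreover have "Z \<subseteq> {a..b}" by (auto simp: Z_def)
    ultimately have "compact Z"
      using bounded_subset[OF bounded_closed_interval] compact_eq_bounded_closed by blast
    moreover have "u \<in> Z" using neg u v by (auto simp: Z_def not_less)
    then have "Z \<noteq> {}" by blast
    ultimately obtain z where z: "z \<in> Z" "\<And>y. y \<in> Z \<Longrightarrow> z \<le> y"
      using compact_attains_inf[of Z] by blast
    have zab: "z \<in> {a..b}" using z by (auto simp: Z_def)
    obtain j where j: "D z $ j \<le> \<rho>" using z by (auto simp: Z_def)
    have "a < z" using j init[of j] zab by (cases "a = z") auto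
    have cl: "closure {a..<z} = {a..z}" using \<open>a < z\<close> by simp
    have before: "D a \<le> D r" if "r \<in> {a..<z}" for r
    proof (rule step)
      show "r \<in> {a..b}" using that zab by auto
      fix u i assume "u \<in> {a..r}"
      then have "u \<notin> Z" using z(2)[of u] that by auto
      then show "\<rho> < D u $ i" using \<open>u \<in> {a..r}\<close> that zab by (auto simp: Z_def not_le)
    qed
    have "D a $ j \<le> D z $ j"
    proof (rule continuous_ge_on_closure[of "{a..<z}" "\<lambda>r. D r $ j" z "D a $ j"])
      show "continuous_on (closure {a..<z}) (\<lambda>r. D r $ j)"
        unfolding cl by (intro continuous_intros continuous_on_subset[OF cont]) (use zab in auto)
      show "z \<in> closure {a..<z}" unfolding cl using \<open>a < z\<close> by simp
    qed (use before in \<open>simp add: less_eq_vec_def\<close>)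
    then show False using j init[of j] by simp
  qed
qed

text \<open>
  On each line of direction \<open>1 = (1, \<dots>, 1)\<close> the function is monotone, so that its discontinuities
  are countable. Tonelli's theorem on space times line gives one translation for which almost every
  translated point is good; Lebesgue measure being translation invariant, almost every point is.
\<close>

lemma AE_jump_free_on_diagonal:
  fixes f :: "real^'n::finite \<Rightarrow> real"
  assumes [measurable]: "f \<in> borel_measurable borel" and mono: "\<And>x y. x \<lless> y \<Longrightarrow> f x \<le> f y"
  shows "AE x in lborel. \<forall>e>0. \<exists>d>0. f (x + d *\<^sub>R 1) - f (x - d *\<^sub>R 1) < e"
proof -
  \<comment> \<open>Restricting \<open>e\<close> and \<open>d\<close> to reciprocals of integers makes the set of good points Borel.\<close>
  define P where "P x \<longleftrightarrow> (\<forall>m::nat. \<exists>k::nat. f (x + (1 / real (Suc k)) *\<^sub>R 1) - f (x - (1 / real (Suc k)) *\<^sub>R 1) < 1 / real (Suc m))" for x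
  have meas: "{p \<in> space (lborel \<Otimes>\<^sub>M lborel). P (fst p + snd p *\<^sub>R 1)} \<in> sets (lborel \<Otimes>\<^sub>M (lborel :: real measure))"
    unfolding P_def by measurable
  have "AE \<tau> in lborel. P (x + \<tau> *\<^sub>R 1)" for x
  proof -
    define g where "g \<tau> = f (x + \<tau> *\<^sub>R 1)" for \<tau>
    have "mono g"
    proof (rule monoI)
      fix r s :: real assume "r \<le> s"
      then show "g r \<le> g s" unfolding g_def
        by (cases "r = s") (auto intro!: mono simp: strictly_below_def)
    qed
    have "{\<tau>. \<not> isCont g \<tau>} \<in> null_sets lborel"
      by (rule countable_imp_null_set_lborel[OF mono_ctble_discont[OF \<open>mono g\<close>]])
    then have "AE \<tau> in lborel. \<tau> \<notin> {\<tau>. \<not> isCont g \<tau>}" by (rule AE_not_in)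
    then show ?thesis
    proof (rule eventually_mono)
      fix \<tau> assume "\<tau> \<notin> {\<tau>. \<not> isCont g \<tau>}"
      then have c: "isCont g \<tau>" by simp
      show "P (x + \<tau> *\<^sub>R 1)" unfolding P_def
      proof
        fix m
        have "1 / real (Suc m) / 2 > 0" by simp
        then obtain d where d: "d > 0" "\<And>s. dist s \<tau> < d \<Longrightarrow> dist (g s) (g \<tau>) < 1 / real (Suc m) / 2"
          using c unfolding continuous_at_eps_delta by blast
        obtain k where k: "1 / real (Suc k) < d" using nat_approx_posE[OF d(1)] by blast
        have "g (\<tau> + 1 / real (Suc k)) - g (\<tau> - 1 / real (Suc k)) < 1 / real (Suc m)"
          using d(2)[of "\<tau> + 1 / real (Suc k)"] d(2)[of "\<tau> - 1 / real (Suc k)"] k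
          by (auto simp: dist_real_def abs_less_iff field_simps)
        then show "\<exists>k. f (x + \<tau> *\<^sub>R 1 + (1 / real (Suc k)) *\<^sub>R 1) - f (x + \<tau> *\<^sub>R 1 - (1 / real (Suc k)) *\<^sub>R 1) < 1 / real (Suc m)"
          by (intro exI[of _ k]) (simp add: g_def algebra_simps)
      qed
    qed
  qed
  then have "AE x in lborel. AE \<tau> in lborel. P (x + \<tau> *\<^sub>R 1)" by simp
  then have "AE \<tau>::real in lborel. AE x in lborel. P (x + \<tau> *\<^sub>R 1)"
    using lborel_pair.AE_commute[OF meas] by simp
  moreover have "ae_filter (lborel :: real measure) \<noteq> bot"
    by (simp add: ae_filter_eq_bot_iff)
  ultimately obtain \<tau> :: real where \<tau>: "AE x in lborel. P (x + \<tau> *\<^sub>R 1)"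
    using eventually_happens by blast
  have [measurable]: "Measurable.pred borel P" unfolding P_def by measurable
  have "AE x in distr lborel borel ((+) (\<tau> *\<^sub>R (1::real^'n))). P x"
    by (subst AE_distr_iff) (use \<tau> in \<open>auto simp: add.commute\<close>)
  then have "AE x in lborel. P x" unfolding lborel_distr_plus .
  then show ?thesis
  proof (rule eventually_mono, intro allI impI)
    fix x and e :: real assume "P x" "e > 0"
    obtain m where "1 / real (Suc m) < e" using nat_approx_posE[OF \<open>e > 0\<close>] by blast
    moreover obtain k where "f (x + (1 / real (Suc k)) *\<^sub>R 1) - f (x - (1 / real (Suc k)) *\<^sub>R 1) < 1 / real (Suc m)"
      using \<open>P x\<close> unfolding P_def by blast
    ultimately show "\<exists>d>0. f (x + d *\<^sub>R 1) - f (x - d *\<^sub>R 1) < e"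
      by (intro exI[of _ "1 / real (Suc k)"]) auto
  qed
qed

text \<open>
  Only components of an open superset of \<open>Q\<close> need be considered. The points of \<open>S\<close> mapped into one
  component \<open>I\<close> lie within the length of \<open>I\<close> of each other, as \<open>p\<close> does not decrease distances
  and \<open>I\<close> contains the whole interval between two image points.
\<close>

lemma emeasure_expanding_preimage_le:
  fixes p :: "real \<Rightarrow> real"
  assumes p[measurable]: "p \<in> borel_measurable borel" and S[measurable]: "S \<in> sets borel"
    and exp: "\<And>r s. r \<in> S \<Longrightarrow> s \<in> S \<Longrightarrow> r \<le> s \<Longrightarrow> s - r \<le> p s - p r"
    and Q: "Q \<in> sets borel" "p ` S \<subseteq> Q"
  shows "emeasure lborel S \<le> emeasure lborel Q"
proof (rule ennreal_le_epsilon)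
  fix e :: real assume "e > 0"
  obtain U where U: "open U" "Q \<subseteq> U" "emeasure lborel (U - Q) < e"
    by (rule outer_regular_lborel[OF Q(1) \<open>e > 0\<close>])
  have C: "countable (components U)"
    by (rule countable_disjoint_open_subsets)
      (use open_components[OF U(1)] pairwise_disjoint_components[of U] in \<open>auto simp: disjnt_def pairwise_def\<close>)
  have CB: "I \<in> sets borel" if "I \<in> components U" for I
    using open_components[OF U(1) that] by simp
  have piece: "emeasure lborel (S \<inter> p -` I) \<le> emeasure lborel I" if I: "I \<in> components U" for I
  proof (cases "emeasure lborel I = \<infinity> \<or> S \<inter> p -` I = {}")
    case True then show ?thesis by auto
  next
    case False
    then have fin: "emeasure lborel I < \<infinity>" by (simp add: less_top)
    define L where "L = measure lborel I"
    have L: "emeasure lborel I = ennreal L" using fin unfolding L_def by (simp add: emeasure_eq_ennreal_measure)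
    have dist: "s - r \<le> L" if rs: "r \<in> S \<inter> p -` I" "s \<in> S \<inter> p -` I" for r s
    proof (cases "r \<le> s")
      case True
      then have le: "s - r \<le> p s - p r" using exp rs by auto
      have "{p r..p s} \<subseteq> I"
        using in_components_connected[OF I] rs connected_contains_Icc by blast
      then have "emeasure lborel {p r..p s} \<le> emeasure lborel I"
        using CB[OF I] by (intro emeasure_mono) auto
      then have "ennreal (p s - p r) \<le> ennreal L" using le True L by simp
      then show ?thesis using le by (simp add: L_def ennreal_le_iff)
    next
      case False
      have "L \<ge> 0" by (simp add: L_def)
      with False show ?thesis by linarith
    qed
    define r0 where "r0 = Inf (S \<inter> p -` I)"
    have ne: "S \<inter> p -` I \<noteq> {}" using False by simp
    then obtain s0 where s0: "s0 \<in> S \<inter> p -` I" by blast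
    have bdd: "bdd_below (S \<inter> p -` I)"
      by (rule bdd_belowI[of _ "s0 - L"]) (use dist[OF _ s0] in fastforce)
    have "S \<inter> p -` I \<subseteq> {r0..r0 + L}"
    proof
      fix s assume s: "s \<in> S \<inter> p -` I"
      have "r0 \<le> s" unfolding r0_def by (rule cInf_lower[OF s bdd])
      moreover have "s - L \<le> r0" unfolding r0_def
        by (rule cInf_greatest[OF ne]) (use dist[OF _ s] in fastforce)
      ultimately show "s \<in> {r0..r0 + L}" by auto
    qed
    then have "emeasure lborel (S \<inter> p -` I) \<le> emeasure lborel {r0..r0+L}" by (intro emeasure_mono) auto
    also have "\<dots> = emeasure lborel I" unfolding L using L_def by simp
    finally show ?thesis .
  qed
  have Seq: "S = (\<Union>I\<in>components U. S \<inter> p -` I)"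
  proof (intro equalityI subsetI)
    fix s assume s: "s \<in> S"
    then have "p s \<in> \<Union>(components U)" using Q(2) U(2) by auto
    then show "s \<in> (\<Union>I\<in>components U. S \<inter> p -` I)" using s by blast
  qed auto
  have "emeasure lborel S = emeasure lborel (\<Union>I\<in>components U. S \<inter> p -` I)" using Seq by simp
  also have "\<dots> = (\<integral>\<^sup>+I. emeasure lborel (S \<inter> p -` I) \<partial>count_space (components U))"
  proof (rule emeasure_UN_countable[OF _ C])
    show "S \<inter> p -` I \<in> sets lborel" if "I \<in> components U" for I
      using measurable_sets_borel[OF p CB[OF that]] by simp
    show "disjoint_family_on (\<lambda>I. S \<inter> p -` I) (components U)"
      using pairwise_disjoint_components[of U] unfolding disjoint_family_on_def pairwise_def by blast
  qed
  also have "\<dots> \<le> (\<integral>\<^sup>+I. emeasure lborel I \<partial>count_space (components U))"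
    by (rule nn_integral_mono) (use piece in auto)
  also have "\<dots> = emeasure lborel (\<Union>I\<in>components U. I)"
    by (rule emeasure_UN_countable[OF _ C, symmetric])
      (use CB pairwise_disjoint_components[of U] in \<open>auto simp: disjoint_family_on_def pairwise_def\<close>)
  also have "\<dots> = emeasure lborel U" by simp
  also have "\<dots> = emeasure lborel (Q \<union> (U - Q))" using U(2) by (simp add: Un_absorb1)
  also have "\<dots> \<le> emeasure lborel Q + emeasure lborel (U - Q)"
    by (rule emeasure_subadditive) (use Q U in auto)
  also have "\<dots> \<le> emeasure lborel Q + ennreal e" using U(3) by (intro add_left_mono) auto
  finally show "emeasure lborel S \<le> emeasure lborel Q + ennreal e" .
qed

text \<open>
  Volume as an average over lines of direction \<open>e\<close>. Translation invariance makes this work for every direction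
  without choosing coordinates adapted to it.
\<close>

lemma nn_integral_emeasure_line_window:
  fixes e :: "'a::euclidean_space"
  assumes B[measurable]: "B \<in> sets borel" and "a \<le> b"
  shows "(\<integral>\<^sup>+x. emeasure lborel {\<tau>\<in>{a..b}. x + \<tau> *\<^sub>R e \<in> B} \<partial>lborel) = ennreal (b - a) * emeasure lborel B"
proof -
  have "(\<integral>\<^sup>+x. emeasure lborel {\<tau>\<in>{a..b}. x + \<tau> *\<^sub>R e \<in> B} \<partial>lborel)
      = (\<integral>\<^sup>+x. (\<integral>\<^sup>+\<tau>. indicator {a..b} \<tau> * indicator B (x + \<tau> *\<^sub>R e) \<partial>lborel) \<partial>lborel)"
  proof (rule nn_integral_cong)
    fix x :: 'a
    have "{\<tau>\<in>{a..b}. x + \<tau> *\<^sub>R e \<in> B} \<in> sets lborel" by measurable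
    then have "emeasure lborel {\<tau>\<in>{a..b}. x + \<tau> *\<^sub>R e \<in> B} = (\<integral>\<^sup>+\<tau>. indicator {\<tau>\<in>{a..b}. x + \<tau> *\<^sub>R e \<in> B} \<tau> \<partial>lborel)"
      by simp
    also have "\<dots> = (\<integral>\<^sup>+\<tau>. indicator {a..b} \<tau> * indicator B (x + \<tau> *\<^sub>R e) \<partial>lborel)"
      by (rule nn_integral_cong) (auto simp: indicator_def)
    finally show "emeasure lborel {\<tau>\<in>{a..b}. x + \<tau> *\<^sub>R e \<in> B} = \<dots>" .
  qed
  also have "\<dots> = (\<integral>\<^sup>+\<tau>. (\<integral>\<^sup>+x. indicator {a..b} \<tau> * indicator B (x + \<tau> *\<^sub>R e) \<partial>lborel) \<partial>lborel)"
    by (rule lborel_pair.Fubini') simp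
  also have "\<dots> = (\<integral>\<^sup>+\<tau>. indicator {a..b} \<tau> * emeasure lborel B \<partial>lborel)"
  proof (rule nn_integral_cong)
    fix \<tau> :: real
    have "(\<integral>\<^sup>+x. indicator {a..b} \<tau> * indicator B (x + \<tau> *\<^sub>R e) \<partial>lborel)
       = indicator {a..b} \<tau> * (\<integral>\<^sup>+x. indicator B (\<tau> *\<^sub>R e + x) \<partial>lborel)"
      by (simp add: nn_integral_cmult add.commute)
    also have "(\<integral>\<^sup>+x. indicator B (\<tau> *\<^sub>R e + x) \<partial>lborel) = (\<integral>\<^sup>+x. indicator B x \<partial>distr lborel borel ((+) (\<tau> *\<^sub>R e)))"
      by (subst nn_integral_distr) auto
    also have "\<dots> = emeasure lborel B" by (simp add: lborel_distr_plus)
    finally show "(\<integral>\<^sup>+x. indicator {a..b} \<tau> * indicator B (x + \<tau> *\<^sub>R e) \<partial>lborel) = indicator {a..b} \<tau> * emeasure lborel B" .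
  qed
  also have "\<dots> = ennreal (b - a) * emeasure lborel B"
    using \<open>a \<le> b\<close> by (simp add: nn_integral_multc)
  finally show ?thesis .
qed

text \<open>
  On a line of direction \<open>e\<close> the map is \<open>\<tau> \<mapsto> \<tau> + g\<close> with \<open>g\<close> nondecreasing, hence expanding. A shift by at
  most \<open>K\<close> moves the window \<open>[0, N]\<close> into \<open>[-K, N + K]\<close>, so that the factor lost is \<open>(N + 2K) / N\<close>, which
  tends to 1 as \<open>N\<close> grows.
\<close>

lemma emeasure_directional_shift_preimage_le:
  fixes e :: "'a::euclidean_space" and g :: "'a \<Rightarrow> real"
  assumes g[measurable]: "g \<in> borel_measurable borel"
    and mono: "\<And>x \<tau>. 0 \<le> \<tau> \<Longrightarrow> g x \<le> g (x + \<tau> *\<^sub>R e)"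
    and A[measurable]: "A \<in> sets borel"
  shows "emeasure lborel {x. x + g x *\<^sub>R e \<in> A} \<le> emeasure lborel A"
proof -
  \<comment> \<open>\<open>g\<close> may be unbounded; the set where it is at most \<open>K\<close> exhausts space as \<open>K\<close> grows.\<close>
  define S where "S K = {x. x + g x *\<^sub>R e \<in> A \<and> \<bar>g x\<bar> \<le> real K}" for K :: nat
  have Sm[measurable]: "S K \<in> sets borel" for K unfolding S_def by measurable
  have bound: "ennreal (real N) * emeasure lborel (S K) \<le> ennreal (real N + 2 * real K) * emeasure lborel A" for N K
  proof -
    have "ennreal (real N) * emeasure lborel (S K) = (\<integral>\<^sup>+x. emeasure lborel {\<tau>\<in>{0..real N}. x + \<tau> *\<^sub>R e \<in> S K} \<partial>lborel)"
      using nn_integral_emeasure_line_window[of "S K" 0 "real N" e] by simp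
    also have "\<dots> \<le> (\<integral>\<^sup>+x. emeasure lborel {\<tau>\<in>{- real K..real N + real K}. x + \<tau> *\<^sub>R e \<in> A} \<partial>lborel)"
    proof (rule nn_integral_mono)
      fix x :: 'a
      define p where "p \<tau> = \<tau> + g (x + \<tau> *\<^sub>R e)" for \<tau>
      show "emeasure lborel {\<tau>\<in>{0..real N}. x + \<tau> *\<^sub>R e \<in> S K} \<le> emeasure lborel {\<tau>\<in>{- real K..real N + real K}. x + \<tau> *\<^sub>R e \<in> A}"
      proof (rule emeasure_expanding_preimage_le[where p = p])
        show "p \<in> borel_measurable borel" unfolding p_def by measurable
        show "{\<tau>\<in>{0..real N}. x + \<tau> *\<^sub>R e \<in> S K} \<in> sets borel" by measurable
        show "{\<tau>\<in>{- real K..real N + real K}. x + \<tau> *\<^sub>R e \<in> A} \<in> sets borel" by measurable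
        show "s - r \<le> p s - p r" if "r \<le> s" for r s
          using mono[of "s - r" "x + r *\<^sub>R e"] that by (simp add: p_def algebra_simps)
        show "p ` {\<tau>\<in>{0..real N}. x + \<tau> *\<^sub>R e \<in> S K} \<subseteq> {\<tau>\<in>{- real K..real N + real K}. x + \<tau> *\<^sub>R e \<in> A}"
          by (auto simp: p_def S_def algebra_simps abs_le_iff)
      qed
    qed
    also have "\<dots> = ennreal (real N + 2 * real K) * emeasure lborel A"
      using nn_integral_emeasure_line_window[OF A, of "- real K" "real N + real K" e] by (simp add: add.commute)
    finally show ?thesis .
  qed
  have le: "emeasure lborel (S K) \<le> emeasure lborel A" for K
  proof (cases "emeasure lborel A = \<infinity>")
    case False
    then obtain M where M: "emeasure lborel A = ennreal M" "M \<ge> 0"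
      by (cases "emeasure lborel A") auto
    have "emeasure lborel (S K) \<le> ennreal (1 + 2 * real K) * ennreal M" using bound[of 1 K] M by simp
    also have "\<dots> < \<infinity>" by (simp add: ennreal_mult_less_top)
    finally obtain m where m: "emeasure lborel (S K) = ennreal m" "m \<ge> 0"
      by (cases "emeasure lborel (S K)") auto
    have b: "real N * m \<le> (real N + 2 * real K) * M" for N
    proof -
      have "ennreal (real N * m) \<le> ennreal ((real N + 2 * real K) * M)"
        using bound[of N K] M m by (simp add: ennreal_mult del: ennreal_plus)
      then show ?thesis using M by (simp add: ennreal_le_iff del: ennreal_plus)
    qed
    have "m \<le> M"
    proof (rule ccontr)
      assume "\<not> m \<le> M"
      then have "m - M > 0" by simp
      then obtain N where "2 * real K * M < real N * (m - M)" using reals_Archimedean3 by blast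
      with b[of N] show False by (simp add: algebra_simps)
    qed
    then show ?thesis using M m by (simp add: ennreal_leI)
  qed simp
  have inc: "incseq S" unfolding S_def incseq_def by auto
  have "{x. x + g x *\<^sub>R e \<in> A} = (\<Union>K. S K)"
  proof (intro set_eqI iffI)
    fix x assume "x \<in> {x. x + g x *\<^sub>R e \<in> A}"
    moreover obtain K where "\<bar>g x\<bar> \<le> real K" using real_arch_simple by blast
    ultimately have "x \<in> S K" by (simp add: S_def)
    then show "x \<in> (\<Union>K. S K)" by blast
  qed (simp add: S_def)
  then have "emeasure lborel {x. x + g x *\<^sub>R e \<in> A} = (SUP K. emeasure lborel (S K))"
    by (subst SUP_emeasure_incseq) (use inc in auto)
  also have "\<dots> \<le> emeasure lborel A" by (intro SUP_least le)
  finally show ?thesis .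
qed

section \<open>Increasing fields: existence for every initial point\<close>

lemma borel_measurable_vec_nth_comp [measurable (raw)]:
  fixes f :: "'a \<Rightarrow> real^'n::finite"
  assumes "f \<in> borel_measurable M"
  shows "(\<lambda>x. f x $ i) \<in> borel_measurable M"
  by (rule borel_measurable_continuous_on[OF _ assms]) (intro continuous_intros)

lemma has_integral_vec_le:
  fixes f g :: "'a::euclidean_space \<Rightarrow> real^'n::finite"
  assumes f: "(f has_integral I) S" and g: "(g has_integral J) S" and le: "\<And>x. x \<in> S \<Longrightarrow> f x \<le> g x"
  shows "I \<le> J"
  unfolding less_eq_vec_def
proof
  fix i
  show "I $ i \<le> J $ i"
    by (rule has_integral_le[OF has_integral_linear[OF f bounded_linear_vec_nth] has_integral_linear[OF g bounded_linear_vec_nth]])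
      (use le in \<open>auto simp: less_eq_vec_def\<close>)
qed

lemma norm_le_card_mult:
  fixes x :: "real^'n::finite"
  assumes "\<And>i. \<bar>x $ i\<bar> \<le> m"
  shows "norm x \<le> real CARD('n) * m"
  using order_trans[OF norm_le_l1_cart sum_bounded_above[of UNIV "\<lambda>i. \<bar>x $ i\<bar>" m]] assms by simp

text \<open>
  Makes Picard iterates jointly measurable in time and initial point.
\<close>

lemma borel_measurable_set_integral_upto [measurable (raw)]:
  fixes f :: "'a \<Rightarrow> real \<Rightarrow> 'b::euclidean_space"
  assumes [measurable]: "(\<lambda>(p, r). f p r) \<in> borel_measurable (M \<Otimes>\<^sub>M lborel)" "t \<in> borel_measurable M"
  shows "(\<lambda>p. LINT r:{s..t p}|lborel. f p r) \<in> borel_measurable M"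
proof -
  have "(\<lambda>p. (LINT r|lborel. (if s \<le> r \<and> r \<le> t p then f p r else 0))) \<in> borel_measurable M"
    by measurable
  also have "(\<lambda>p. (LINT r|lborel. (if s \<le> r \<and> r \<le> t p then f p r else 0))) = (\<lambda>p. LINT r:{s..t p}|lborel. f p r)"
    unfolding set_lebesgue_integral_def by (intro ext Bochner_Integration.integral_cong) auto
  finally show ?thesis .
qed

lemma set_integrable_lborel_imp_absolutely_integrable:
  fixes f :: "'a::euclidean_space \<Rightarrow> 'b::euclidean_space"
  assumes "set_integrable lborel S f"
  shows "f absolutely_integrable_on S"
  using assms integrable_completion[of "\<lambda>x. indicator S x *\<^sub>R f x" lborel]
  by (auto simp: set_integrable_def)

text \<open>
  The conditions hold for all times, not just almost all: a null set of bad times can be removed beforehand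
  by setting the field to zero there.
\<close>

locale increasing_field =
  fixes B :: "real \<Rightarrow> real^'n::finite \<Rightarrow> real^'n" and c :: "real \<Rightarrow> real"
  assumes B_measurable: "(\<lambda>p. B (fst p) (snd p)) \<in> borel_measurable (borel \<Otimes>\<^sub>M borel)"
    and B_mono: "x \<le> y \<Longrightarrow> B t x \<le> B t y"
    and B_right_continuous: "(\<lambda>k. B t (x + (1 / real (Suc k)) *\<^sub>R 1)) \<longlonglongrightarrow> B t x"
    and B_growth: "norm (B t x) \<le> c t * (1 + norm x)"
    and c_integrable: "integrable lborel c"
begin

lemma B_measurable_comp [measurable (raw)]:
  assumes [measurable]: "f \<in> borel_measurable M" "g \<in> borel_measurable M"
  shows "(\<lambda>x. B (f x) (g x)) \<in> borel_measurable M"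
  using measurable_compose[OF measurable_Pair[OF assms] B_measurable] by simp

lemma c_measurable [measurable]: "c \<in> borel_measurable borel"
  using c_integrable by simp

lemma c_nonneg: "0 \<le> c t"
proof -
  have "0 \<le> c t * (1 + norm (0 :: real^'n))" using B_growth[of t 0] norm_ge_zero order_trans by blast
  then show ?thesis by simp
qed

lemma c_set_integrable: "A \<in> sets borel \<Longrightarrow> set_integrable lborel A c"
  using set_integrable_subset[of lborel UNIV c A] c_integrable by (simp add: set_integrable_def)

lemma c_absolutely_integrable: "c absolutely_integrable_on {s..t}"
  by (rule set_integrable_lborel_imp_absolutely_integrable[OF c_set_integrable]) simp

lemma c_integrable_on: "c integrable_on {s..t}"
  using c_absolutely_integrable absolutely_integrable_on_def by blast

lemma B_set_integrable:
  assumes Y: "set_borel_measurable lborel {s..t} Y" and K: "\<And>r. r \<in> {s..t} \<Longrightarrow> norm (Y r) \<le> K"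
  shows "set_integrable lborel {s..t} (\<lambda>r. B r (Y r))"
proof (rule set_integrable_bound)
  show "set_integrable lborel {s..t} (\<lambda>r. (1 + \<bar>K\<bar>) * c r)"
    using c_set_integrable[of "{s..t}"] by (intro set_integrable_mult_right) auto
  have [measurable]: "(\<lambda>r. indicator {s..t} r *\<^sub>R Y r) \<in> borel_measurable borel"
    using Y by (simp add: set_borel_measurable_def)
  have "(\<lambda>r. indicator {s..t} r *\<^sub>R B r (indicator {s..t} r *\<^sub>R Y r)) \<in> borel_measurable borel" by measurable
  also have "(\<lambda>r. indicator {s..t} r *\<^sub>R B r (indicator {s..t} r *\<^sub>R Y r)) = (\<lambda>r. indicator {s..t} r *\<^sub>R B r (Y r))"
    by (auto simp: indicator_def)
  finally show "set_borel_measurable lborel {s..t} (\<lambda>r. B r (Y r))" by (simp add: set_borel_measurable_def)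
  show "AE r in lborel. r \<in> {s..t} \<longrightarrow> norm (B r (Y r)) \<le> norm ((1 + \<bar>K\<bar>) * c r)"
  proof (intro AE_I2 impI)
    fix r assume "r \<in> {s..t}"
    have "norm (B r (Y r)) \<le> c r * (1 + norm (Y r))" by (rule B_growth)
    also have "\<dots> \<le> c r * (1 + \<bar>K\<bar>)" using K[OF \<open>r \<in> {s..t}\<close>] c_nonneg by (intro mult_left_mono) auto
    finally show "norm (B r (Y r)) \<le> norm ((1 + \<bar>K\<bar>) * c r)" using c_nonneg[of r] by (simp add: abs_mult mult.commute)
  qed
qed

lemma B_integrable_continuous:
  assumes "continuous_on {s..t} Y"
  shows "set_integrable lborel {s..t} (\<lambda>r. B r (Y r))"
proof -
  have "bounded (Y ` {s..t})" by (intro compact_imp_bounded compact_continuous_image assms compact_Icc)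
  then obtain K where K: "\<forall>r\<in>{s..t}. norm (Y r) \<le> K" by (auto simp: bounded_iff)
  show ?thesis
    by (rule B_set_integrable[of s t Y K])
      (use K borel_measurable_continuous_on_indicator[OF _ assms] in \<open>auto simp: set_borel_measurable_def\<close>)
qed

text \<open>
  The barrier \<open>U\<close> satisfies \<open>|x| + \<integral>\<^sub>s\<^sup>t k c U \<le> U\<close>, and \<open>|B r y| \<le> k c U\<close> whenever \<open>|y\<^sub>i| \<le> U\<close>; so the
  iterates stay between \<open>-U\<close> and \<open>U\<close>, and the first one is below the starting point \<open>U\<close>. As \<open>B\<close> is
  increasing, they decrease. Right continuity of \<open>B\<close>, which is one sided, is enough to pass to
  a decreasing limit.
\<close>

lemma exact_solutions_exist:
  obtains \<Phi> where "(\<lambda>p. \<Phi> (fst p) (snd p)) \<in> borel_measurable (borel \<Otimes>\<^sub>M borel)"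
    "\<And>t x. continuous_on {s..t} (\<lambda>r. \<Phi> r x)"
    "\<And>t x. s \<le> t \<Longrightarrow> ((\<lambda>r. B r (\<Phi> r x)) has_integral (\<Phi> t x - x)) {s..t}"
proof -
  \<comment> \<open>Vectors with coordinates bounded by \<open>U \<ge> 1\<close> satisfy \<open>1 + |y| \<le> k U\<close>.\<close>
  define k where "k = 1 + real CARD('n)"
  have "k \<ge> 1" by (simp add: k_def)
  define C where "C t = (LINT r:{s..t}|lborel. c r)" for t
  have C: "C t = integral {s..t} c" for t
    unfolding C_def by (rule set_borel_integral_eq_integral(2)[OF c_set_integrable]) simp
  have C_mono: "C r \<le> C t" if "r \<le> t" for r t
    unfolding C by (rule integral_subset_le) (use that c_integrable_on c_nonneg in auto)
  have C_nonneg: "0 \<le> C t" for t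
    unfolding C by (rule integral_nonneg[OF c_integrable_on]) (use c_nonneg in auto)
  define U where "U t x = (1 + norm x) * exp (k * C t)" for t and x :: "real^'n"
  have U_mono: "U r x \<le> U t x" if "r \<le> t" for r t x
    unfolding U_def using C_mono[OF that] \<open>k \<ge> 1\<close> by (intro mult_left_mono) auto
  have U_ge: "1 + norm x \<le> U t x" for t x
    unfolding U_def using C_nonneg[of t] \<open>k \<ge> 1\<close> mult_left_mono[of 1 "exp (k * C t)" "1 + norm x"] by simp
  have Uint: "norm x + integral {s..t} (\<lambda>r. k * c r * U r x) \<le> U t x" (is ?le)
    and Uint': "(\<lambda>r. k * c r * U r x) integrable_on {s..t}" (is ?int) for t x
  proof -
    have "?le \<and> ?int"
    proof (cases "s \<le> t")
      case True
      from has_integral_mult_right[OF has_integral_exp_indefinite_integral[OF c_absolutely_integrable True, of k], of "1 + norm x"]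
      have "((\<lambda>r. k * c r * U r x) has_integral (U t x - (1 + norm x))) {s..t}"
        by (simp add: U_def C algebra_simps)
      then show ?thesis by (auto simp: integral_unique has_integral_integrable)
    next
      case False
      then show ?thesis using U_ge[of x t] by auto
    qed
    then show ?le ?int by auto
  qed
  define \<Gamma> where "\<Gamma> = rec_nat (\<lambda>t x. U t x *\<^sub>R (1 :: real^'n)) (\<lambda>_ G t x. x + (LINT r:{s..t}|lborel. B r (G r x)))"
  have \<Gamma>0: "\<Gamma> 0 t x = U t x *\<^sub>R 1" for t x by (simp add: \<Gamma>_def)
  have \<Gamma>S: "\<Gamma> (Suc n) t x = x + (LINT r:{s..t}|lborel. B r (\<Gamma> n r x))" for n t x by (simp add: \<Gamma>_def)
  have C_meas: "C \<in> borel_measurable borel"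
    unfolding C_def by measurable
  have \<Gamma>_meas: "(\<lambda>p. \<Gamma> n (fst p) (snd p)) \<in> borel_measurable (borel \<Otimes>\<^sub>M borel)" for n
  proof (induction n)
    case 0
    note C_meas[measurable]
    show ?case unfolding \<Gamma>0 U_def by measurable
  next
    case (Suc n)
    have [measurable (raw)]: "(\<lambda>x. \<Gamma> n (f x) (g x)) \<in> borel_measurable M"
      if [measurable]: "f \<in> borel_measurable M" "g \<in> borel_measurable M" for M and f :: "'c \<Rightarrow> real" and g
      using measurable_compose[OF measurable_Pair[OF that] Suc.IH] by simp
    show ?case unfolding \<Gamma>S by measurable
  qed
  have \<Gamma>_meas_t: "(\<lambda>t. \<Gamma> n t x) \<in> borel_measurable borel" for n x
    using measurable_compose[OF measurable_Pair[of "\<lambda>t. t" borel borel "\<lambda>_. x" borel] \<Gamma>_meas[of n]] by simp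
  have step_bound: "integral {s..t} g \<in> {- (U t x - norm x) *\<^sub>R 1..(U t x - norm x) *\<^sub>R 1}"
    if "g integrable_on {s..t}" "\<And>r. norm (g r) \<le> k * c r * U r x" for g :: "real \<Rightarrow> real^'n" and t x
  proof -
    have "norm (integral {s..t} g) \<le> integral {s..t} (\<lambda>r. k * c r * U r x)"
      by (rule integral_norm_bound_integral[OF that(1) Uint']) (use that in auto)
    also have "\<dots> \<le> U t x - norm x" using Uint[of x t] by simp
    finally have "\<bar>integral {s..t} g $ i\<bar> \<le> U t x - norm x" for i
      using component_le_norm_cart order_trans by blast
    then show ?thesis by (auto simp: less_eq_vec_def abs_le_iff) (smt (verit))+
  qed
  have B_bound: "norm (B r y) \<le> k * c r * U r x" if "\<And>i. \<bar>y $ i\<bar> \<le> U r x" for r x y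
  proof -
    have "norm y \<le> real CARD('n) * U r x" by (rule norm_le_card_mult) (rule that)
    moreover have "1 \<le> U r x" using U_ge[of x r] norm_ge_zero[of x] by linarith
    ultimately have "1 + norm y \<le> k * U r x" by (simp add: k_def distrib_right)
    then have "c r * (1 + norm y) \<le> c r * (k * U r x)" using c_nonneg by (intro mult_left_mono) auto
    then show ?thesis using B_growth[of r y] by (simp add: mult_ac)
  qed
  have B_int: "set_integrable lborel {s..t} (\<lambda>r. B r (Y r))"
    if "Y \<in> borel_measurable borel" "\<And>r i. \<bar>Y r $ i\<bar> \<le> U r x" for Y t x
  proof (rule B_set_integrable[where K = "real CARD('n) * U t x"])
    show "set_borel_measurable lborel {s..t} Y" using that(1) by (simp add: set_borel_measurable_def)
    show "norm (Y r) \<le> real CARD('n) * U t x" if "r \<in> {s..t}" for r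
      using \<open>\<And>r i. \<bar>Y r $ i\<bar> \<le> U r x\<close>[of r] U_mono[of r t x] that by (intro norm_le_card_mult) (fastforce intro: order_trans)
  qed
  have \<Gamma>_bound: "\<bar>\<Gamma> n t x $ i\<bar> \<le> U t x" for n t x i
  proof (induction n arbitrary: t i)
    case 0
    have "0 \<le> U t x" using U_ge[of x t] norm_ge_zero[of x] by linarith
    then show ?case by (simp add: \<Gamma>0)
  next
    case (Suc n)
    have si: "set_integrable lborel {s..t} (\<lambda>r. B r (\<Gamma> n r x))"
      by (rule B_int[OF \<Gamma>_meas_t Suc.IH])
    have "integral {s..t} (\<lambda>r. B r (\<Gamma> n r x)) \<in> {- (U t x - norm x) *\<^sub>R 1..(U t x - norm x) *\<^sub>R 1}"
      by (intro step_bound set_borel_integral_eq_integral(1)[OF si] B_bound Suc.IH)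
    then have "\<bar>integral {s..t} (\<lambda>r. B r (\<Gamma> n r x)) $ i\<bar> \<le> U t x - norm x"
      by (auto simp: less_eq_vec_def abs_le_iff) (metis minus_diff_eq minus_le_iff)
    then show ?case using component_le_norm_cart[of x i]
      unfolding \<Gamma>S set_borel_integral_eq_integral(2)[OF si] vector_add_component by linarith
  qed
  have \<Gamma>_int: "set_integrable lborel {s..t} (\<lambda>r. B r (\<Gamma> n r x))" for n t x
    by (rule B_int[OF \<Gamma>_meas_t \<Gamma>_bound])
  have \<Gamma>S': "\<Gamma> (Suc n) t x = x + integral {s..t} (\<lambda>r. B r (\<Gamma> n r x))" for n t x
    unfolding \<Gamma>S set_borel_integral_eq_integral(2)[OF \<Gamma>_int] ..
  have \<Gamma>_hint: "((\<lambda>r. B r (\<Gamma> n r x)) has_integral (\<Gamma> (Suc n) t x - x)) {s..t}" for n t x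
    using integrable_integral[OF set_borel_integral_eq_integral(1)[OF \<Gamma>_int]] by (simp add: \<Gamma>S')
  have \<Gamma>_dec: "\<Gamma> (Suc n) t x \<le> \<Gamma> n t x" for n t x
  proof (induction n arbitrary: t)
    case 0
    show ?case using \<Gamma>_bound[of "Suc 0" t x] by (auto simp: \<Gamma>0 less_eq_vec_def abs_le_iff)
  next
    case (Suc n)
    have "\<Gamma> (Suc (Suc n)) t x - x \<le> \<Gamma> (Suc n) t x - x"
      by (rule has_integral_vec_le[OF \<Gamma>_hint \<Gamma>_hint]) (rule B_mono[OF Suc.IH])
    then show ?case by simp
  qed
  have conv: "convergent (\<lambda>n. \<Gamma> n t x $ i)" for t x i
  proof (rule Bseq_monoseq_convergent)
    show "Bseq (\<lambda>n. \<Gamma> n t x $ i)" using \<Gamma>_bound by (intro BseqI'[of _ "U t x"]) simp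
    show "monoseq (\<lambda>n. \<Gamma> n t x $ i)"
      using \<Gamma>_dec by (intro decseq_imp_monoseq decseq_SucI) (auto simp: less_eq_vec_def)
  qed
  define \<Phi> where "\<Phi> t x = (\<chi> i. lim (\<lambda>n. \<Gamma> n t x $ i))" for t x
  have lim: "(\<lambda>n. \<Gamma> n t x) \<longlonglongrightarrow> \<Phi> t x" for t x
    by (rule vec_tendstoI) (use conv in \<open>simp add: \<Phi>_def convergent_LIMSEQ_iff\<close>)
  have \<Phi>_le: "\<Phi> t x \<le> \<Gamma> n t x" for t x n
    unfolding less_eq_vec_def
  proof
    fix i
    have "decseq (\<lambda>n. \<Gamma> n t x $ i)" using \<Gamma>_dec by (intro decseq_SucI) (auto simp: less_eq_vec_def)
    then show "\<Phi> t x $ i \<le> \<Gamma> n t x $ i"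
      using tendsto_vec_nth[OF lim[of t x], of i] by (rule decseq_ge)
  qed
  have B_lim: "(\<lambda>n. B r (\<Gamma> n r x)) \<longlonglongrightarrow> B r (\<Phi> r x)" for r x
  proof (rule vec_tendstoI, rule order_tendstoI)
    fix i a assume "a < B r (\<Phi> r x) $ i"
    then show "\<forall>\<^sub>F n in sequentially. a < B r (\<Gamma> n r x) $ i"
      using B_mono[OF \<Phi>_le, of r r x] by (intro always_eventually) (auto simp: less_eq_vec_def intro: less_le_trans)
  next
    fix i a assume "B r (\<Phi> r x) $ i < a"
    with tendsto_vec_nth[OF B_right_continuous[of r "\<Phi> r x"], of i]
    have "\<forall>\<^sub>F m in sequentially. B r (\<Phi> r x + (1 / real (Suc m)) *\<^sub>R 1) $ i < a" by (rule order_tendstoD)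
    then obtain m where m: "B r (\<Phi> r x + (1 / real (Suc m)) *\<^sub>R 1) $ i < a" by (auto simp: eventually_sequentially)
    have "\<forall>\<^sub>F n in sequentially. \<Gamma> n r x $ j < \<Phi> r x $ j + 1 / real (Suc m)" for j
      by (rule order_tendstoD[OF tendsto_vec_nth[OF lim]]) simp
    then have "\<forall>\<^sub>F n in sequentially. \<forall>j. \<Gamma> n r x $ j < \<Phi> r x $ j + 1 / real (Suc m)"
      by (intro eventually_all_finite) auto
    then show "\<forall>\<^sub>F n in sequentially. B r (\<Gamma> n r x) $ i < a"
    proof (rule eventually_mono)
      fix n assume "\<forall>j. \<Gamma> n r x $ j < \<Phi> r x $ j + 1 / real (Suc m)"
      then have "\<Gamma> n r x \<le> \<Phi> r x + (1 / real (Suc m)) *\<^sub>R 1" by (auto simp: less_eq_vec_def less_imp_le)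
      from B_mono[OF this, of r] m show "B r (\<Gamma> n r x) $ i < a" by (auto simp: less_eq_vec_def intro: le_less_trans)
    qed
  qed
  have eq: "((\<lambda>r. B r (\<Phi> r x)) has_integral (\<Phi> t x - x)) {s..t}" for t x
  proof -
    have int: "(\<lambda>r. B r (\<Phi> r x)) integrable_on {s..t}"
      and l: "(\<lambda>n. integral {s..t} (\<lambda>r. B r (\<Gamma> n r x))) \<longlonglongrightarrow> integral {s..t} (\<lambda>r. B r (\<Phi> r x))"
      by (rule dominated_convergence[OF set_borel_integral_eq_integral(1)[OF \<Gamma>_int] Uint'[of x t] _ B_lim],
          rule B_bound[OF \<Gamma>_bound])+
    have "(\<lambda>n. \<Gamma> (Suc n) t x) \<longlonglongrightarrow> x + integral {s..t} (\<lambda>r. B r (\<Phi> r x))"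
      unfolding \<Gamma>S' by (intro tendsto_add tendsto_const l)
    from LIMSEQ_unique[OF this LIMSEQ_Suc[OF lim]]
    have "integral {s..t} (\<lambda>r. B r (\<Phi> r x)) = \<Phi> t x - x" by (simp add: algebra_simps)
    with integrable_integral[OF int] show ?thesis by simp
  qed
  show thesis
  proof
    show "(\<lambda>p. \<Phi> (fst p) (snd p)) \<in> borel_measurable (borel \<Otimes>\<^sub>M borel)"
      by (rule borel_measurable_LIMSEQ_metric[OF \<Gamma>_meas]) (rule lim)
    show "continuous_on {s..t} (\<lambda>r. \<Phi> r x)" for t x
    proof (rule continuous_on_eq)
      show "continuous_on {s..t} (\<lambda>r. x + integral {s..r} (\<lambda>r. B r (\<Phi> r x)))"
        by (intro continuous_intros indefinite_integral_continuous_1 has_integral_integrable[OF eq])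
      show "x + integral {s..r} (\<lambda>r. B r (\<Phi> r x)) = \<Phi> r x" for r
        using integral_unique[OF eq[of x r]] by simp
    qed
    show "((\<lambda>r. B r (\<Phi> r x)) has_integral (\<Phi> t x - x)) {s..t}" for t x by (rule eq)
  qed
qed

end

section \<open>Comparison with exact solutions\<close>

locale increasing_flow = increasing_field B c for B :: "real \<Rightarrow> real^'n::finite \<Rightarrow> real^'n" and c +
  fixes s :: real and \<Phi> :: "real \<Rightarrow> real^'n \<Rightarrow> real^'n"
  assumes \<Phi>_measurable: "(\<lambda>p. \<Phi> (fst p) (snd p)) \<in> borel_measurable (borel \<Otimes>\<^sub>M borel)"
    and \<Phi>_continuous: "continuous_on {s..t} (\<lambda>r. \<Phi> r x)"
    and \<Phi>_solves: "s \<le> t \<Longrightarrow> ((\<lambda>r. B r (\<Phi> r x)) has_integral (\<Phi> t x - x)) {s..t}"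
begin

lemma \<Phi>_measurable_comp [measurable (raw)]:
  assumes [measurable]: "f \<in> borel_measurable M" "g \<in> borel_measurable M"
  shows "(\<lambda>x. \<Phi> (f x) (g x)) \<in> borel_measurable M"
  using measurable_compose[OF measurable_Pair[OF assms] \<Phi>_measurable] by simp

lemma \<Phi>_start [simp]: "\<Phi> s x = x"
  using has_integral_unique[OF \<Phi>_solves[of s x, unfolded atLeastAtMost_singleton] has_integral_refl(2)] by simp

text \<open>
  The margin \<open>\<rho>\<close> is for curves that are driven by \<open>B\<close> evaluated at distance at most \<open>\<rho>\<close> from the curve.
\<close>

lemma upper_comparison:
  assumes t: "s \<le> t" and \<Gamma>: "continuous_on {s..t} \<Gamma>" and \<rho>: "\<And>i. \<Gamma> s $ i + \<rho> < y $ i"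
    and step: "\<And>v. v \<in> {s..t} \<Longrightarrow> (\<And>u i. u \<in> {s..v} \<Longrightarrow> \<Gamma> u $ i + \<rho> < \<Phi> u y $ i) \<Longrightarrow> \<Gamma> v - \<Gamma> s \<le> \<Phi> v y - y"
  shows "\<Gamma> t - \<Gamma> s \<le> \<Phi> t y - y"
proof -
  have "\<Phi> s y - \<Gamma> s \<le> \<Phi> t y - \<Gamma> t"
  proof (rule gap_persists[where a = s and b = t and \<rho> = \<rho> and D = "\<lambda>r. \<Phi> r y - \<Gamma> r"])
    show "continuous_on {s..t} (\<lambda>r. \<Phi> r y - \<Gamma> r)" by (intro continuous_intros \<Phi>_continuous \<Gamma>)
    show "\<rho> < (\<Phi> s y - \<Gamma> s) $ i" for i using \<rho>[of i] by simp
    show "\<Phi> s y - \<Gamma> s \<le> \<Phi> v y - \<Gamma> v"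
      if v: "v \<in> {s..t}" "\<And>u i. u \<in> {s..v} \<Longrightarrow> \<rho> < (\<Phi> u y - \<Gamma> u) $ i" for v
    proof -
      have "\<Gamma> v - \<Gamma> s \<le> \<Phi> v y - y"
      proof (rule step[OF v(1)])
        show "\<Gamma> u $ i + \<rho> < \<Phi> u y $ i" if "u \<in> {s..v}" for u i
          using v(2)[OF that, of i] by simp
      qed
      then show ?thesis by (simp add: algebra_simps)
    qed
  qed (use t in auto)
  then show ?thesis by (simp add: algebra_simps)
qed

lemma lower_comparison:
  assumes t: "s \<le> t" and \<Gamma>: "continuous_on {s..t} \<Gamma>" and \<rho>: "\<And>i. y $ i + \<rho> < \<Gamma> s $ i"
    and step: "\<And>v. v \<in> {s..t} \<Longrightarrow> (\<And>u i. u \<in> {s..v} \<Longrightarrow> \<Phi> u y $ i + \<rho> < \<Gamma> u $ i) \<Longrightarrow> \<Phi> v y - y \<le> \<Gamma> v - \<Gamma> s"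
  shows "\<Phi> t y - y \<le> \<Gamma> t - \<Gamma> s"
proof -
  have "\<Gamma> s - \<Phi> s y \<le> \<Gamma> t - \<Phi> t y"
  proof (rule gap_persists[where a = s and b = t and \<rho> = \<rho> and D = "\<lambda>r. \<Gamma> r - \<Phi> r y"])
    show "continuous_on {s..t} (\<lambda>r. \<Gamma> r - \<Phi> r y)" by (intro continuous_intros \<Phi>_continuous \<Gamma>)
    show "\<rho> < (\<Gamma> s - \<Phi> s y) $ i" for i using \<rho>[of i] by simp
    show "\<Gamma> s - \<Phi> s y \<le> \<Gamma> v - \<Phi> v y"
      if v: "v \<in> {s..t}" "\<And>u i. u \<in> {s..v} \<Longrightarrow> \<rho> < (\<Gamma> u - \<Phi> u y) $ i" for v
    proof -
      have "\<Phi> v y - y \<le> \<Gamma> v - \<Gamma> s"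
      proof (rule step[OF v(1)])
        show "\<Phi> u y $ i + \<rho> < \<Gamma> u $ i" if "u \<in> {s..v}" for u i
          using v(2)[OF that, of i] by simp
      qed
      then show ?thesis by (simp add: algebra_simps)
    qed
  qed (use t in auto)
  then show ?thesis by (simp add: algebra_simps)
qed

lemma \<Phi>_strictly_increasing:
  assumes t: "s \<le> t" and xy: "x \<lless> y"
  shows "\<Phi> t x \<le> \<Phi> t y"
proof -
  have "\<Phi> t x - \<Phi> s x \<le> \<Phi> t y - y"
  proof (rule upper_comparison[OF t \<Phi>_continuous, where \<rho> = 0])
    show "\<Phi> s x $ i + 0 < y $ i" for i using xy by (simp add: strictly_below_def)
    show "\<Phi> v x - \<Phi> s x \<le> \<Phi> v y - y"
      if v: "v \<in> {s..t}" "\<And>u i. u \<in> {s..v} \<Longrightarrow> \<Phi> u x $ i + 0 < \<Phi> u y $ i" for v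
      unfolding \<Phi>_start
    proof (rule has_integral_vec_le[OF \<Phi>_solves \<Phi>_solves])
      show "B r (\<Phi> r x) \<le> B r (\<Phi> r y)" if "r \<in> {s..v}" for r
        using v(2)[OF that] by (intro B_mono) (auto simp: less_eq_vec_def intro: less_imp_le)
    qed (use v in auto)
  qed
  then have "\<Phi> t x - x \<le> \<Phi> t y - y" by simp
  moreover have "x \<le> y" using xy by (auto simp: strictly_below_def less_eq_vec_def intro: less_imp_le)
  ultimately have "\<Phi> t x - x + x \<le> \<Phi> t y - y + y" by (rule add_mono)
  then show ?thesis by simp
qed

text \<open>
  Since \<open>\<Phi> t\<close> is increasing for the strict order only, its one-sided limits are taken along the
  diagonal.
\<close>

definition jump_free :: "real \<Rightarrow> real^'n \<Rightarrow> bool" where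
  "jump_free t x \<longleftrightarrow> (\<forall>i. \<forall>e>0. \<exists>d>0. \<Phi> t (x + d *\<^sub>R 1) $ i - \<Phi> t (x - d *\<^sub>R 1) $ i < e)"

lemma AE_jump_free: 
  assumes "s \<le> t"
  shows "AE x in lborel. jump_free t x"
proof -
  have "AE x in lborel. \<forall>e>0. \<exists>d>0. \<Phi> t (x + d *\<^sub>R 1) $ i - \<Phi> t (x - d *\<^sub>R 1) $ i < e" for i
    by (rule AE_jump_free_on_diagonal) (use \<Phi>_strictly_increasing[OF assms] in \<open>auto simp: less_eq_vec_def\<close>)
  then show ?thesis unfolding jump_free_def by (subst AE_all_countable) auto
qed

lemma squeezed_eq_flow:
  assumes x: "jump_free t x"
    and up: "\<And>d. d > 0 \<Longrightarrow> z \<le> \<Phi> t (x + d *\<^sub>R 1)" and lo: "\<And>d. d > 0 \<Longrightarrow> \<Phi> t (x - d *\<^sub>R 1) \<le> z"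
    and up': "\<And>d. d > 0 \<Longrightarrow> z' \<le> \<Phi> t (x + d *\<^sub>R 1)" and lo': "\<And>d. d > 0 \<Longrightarrow> \<Phi> t (x - d *\<^sub>R 1) \<le> z'"
  shows "z = z'"
proof -
  have "\<bar>z $ i - z' $ i\<bar> \<le> e" if "e > 0" for e i
  proof -
    obtain d where d: "d > 0" "\<Phi> t (x + d *\<^sub>R 1) $ i - \<Phi> t (x - d *\<^sub>R 1) $ i < e"
      using x \<open>e > 0\<close> unfolding jump_free_def by blast
    show ?thesis using up[OF d(1)] lo[OF d(1)] up'[OF d(1)] lo'[OF d(1)] d(2)
      unfolding less_eq_vec_def by (smt (verit))
  qed
  then have "\<bar>z $ i - z' $ i\<bar> \<le> 0" for i using field_le_epsilon[of "\<bar>z $ i - z' $ i\<bar>" 0] by simp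
  then show ?thesis by (simp add: vec_eq_iff)
qed

end

section \<open>The coordinatewise Euler scheme\<close>

context increasing_field
begin

lemma B_const_set_integrable: "set_integrable lborel {a..b} (\<lambda>r. B r z)"
  by (rule B_integrable_continuous[of a b "\<lambda>_. z"]) simp

lemma B_const_integrable: "(\<lambda>r. B r z) integrable_on {a..b}"
  by (rule set_borel_integral_eq_integral(1)[OF B_const_set_integrable])

lemma integral_B_measurable [measurable]: "(\<lambda>z. integral {a..b} (\<lambda>r. B r z)) \<in> borel_measurable borel"
proof -
  have "(\<lambda>z. LINT r:{a..b}|lborel. B r z) \<in> borel_measurable borel" by measurable
  then show ?thesis by (simp add: set_borel_integral_eq_integral(2)[OF B_const_set_integrable])
qed

lemma integral_B_mono: "x \<le> y \<Longrightarrow> integral {a..b} (\<lambda>r. B r x) \<le> integral {a..b} (\<lambda>r. B r y)"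
  by (rule has_integral_vec_le[OF integrable_integral[OF B_const_integrable] integrable_integral[OF B_const_integrable]])
    (rule B_mono)

lemma norm_integral_B_le: "norm (integral {a..b} (\<lambda>r. B r z)) \<le> integral {a..b} c * (1 + norm z)"
proof -
  have "norm (integral {a..b} (\<lambda>r. B r z)) \<le> integral {a..b} (\<lambda>r. c r * (1 + norm z))"
    by (rule integral_norm_bound_integral[OF B_const_integrable])
      (use B_growth c_integrable_on in \<open>auto intro: integrable_on_mult_left\<close>)
  then show ?thesis by simp
qed

text \<open>
  One time step \<open>[a, b]\<close>, the coordinates in \<open>S\<close> being updated one after the other; \<open>w z i\<close> is the state
  at which the velocity of coordinate \<open>i\<close> is evaluated. Updating all coordinates simultaneously would not
  do: if \<open>G\<close> is increasing, \<open>x + G x\<close> can contract volume, for example when \<open>G\<close> swaps two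
  coordinates.
\<close>

lemma coordinatewise_euler_step:
  fixes S :: "'n set" and a b :: real
  assumes "finite S"
  defines "J z \<equiv> integral {a..b} (\<lambda>r. B r z)" and "\<omega> \<equiv> integral {a..b} c"
  shows "\<exists>E w. E \<in> borel_measurable borel \<and> (\<forall>A\<in>sets borel. emeasure lborel (E -` A) \<le> emeasure lborel A) \<and>
    (\<forall>z i. E z $ i = z $ i + (if i \<in> S then J (w z i) $ i else 0)) \<and>
    (\<forall>z. norm (E z - z) \<le> (1 + norm z) * (exp (real (card S) * \<omega>) - 1)) \<and>
    (\<forall>z i. norm (w z i - z) \<le> (1 + norm z) * (exp (real (card S) * \<omega>) - 1))"
  using \<open>finite S\<close>
proof (induction S rule: finite_induct)
  case empty
  show ?case by (intro exI[of _ "\<lambda>z. z"] exI[of _ "\<lambda>z i. z"]) auto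
next
  case (insert j S)
  then obtain E w where Em: "E \<in> borel_measurable borel"
    and Ec: "\<And>A. A \<in> sets borel \<Longrightarrow> emeasure lborel (E -` A) \<le> emeasure lborel A"
    and Eeq: "\<And>z i. E z $ i = z $ i + (if i \<in> S then J (w z i) $ i else 0)"
    and Eb: "\<And>z. norm (E z - z) \<le> (1 + norm z) * (exp (real (card S) * \<omega>) - 1)"
    and wb: "\<And>z i. norm (w z i - z) \<le> (1 + norm z) * (exp (real (card S) * \<omega>) - 1)"
    by blast
  have \<omega>0: "0 \<le> \<omega>" unfolding \<omega>_def by (rule integral_nonneg[OF c_integrable_on]) (use c_nonneg in auto)
  have mono_exp: "exp (real (card S) * \<omega>) \<le> exp (real (card (insert j S)) * \<omega>)"
    using insert \<omega>0 by (simp add: mult_right_mono)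
  have b_mono: "(1 + norm z) * (exp (real (card S) * \<omega>) - 1) \<le> (1 + norm z) * (exp (real (card (insert j S)) * \<omega>) - 1)" for z :: "real^'n"
    using mono_exp by (intro mult_left_mono) auto
  define T where "T y = y + (J y $ j) *\<^sub>R axis j (1::real)" for y
  have Jm[measurable]: "J \<in> borel_measurable borel" unfolding J_def by measurable
  have Tm: "T \<in> borel_measurable borel" unfolding T_def by measurable
  have Tc: "emeasure lborel (T -` A) \<le> emeasure lborel A" if "A \<in> sets borel" for A
  proof -
    have "emeasure lborel {x. x + (J x $ j) *\<^sub>R axis j (1::real) \<in> A} \<le> emeasure lborel A"
    proof (rule emeasure_directional_shift_preimage_le[OF _ _ that])
      show "(\<lambda>x. J x $ j) \<in> borel_measurable borel" by measurable
      show "J x $ j \<le> J (x + \<tau> *\<^sub>R axis j 1) $ j" if "0 \<le> \<tau>" for x \<tau>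
      proof -
        have "x \<le> x + \<tau> *\<^sub>R axis j 1" using that by (auto simp: less_eq_vec_def axis_def)
        from integral_B_mono[OF this, of a b] show ?thesis by (simp add: J_def less_eq_vec_def)
      qed
    qed
    then show ?thesis by (simp add: T_def vimage_def)
  qed
  define E' where "E' z = T (E z)" for z
  define w' where "w' z i = (if i = j then E z else w z i)" for z i
  show ?case
  proof (intro exI[of _ E'] exI[of _ w'] conjI allI ballI)
    show "E' \<in> borel_measurable borel" unfolding E'_def by (rule measurable_compose[OF Em Tm])
    show "emeasure lborel (E' -` A) \<le> emeasure lborel A" if "A \<in> sets borel" for A
    proof -
      have "E' -` A = E -` (T -` A)" by (auto simp: E'_def)
      also have "emeasure lborel \<dots> \<le> emeasure lborel (T -` A)"
        by (rule Ec) (use measurable_sets_borel[OF Tm that] in simp)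
      also have "\<dots> \<le> emeasure lborel A" by (rule Tc[OF that])
      finally show ?thesis .
    qed
    show "E' z $ i = z $ i + (if i \<in> insert j S then J (w' z i) $ i else 0)" for z i
      using \<open>j \<notin> S\<close> by (auto simp: E'_def T_def w'_def Eeq axis_def)
    show "norm (E' z - z) \<le> (1 + norm z) * (exp (real (card (insert j S)) * \<omega>) - 1)" for z
    proof -
      have Ez: "1 + norm (E z) \<le> (1 + norm z) * exp (real (card S) * \<omega>)"
        using Eb[of z] norm_triangle_sub[of "E z" z] by (simp add: algebra_simps)
      have "norm (E' z - z) = norm ((E z - z) + (J (E z) $ j) *\<^sub>R axis j (1::real))"
        by (simp add: E'_def T_def algebra_simps)
      also have "\<dots> \<le> norm (E z - z) + \<bar>J (E z) $ j\<bar>"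
        by (rule norm_triangle_le) simp
      also have "\<dots> \<le> (1 + norm z) * (exp (real (card S) * \<omega>) - 1) + \<omega> * ((1 + norm z) * exp (real (card S) * \<omega>))"
      proof (rule add_mono[OF Eb])
        have "\<bar>J (E z) $ j\<bar> \<le> \<omega> * (1 + norm (E z))"
          using component_le_norm_cart[of "J (E z)" j] norm_integral_B_le[of a b "E z"] by (simp add: J_def \<omega>_def)
        also have "\<dots> \<le> \<omega> * ((1 + norm z) * exp (real (card S) * \<omega>))" by (rule mult_left_mono[OF Ez \<omega>0])
        finally show "\<bar>J (E z) $ j\<bar> \<le> \<omega> * ((1 + norm z) * exp (real (card S) * \<omega>))" .
      qed
      also have "\<dots> = (1 + norm z) * (exp (real (card S) * \<omega>) * (1 + \<omega>) - 1)" by (simp add: algebra_simps)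
      also have "\<dots> \<le> (1 + norm z) * (exp (real (card S) * \<omega>) * exp \<omega> - 1)"
        by (intro mult_left_mono diff_right_mono) (use exp_ge_add_one_self[of \<omega>] in auto)
      also have "exp (real (card S) * \<omega>) * exp \<omega> = exp (real (card (insert j S)) * \<omega>)"
        using insert by (simp add: exp_add[symmetric] algebra_simps)
      finally show ?thesis .
    qed
    show "norm (w' z i - z) \<le> (1 + norm z) * (exp (real (card (insert j S)) * \<omega>) - 1)" for z i
      using order_trans[OF Eb b_mono] order_trans[OF wb b_mono] by (simp add: w'_def)
  qed
qed

text \<open>
  The discrete trajectory \<open>F k x\<close> is interpolated by the curve \<open>Z\<close> whose coordinate \<open>i\<close> moves, during each
  time step, with the velocity at the frozen state \<open>W r i\<close>. Thus \<open>Z\<close> solves the equation up to evaluating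
  the field at a distance that is controlled by the integral of \<open>c\<close> over one time step.
\<close>

lemma splitting_scheme_fixed_mesh:
  fixes s h :: real and N :: nat
  assumes h: "h > 0"
  defines "\<tau> k \<equiv> s + real k * h" and "d \<equiv> real CARD('n)"
  shows "\<exists>F. F \<in> borel_measurable borel \<and> (\<forall>A\<in>sets borel. emeasure lborel (F -` A) \<le> emeasure lborel A) \<and>
    (\<forall>x. \<exists>Z W. continuous_on {s..\<tau> (Suc N)} Z \<and> Z s = x \<and> Z (\<tau> (Suc N)) = F x \<and>
      (\<forall>v\<in>{s..\<tau> (Suc N)}. ((\<lambda>r. \<chi> i. B r (W r i) $ i) has_integral (Z v - x)) {s..v}) \<and>
      (\<forall>r\<in>{s..\<tau> (Suc N)}. \<exists>k\<le>N. \<forall>i. norm (W r i - Z r) \<le>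
          (1 + norm x) * exp (d * integral {s..\<tau> (Suc N)} c) *
          (exp (d * integral {\<tau> k..\<tau> (Suc k)} c) - 1 + d * integral {\<tau> k..\<tau> (Suc k)} c)))"
proof -
  define \<omega> where "\<omega> k = integral {\<tau> k..\<tau> (Suc k)} c" for k
  have \<omega>0: "0 \<le> \<omega> k" for k unfolding \<omega>_def by (rule integral_nonneg[OF c_integrable_on]) (use c_nonneg in auto)
  have d0: "d \<ge> 0" by (simp add: d_def)
  have \<tau>0: "\<tau> 0 = s" by (simp add: \<tau>_def)
  have \<tau>_less: "\<tau> j < \<tau> k \<longleftrightarrow> j < k" and \<tau>_le: "\<tau> j \<le> \<tau> k \<longleftrightarrow> j \<le> k" for j k
    using h by (auto simp: \<tau>_def)
  have "\<forall>k. \<exists>Ew. fst Ew \<in> borel_measurable borel \<and> (\<forall>A\<in>sets borel. emeasure lborel (fst Ew -` A) \<le> emeasure lborel A) \<and>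
    (\<forall>z i. fst Ew z $ i = z $ i + integral {\<tau> k..\<tau> (Suc k)} (\<lambda>r. B r (snd Ew z i)) $ i) \<and>
    (\<forall>z. norm (fst Ew z - z) \<le> (1 + norm z) * (exp (d * \<omega> k) - 1)) \<and>
    (\<forall>z i. norm (snd Ew z i - z) \<le> (1 + norm z) * (exp (d * \<omega> k) - 1))" (is "\<forall>k. \<exists>Ew. ?P k Ew")
  proof
    fix k
    from coordinatewise_euler_step[OF finite_class.finite_UNIV, of "\<tau> k" "\<tau> (Suc k)"]
    obtain E w where "?P k (E, w)" unfolding d_def \<omega>_def by auto
    then show "\<exists>Ew. ?P k Ew" by blast
  qed
  from choice[OF this] obtain Ew where Ew: "\<And>k. ?P k (Ew k)" by blast
  define E where "E k = fst (Ew k)" for k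
  define w where "w k = snd (Ew k)" for k
  have Em: "E k \<in> borel_measurable borel"
    and Ec: "A \<in> sets borel \<Longrightarrow> emeasure lborel (E k -` A) \<le> emeasure lborel A"
    and Eeq: "E k z $ i = z $ i + integral {\<tau> k..\<tau> (Suc k)} (\<lambda>r. B r (w k z i)) $ i"
    and Eb: "norm (E k z - z) \<le> (1 + norm z) * (exp (d * \<omega> k) - 1)"
    and wb: "norm (w k z i - z) \<le> (1 + norm z) * (exp (d * \<omega> k) - 1)" for k A z i
    using Ew[of k] by (auto simp: E_def w_def)
  define F where "F = rec_nat (\<lambda>x. x) (\<lambda>k G x. E k (G x))"
  have F0: "F 0 x = x" and FS: "F (Suc k) x = E k (F k x)" for k x by (auto simp: F_def)
  have Fm: "F k \<in> borel_measurable borel" for k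
  proof (induction k)
    case 0 show ?case by (subst measurable_cong[where g = "\<lambda>x. x"]) (auto simp: F0)
  next
    case (Suc k)
    show ?case using measurable_compose[OF Suc Em[of k]] by (subst measurable_cong[where g = "\<lambda>x. E k (F k x)"]) (auto simp: FS)
  qed
  have Fc: "emeasure lborel (F k -` A) \<le> emeasure lborel A" if "A \<in> sets borel" for k A
    using that
  proof (induction k arbitrary: A)
    case 0
    have "F 0 -` A = A" by (auto simp: F0)
    then show ?case by simp
  next
    case (Suc k)
    have "F (Suc k) -` A = F k -` (E k -` A)" by (auto simp: FS)
    also have "emeasure lborel \<dots> \<le> emeasure lborel (E k -` A)"
      by (rule Suc.IH) (use measurable_sets_borel[OF Em Suc.prems] in simp)
    also have "\<dots> \<le> emeasure lborel A" by (rule Ec[OF Suc.prems])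
    finally show ?case .
  qed
  define t where "t = \<tau> (Suc N)"
  show ?thesis
  proof (intro exI[of _ "F (Suc N)"] conjI ballI allI)
    show "F (Suc N) \<in> borel_measurable borel" by (rule Fm)
    show "emeasure lborel (F (Suc N) -` A) \<le> emeasure lborel A" if "A \<in> sets borel" for A
      by (rule Fc[OF that])
    fix x :: "real^'n"
    \<comment> \<open>The index of the time step containing \<open>r\<close>; grid points belong to the step that ends there, so that the final time needs no exception.\<close>
    define \<kappa> where "\<kappa> r = (LEAST k. r \<le> \<tau> (Suc k))" for r
    have \<kappa>: "\<kappa> r = k" if "r \<in> {\<tau> k<..\<tau> (Suc k)}" for r k
      unfolding \<kappa>_def
    proof (rule Least_equality)
      show "r \<le> \<tau> (Suc k)" using that by simp
      fix y assume "r \<le> \<tau> (Suc y)"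
      then have "\<tau> k < \<tau> (Suc y)" using that by auto
      then show "k \<le> y" by (simp add: \<tau>_less)
    qed
    have \<kappa>s: "\<kappa> s = 0" unfolding \<kappa>_def by (rule Least_equality) (use h in \<open>auto simp: \<tau>_def\<close>)
    have \<kappa>_in: "\<kappa> r \<le> N \<and> r \<in> {\<tau> (\<kappa> r)..\<tau> (Suc (\<kappa> r))}" if r: "r \<in> {s..t}" for r
    proof (cases "r = s")
      case True
      then show ?thesis using h by (auto simp: \<kappa>s \<tau>_def)
    next
      case False
      have "r \<le> \<tau> (Suc N)" using r by (simp add: t_def)
      then have le: "r \<le> \<tau> (Suc (\<kappa> r))" "\<kappa> r \<le> N" unfolding \<kappa>_def by (rule LeastI, rule Least_le)
      have "\<tau> (\<kappa> r) \<le> r"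
      proof (cases "\<kappa> r")
        case 0 then show ?thesis using r by (simp add: \<tau>0)
      next
        case (Suc m)
        then have "\<not> r \<le> \<tau> (Suc m)" using not_less_Least[of m "\<lambda>k. r \<le> \<tau> (Suc k)"] by (simp add: \<kappa>_def)
        then show ?thesis using Suc by simp
      qed
      then show ?thesis using le by simp
    qed
    \<comment> \<open>Discrete Gronwall bound for the trajectory, independent of the mesh.\<close>
    define K where "K k = (1 + norm x) * exp (d * integral {s..\<tau> k} c)" for k
    have cadd: "integral {s..\<tau> k} c + \<omega> k = integral {s..\<tau> (Suc k)} c" for k
      unfolding \<omega>_def using Henstock_Kurzweil_Integration.integral_combine[of s "\<tau> k" "\<tau> (Suc k)" c] c_integrable_on \<tau>_le[of 0 k] \<tau>_le[of k "Suc k"] \<tau>0 by simp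
    have KS: "K k * exp (d * \<omega> k) = K (Suc k)" for k
      unfolding K_def cadd[symmetric] by (simp add: exp_add[symmetric] algebra_simps)
    have FK: "1 + norm (F k x) \<le> K k" for k
    proof (induction k)
      case 0 show ?case by (simp add: F0 K_def \<tau>0)
    next
      case (Suc k)
      have "1 + norm (F (Suc k) x) \<le> (1 + norm (F k x)) * exp (d * \<omega> k)"
        using Eb[of k "F k x"] norm_triangle_sub[of "E k (F k x)" "F k x"] by (simp add: FS algebra_simps)
      also have "\<dots> \<le> K k * exp (d * \<omega> k)" by (intro mult_right_mono Suc.IH) auto
      finally show ?case by (simp add: KS)
    qed
    have K_mono: "K k \<le> K (Suc N)" if "k \<le> Suc N" for k
    proof -
      have "integral {s..\<tau> k} c \<le> integral {s..\<tau> (Suc N)} c"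
        by (rule integral_subset_le) (use that \<tau>_le c_integrable_on c_nonneg in \<open>auto intro: order_trans\<close>)
      then show ?thesis unfolding K_def using d0 by (intro mult_left_mono) (auto intro: mult_left_mono)
    qed
    have K0: "0 \<le> K k" for k using FK[of k] norm_ge_zero[of "F k x"] by linarith
    define W where "W r i = w (\<kappa> r) (F (\<kappa> r) x) i" for r i
    define V where "V r = (\<chi> i. B r (W r i) $ i)" for r
    have wK: "1 + norm (w k (F k x) i) \<le> K (Suc k)" for k i
    proof -
      have "1 + norm (w k (F k x) i) \<le> (1 + norm (F k x)) * exp (d * \<omega> k)"
        using wb[of k "F k x" i] norm_triangle_sub[of "w k (F k x) i" "F k x"] by (simp add: algebra_simps)
      also have "\<dots> \<le> K k * exp (d * \<omega> k)" by (intro mult_right_mono FK) auto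
      finally show ?thesis by (simp add: KS)
    qed
    have V_piece: "(V has_integral (\<chi> i. integral {\<tau> k..v} (\<lambda>r. B r (w k (F k x) i)) $ i)) {\<tau> k..v}"
      if v: "v \<in> {\<tau> k..\<tau> (Suc k)}" for k v
    proof (rule has_integral_spike[of "{\<tau> k}" _ _ "\<lambda>r. \<chi> i. B r (w k (F k x) i) $ i"])
      show "V r = (\<chi> i. B r (w k (F k x) i) $ i)" if "r \<in> {\<tau> k..v} - {\<tau> k}" for r
        using \<kappa>[of r k] that v by (auto simp: V_def W_def)
      have "((\<lambda>r. \<Sum>i\<in>UNIV. (B r (w k (F k x) i) $ i) *\<^sub>R axis i (1::real)) has_integral
          (\<Sum>i\<in>UNIV. (integral {\<tau> k..v} (\<lambda>r. B r (w k (F k x) i)) $ i) *\<^sub>R axis i 1)) {\<tau> k..v}"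
      proof (intro has_integral_sum finite has_integral_scaleR_left)
        fix i
        show "((\<lambda>r. B r (w k (F k x) i) $ i) has_integral integral {\<tau> k..v} (\<lambda>r. B r (w k (F k x) i)) $ i) {\<tau> k..v}"
          using has_integral_linear[OF integrable_integral[OF B_const_integrable] bounded_linear_vec_nth] by (simp add: comp_def)
      qed
      moreover have "(\<Sum>i\<in>UNIV. g i *\<^sub>R axis i (1::real)) = (\<chi> i. g i)" for g :: "'n \<Rightarrow> real"
        by (simp add: vec_eq_iff axis_def if_distrib cong: if_cong)
      ultimately show "((\<lambda>r. \<chi> i. B r (w k (F k x) i) $ i) has_integral (\<chi> i. integral {\<tau> k..v} (\<lambda>r. B r (w k (F k x) i)) $ i)) {\<tau> k..v}"
        by simp
    qed simp
    have V_F: "(V has_integral (F k x - x)) {s..\<tau> k}" for k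
    proof (induction k)
      case 0 show ?case by (simp add: F0 \<tau>0 has_integral_refl)
    next
      case (Suc k)
      have "(V has_integral (F k x - x) + (\<chi> i. integral {\<tau> k..\<tau> (Suc k)} (\<lambda>r. B r (w k (F k x) i)) $ i)) {s..\<tau> (Suc k)}"
        by (rule has_integral_combine[OF _ _ Suc.IH V_piece]) (use \<tau>_le[of 0 k] \<tau>_le[of k "Suc k"] \<tau>0 in auto)
      also have "(F k x - x) + (\<chi> i. integral {\<tau> k..\<tau> (Suc k)} (\<lambda>r. B r (w k (F k x) i)) $ i) = F (Suc k) x - x"
        by (simp add: vec_eq_iff FS Eeq)
      finally show ?case .
    qed
    have V_int: "V integrable_on {s..t}" using V_F[of "Suc N"] by (auto simp: t_def)
    define Z where "Z v = x + integral {s..v} V" for v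
    have ZF: "Z (\<tau> k) = F k x" for k using integral_unique[OF V_F[of k]] by (simp add: Z_def)
    have V_bound: "norm (V r) \<le> d * K (Suc N) * c r" if "r \<in> {s..t}" for r
    proof -
      have "\<bar>V r $ i\<bar> \<le> c r * K (Suc N)" for i
      proof -
        have "\<bar>V r $ i\<bar> \<le> norm (B r (W r i))" unfolding V_def by (simp add: component_le_norm_cart)
        also have "\<dots> \<le> c r * (1 + norm (W r i))" by (rule B_growth)
        also have "\<dots> \<le> c r * K (Suc N)"
          unfolding W_def using order_trans[OF wK K_mono] \<kappa>_in[OF that] c_nonneg by (intro mult_left_mono) auto
        finally show ?thesis .
      qed
      from norm_le_card_mult[OF this] show ?thesis by (simp add: d_def mult_ac)
    qed
    show "\<exists>Z W. continuous_on {s..\<tau> (Suc N)} Z \<and> Z s = x \<and> Z (\<tau> (Suc N)) = F (Suc N) x \<and>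
      (\<forall>v\<in>{s..\<tau> (Suc N)}. ((\<lambda>r. \<chi> i. B r (W r i) $ i) has_integral (Z v - x)) {s..v}) \<and>
      (\<forall>r\<in>{s..\<tau> (Suc N)}. \<exists>k\<le>N. \<forall>i. norm (W r i - Z r) \<le>
          (1 + norm x) * exp (d * integral {s..\<tau> (Suc N)} c) *
          (exp (d * integral {\<tau> k..\<tau> (Suc k)} c) - 1 + d * integral {\<tau> k..\<tau> (Suc k)} c))"
      unfolding t_def[symmetric]
    proof (intro exI[of _ Z] exI[of _ W] conjI ballI)
      show "continuous_on {s..t} Z" unfolding Z_def
        by (intro continuous_intros indefinite_integral_continuous_1 V_int)
      show "Z s = x" by (simp add: Z_def)
      show "Z t = F (Suc N) x" by (simp add: t_def ZF)
      show "((\<lambda>r. \<chi> i. B r (W r i) $ i) has_integral (Z v - x)) {s..v}" if "v \<in> {s..t}" for v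
      proof -
        have "V integrable_on {s..v}" by (rule integrable_on_subinterval[OF V_int]) (use that in auto)
        from integrable_integral[OF this] show ?thesis by (simp add: Z_def V_def[abs_def])
      qed
      fix r assume r: "r \<in> {s..t}"
      define k where "k = \<kappa> r"
      have k: "k \<le> N" "r \<in> {\<tau> k..\<tau> (Suc k)}" using \<kappa>_in[OF r] by (auto simp: k_def)
      have sub: "{\<tau> k..r} \<subseteq> {s..t}" using k r \<tau>_le[of 0 k] \<tau>0 by auto
      have Vr: "V integrable_on {s..r}" "V integrable_on {\<tau> k..r}"
        by (rule integrable_on_subinterval[OF V_int]; use sub r in auto)+
      have "integral {s..\<tau> k} V + integral {\<tau> k..r} V = integral {s..r} V"
        by (rule Henstock_Kurzweil_Integration.integral_combine) (use k \<tau>_le[of 0 k] \<tau>0 Vr in auto)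
      then have "Z r - F k x = integral {\<tau> k..r} V" unfolding ZF[symmetric] by (simp add: Z_def algebra_simps)
      also have "norm \<dots> \<le> integral {\<tau> k..r} (\<lambda>r. d * K (Suc N) * c r)"
        by (rule integral_norm_bound_integral[OF Vr(2)])
          (use V_bound sub c_integrable_on in \<open>auto intro: integrable_on_mult_right\<close>)
      also have "\<dots> \<le> integral {\<tau> k..\<tau> (Suc k)} (\<lambda>r. d * K (Suc N) * c r)"
        by (rule integral_subset_le)
          (use k K0 d0 c_nonneg c_integrable_on in \<open>auto intro: integrable_on_mult_right\<close>)
      also have "\<dots> = d * K (Suc N) * \<omega> k" by (simp add: \<omega>_def)
      finally have Zd: "norm (Z r - F k x) \<le> d * K (Suc N) * \<omega> k" .
      show "\<exists>k\<le>N. \<forall>i. norm (W r i - Z r) \<le>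
          (1 + norm x) * exp (d * integral {s..t} c) *
          (exp (d * integral {\<tau> k..\<tau> (Suc k)} c) - 1 + d * integral {\<tau> k..\<tau> (Suc k)} c)"
      proof (intro exI[of _ k] conjI allI k(1))
        fix i
        have "norm (W r i - Z r) = norm ((w k (F k x) i - F k x) - (Z r - F k x))"
          by (simp add: W_def k_def)
        also have "\<dots> \<le> norm (w k (F k x) i - F k x) + norm (Z r - F k x)" by (rule norm_triangle_ineq4)
        also have "\<dots> \<le> K (Suc N) * (exp (d * \<omega> k) - 1) + d * K (Suc N) * \<omega> k"
        proof (rule add_mono[OF order_trans[OF wb] Zd])
          show "(1 + norm (F k x)) * (exp (d * \<omega> k) - 1) \<le> K (Suc N) * (exp (d * \<omega> k) - 1)"
            using order_trans[OF FK K_mono[of k]] k d0 \<omega>0[of k] by (intro mult_right_mono) auto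
        qed
        also have "\<dots> = K (Suc N) * (exp (d * \<omega> k) - 1 + d * \<omega> k)" by (simp add: algebra_simps)
        finally show "norm (W r i - Z r) \<le> (1 + norm x) * exp (d * integral {s..t} c) *
          (exp (d * integral {\<tau> k..\<tau> (Suc k)} c) - 1 + d * integral {\<tau> k..\<tau> (Suc k)} c)"
          by (simp add: K_def t_def \<omega>_def)
      qed
    qed
  qed
qed

end

section \<open>Compression of volume by the flow\<close>

lemma nn_integral_indicator_vimage:
  assumes f: "f \<in> borel_measurable borel" and U: "U \<in> sets borel"
  shows "(\<integral>\<^sup>+x. indicator U (f x) \<partial>lborel) = emeasure lborel (f -` U)"
proof -
  have eq: "(indicator U (f x) :: ennreal) = indicator (f -` U) x" for x by (simp add: indicator_def)
  show ?thesis unfolding eq using measurable_sets_borel[OF f U] by (intro nn_integral_indicator) simp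
qed

context increasing_flow
begin

text \<open>
  A curve \<open>Z\<close> from \<open>x\<close> to \<open>y\<close> whose coordinate \<open>i\<close> is driven by \<open>B\<close> evaluated at a point \<open>W r i\<close> within \<open>\<rho>\<close>
  of the curve.
\<close>

definition approximate_solution :: "real \<Rightarrow> real \<Rightarrow> real^'n \<Rightarrow> real^'n \<Rightarrow> bool" where
  "approximate_solution \<rho> t x y \<longleftrightarrow> (\<exists>Z W. continuous_on {s..t} Z \<and> Z s = x \<and> Z t = y \<and>
      (\<forall>v\<in>{s..t}. ((\<lambda>r. \<chi> i. B r (W r i) $ i) has_integral (Z v - x)) {s..v}) \<and>
      (\<forall>r\<in>{s..t}. \<forall>i. norm (W r i - Z r) \<le> \<rho>))"

definition splitting_approximants :: "real \<Rightarrow> (nat \<Rightarrow> real^'n \<Rightarrow> real^'n) \<Rightarrow> bool" where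
  "splitting_approximants t F \<longleftrightarrow>
    (\<forall>N. F N \<in> borel_measurable borel) \<and>
    (\<forall>N. \<forall>A\<in>sets borel. emeasure lborel (F N -` A) \<le> emeasure lborel A) \<and>
    (\<forall>x. \<forall>\<rho>>0. \<forall>\<^sub>F N in sequentially. approximate_solution \<rho> t x (F N x))"

lemma splitting_approximants_exist:
  assumes st: "s < t"
  shows "\<exists>F. splitting_approximants t F"
proof -
  define h where "h N = (t - s) / real (Suc N)" for N
  define \<tau> where "\<tau> N k = s + real k * h N" for N k
  define d where "d = real CARD('n)"
  have h: "h N > 0" and \<tau>t: "\<tau> N (Suc N) = t" for N using st by (auto simp: h_def \<tau>_def)
  have "\<forall>N. \<exists>F. F \<in> borel_measurable borel \<and> (\<forall>A\<in>sets borel. emeasure lborel (F -` A) \<le> emeasure lborel A) \<and>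
    (\<forall>x. \<exists>Z W. continuous_on {s..t} Z \<and> Z s = x \<and> Z t = F x \<and>
      (\<forall>v\<in>{s..t}. ((\<lambda>r. \<chi> i. B r (W r i) $ i) has_integral (Z v - x)) {s..v}) \<and>
      (\<forall>r\<in>{s..t}. \<exists>k\<le>N. \<forall>i. norm (W r i - Z r) \<le>
          (1 + norm x) * exp (d * integral {s..t} c) *
          (exp (d * integral {\<tau> N k..\<tau> N (Suc k)} c) - 1 + d * integral {\<tau> N k..\<tau> N (Suc k)} c)))"
    (is "\<forall>N. \<exists>F. ?P N F")
  proof
    fix N
    from splitting_scheme_fixed_mesh[OF h[of N], of s N, folded \<tau>_def d_def, unfolded \<tau>t]
    show "\<exists>F. ?P N F" .
  qed
  from choice[OF this] obtain F where F: "\<And>N. ?P N (F N)" by blast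
  show ?thesis unfolding splitting_approximants_def
  proof (intro exI[of _ F] conjI allI impI)
    show "F N \<in> borel_measurable borel" for N using F by blast
    show "\<forall>A\<in>sets borel. emeasure lborel (F N -` A) \<le> emeasure lborel A" for N using F by blast
    fix x :: "real^'n" and \<rho> :: real assume "\<rho> > 0"
    define K where "K = (1 + norm x) * exp (d * integral {s..t} c)"
    have "K > 0" unfolding K_def by (intro mult_pos_pos) (auto intro: add_pos_nonneg)
    have "((\<lambda>\<eta>. K * (exp (d * \<eta>) - 1 + d * \<eta>)) \<longlongrightarrow> K * (exp (d * 0) - 1 + d * 0)) (at 0)"
      by (intro tendsto_intros)
    then have "\<forall>\<^sub>F \<eta> in at 0. K * (exp (d * \<eta>) - 1 + d * \<eta>) < \<rho>"
      by (rule order_tendstoD) (use \<open>\<rho> > 0\<close> in simp)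
    then obtain \<eta> where \<eta>: "\<eta> > 0" "\<And>y. y \<noteq> 0 \<Longrightarrow> dist y 0 < \<eta> \<Longrightarrow> K * (exp (d * y) - 1 + d * y) < \<rho>"
      unfolding eventually_at by blast
    \<comment> \<open>A fine mesh makes the integral of \<open>c\<close> over every time step small.\<close>
    have "uniformly_continuous_on {s..t} (\<lambda>r. integral {s..r} c)"
      by (intro compact_uniformly_continuous compact_Icc indefinite_integral_continuous_1 c_integrable_on)
    then obtain \<delta> where \<delta>: "\<delta> > 0" "\<And>u v. u \<in> {s..t} \<Longrightarrow> v \<in> {s..t} \<Longrightarrow> dist v u < \<delta> \<Longrightarrow>
        dist (integral {s..v} c) (integral {s..u} c) < \<eta>"
      unfolding uniformly_continuous_on_def using \<eta>(1) by metis
    have "(\<lambda>N. (t - s) * inverse (real (Suc N))) \<longlonglongrightarrow> (t - s) * 0"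
      by (intro tendsto_intros LIMSEQ_inverse_real_of_nat)
    then have "\<forall>\<^sub>F N in sequentially. h N < \<delta>"
      using order_tendstoD(2)[of "\<lambda>N. (t - s) * inverse (real (Suc N))"] \<delta>(1) by (simp add: h_def divide_inverse)
    then show "\<forall>\<^sub>F N in sequentially. approximate_solution \<rho> t x (F N x)"
    proof (rule eventually_mono)
      fix N assume hN: "h N < \<delta>"
      have small: "K * (exp (d * integral {\<tau> N k..\<tau> N (Suc k)} c) - 1 + d * integral {\<tau> N k..\<tau> N (Suc k)} c) \<le> \<rho>"
        if "k \<le> N" for k
      proof -
        have le: "s \<le> \<tau> N k" "\<tau> N k \<le> \<tau> N (Suc k)" using h[of N] by (auto simp: \<tau>_def algebra_simps)
        have "\<tau> N (Suc k) \<le> \<tau> N (Suc N)" using h[of N] that by (simp add: \<tau>_def)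
        then have le2: "\<tau> N (Suc k) \<le> t" by (simp add: \<tau>t)
        have "dist (\<tau> N (Suc k)) (\<tau> N k) = h N" using h[of N] by (simp add: \<tau>_def dist_real_def algebra_simps)
        then have "dist (integral {s..\<tau> N (Suc k)} c) (integral {s..\<tau> N k} c) < \<eta>"
          using \<delta>(2)[of "\<tau> N k" "\<tau> N (Suc k)"] le le2 hN by simp
        moreover have "integral {s..\<tau> N k} c + integral {\<tau> N k..\<tau> N (Suc k)} c = integral {s..\<tau> N (Suc k)} c"
          by (rule Henstock_Kurzweil_Integration.integral_combine) (use le c_integrable_on in auto)
        ultimately have "dist (integral {\<tau> N k..\<tau> N (Suc k)} c) 0 < \<eta>" by (simp add: dist_real_def)
        with \<eta>(2)[of "integral {\<tau> N k..\<tau> N (Suc k)} c"] \<open>\<rho> > 0\<close> show ?thesis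
          by (cases "integral {\<tau> N k..\<tau> N (Suc k)} c = 0") (auto simp del: integral_eq_0_iff)
      qed
      from F[of N] obtain Z W where ZW: "continuous_on {s..t} Z" "Z s = x" "Z t = F N x"
        "\<forall>v\<in>{s..t}. ((\<lambda>r. \<chi> i. B r (W r i) $ i) has_integral (Z v - x)) {s..v}"
        "\<forall>r\<in>{s..t}. \<exists>k\<le>N. \<forall>i. norm (W r i - Z r) \<le> K *
          (exp (d * integral {\<tau> N k..\<tau> N (Suc k)} c) - 1 + d * integral {\<tau> N k..\<tau> N (Suc k)} c)"
        unfolding K_def by blast
      have "norm (W r i - Z r) \<le> \<rho>" if "r \<in> {s..t}" for r i
        using ZW(5) that small order_trans by meson
      with ZW show "approximate_solution \<rho> t x (F N x)" unfolding approximate_solution_def by blast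
    qed
  qed
qed

text \<open>
  Start the exact solutions at \<open>x \<plusminus> d1\<close>. Once the error \<open>\<rho>\<close> is less than \<open>d\<close>, the approximate solution
  cannot cross them, because as long as it keeps the distance \<open>\<rho>\<close> its velocity is ordered with theirs.
\<close>

lemma splitting_approximants_tendsto:
  assumes F: "splitting_approximants t F" and t: "s \<le> t" and x: "jump_free t x"
  shows "(\<lambda>N. F N x) \<longlonglongrightarrow> \<Phi> t x"
proof (rule vec_tendstoI, rule tendstoI)
  fix i and e :: real assume "e > 0"
  obtain d where d: "d > 0" "\<Phi> t (x + d *\<^sub>R 1) $ i - \<Phi> t (x - d *\<^sub>R 1) $ i < e"
    using x \<open>e > 0\<close> unfolding jump_free_def by blast
  \<comment> \<open>Any value strictly between 0 and \<open>d\<close> would do.\<close>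
  define \<rho> where "\<rho> = d / 2"
  have "\<rho> > 0" using d by (simp add: \<rho>_def)
  have mid: "\<Phi> t (x - d *\<^sub>R 1) \<le> \<Phi> t x" "\<Phi> t x \<le> \<Phi> t (x + d *\<^sub>R 1)"
    using d by (auto intro!: \<Phi>_strictly_increasing t simp: strictly_below_def)
  have ev: "\<forall>\<^sub>F N in sequentially. approximate_solution \<rho> t x (F N x)"
    using F \<open>\<rho> > 0\<close> unfolding splitting_approximants_def by blast
  show "\<forall>\<^sub>F N in sequentially. dist (F N x $ i) (\<Phi> t x $ i) < e"
    using ev
  proof (rule eventually_mono)
    fix N assume "approximate_solution \<rho> t x (F N x)"
    then obtain Z W where Z: "continuous_on {s..t} Z" "Z s = x" "Z t = F N x"
      and Zint: "\<And>v. v \<in> {s..t} \<Longrightarrow> ((\<lambda>r. \<chi> i. B r (W r i) $ i) has_integral (Z v - x)) {s..v}"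
      and W: "\<And>r i. r \<in> {s..t} \<Longrightarrow> norm (W r i - Z r) \<le> \<rho>"
      unfolding approximate_solution_def by blast
    have Wc: "\<bar>W r i $ j - Z r $ j\<bar> \<le> \<rho>" if "r \<in> {s..t}" for r i j
      using component_le_norm_cart[of "W r i - Z r" j] W[OF that, of i] by simp
    have "Z t - Z s \<le> \<Phi> t (x + d *\<^sub>R 1) - (x + d *\<^sub>R 1)"
    proof (rule upper_comparison[OF t Z(1), where \<rho> = \<rho>])
      show "Z s $ i + \<rho> < (x + d *\<^sub>R 1) $ i" for i using d by (simp add: Z \<rho>_def)
      show "Z v - Z s \<le> \<Phi> v (x + d *\<^sub>R 1) - (x + d *\<^sub>R 1)"
        if v: "v \<in> {s..t}" "\<And>u i. u \<in> {s..v} \<Longrightarrow> Z u $ i + \<rho> < \<Phi> u (x + d *\<^sub>R 1) $ i" for v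
        unfolding Z(2)
      proof (rule has_integral_vec_le[OF Zint[OF v(1)] \<Phi>_solves])
        fix r assume r: "r \<in> {s..v}"
        then have rt: "r \<in> {s..t}" using v(1) by auto
        have "W r i \<le> \<Phi> r (x + d *\<^sub>R 1)" for i
          unfolding less_eq_vec_def using Wc[OF rt, of i] v(2)[OF r] by (smt (verit))
        from B_mono[OF this, of r] show "(\<chi> i. B r (W r i) $ i) \<le> B r (\<Phi> r (x + d *\<^sub>R 1))"
          by (auto simp: less_eq_vec_def)
      qed (use v in auto)
    qed
    then have 1: "F N x $ i \<le> \<Phi> t (x + d *\<^sub>R 1) $ i"
      using d by (auto simp: Z less_eq_vec_def dest!: spec[of _ i])
    have "\<Phi> t (x - d *\<^sub>R 1) - (x - d *\<^sub>R 1) \<le> Z t - Z s"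
    proof (rule lower_comparison[OF t Z(1), where \<rho> = \<rho>])
      show "(x - d *\<^sub>R 1) $ i + \<rho> < Z s $ i" for i using d by (simp add: Z \<rho>_def)
      show "\<Phi> v (x - d *\<^sub>R 1) - (x - d *\<^sub>R 1) \<le> Z v - Z s"
        if v: "v \<in> {s..t}" "\<And>u i. u \<in> {s..v} \<Longrightarrow> \<Phi> u (x - d *\<^sub>R 1) $ i + \<rho> < Z u $ i" for v
        unfolding Z(2)
      proof (rule has_integral_vec_le[OF \<Phi>_solves Zint[OF v(1)]])
        fix r assume r: "r \<in> {s..v}"
        then have rt: "r \<in> {s..t}" using v(1) by auto
        have "\<Phi> r (x - d *\<^sub>R 1) \<le> W r i" for i
          unfolding less_eq_vec_def using Wc[OF rt, of i] v(2)[OF r] by (smt (verit))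
        from B_mono[OF this, of r] show "B r (\<Phi> r (x - d *\<^sub>R 1)) \<le> (\<chi> i. B r (W r i) $ i)"
          by (auto simp: less_eq_vec_def)
      qed (use v in auto)
    qed
    then have 2: "\<Phi> t (x - d *\<^sub>R 1) $ i \<le> F N x $ i"
      using d by (auto simp: Z less_eq_vec_def dest!: spec[of _ i])
    show "dist (F N x $ i) (\<Phi> t x $ i) < e"
      using 1 2 d(2) mid unfolding less_eq_vec_def dist_real_def by (smt (verit))
  qed
qed

text \<open>
  For open sets, membership of the limit implies eventual membership of the approximants, so that Fatou's lemma
  applies.
\<close>

lemma emeasure_flow_preimage_open_le:
  assumes t: "s < t" and U: "open U"
  shows "emeasure lborel (\<Phi> t -` U) \<le> emeasure lborel U"
proof -
  obtain F where F: "splitting_approximants t F" using splitting_approximants_exist[OF t] by blast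
  have Fm[measurable]: "F N \<in> borel_measurable borel"
    and Fc: "\<And>A. A \<in> sets borel \<Longrightarrow> emeasure lborel (F N -` A) \<le> emeasure lborel A" for N
    using F unfolding splitting_approximants_def by blast+
  have [measurable]: "U \<in> sets borel" using U by simp
  have \<Phi>m[measurable]: "\<Phi> t \<in> borel_measurable borel" by measurable
  have "emeasure lborel (\<Phi> t -` U) = (\<integral>\<^sup>+x. indicator U (\<Phi> t x) \<partial>lborel)"
    by (rule nn_integral_indicator_vimage[OF \<Phi>m, symmetric]) simp
  also have "\<dots> \<le> (\<integral>\<^sup>+x. liminf (\<lambda>N. indicator U (F N x)) \<partial>lborel)"
  proof (rule nn_integral_mono_AE)
    show "AE x in lborel. indicator U (\<Phi> t x) \<le> liminf (\<lambda>N. indicator U (F N x) :: ennreal)"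
      using AE_jump_free[OF less_imp_le[OF t]]
    proof (rule eventually_mono)
      fix x assume x: "jump_free t x"
      show "indicator U (\<Phi> t x) \<le> liminf (\<lambda>N. indicator U (F N x) :: ennreal)"
      proof (cases "\<Phi> t x \<in> U")
        case True
        then have "\<forall>\<^sub>F N in sequentially. F N x \<in> U"
          using topological_tendstoD[OF splitting_approximants_tendsto[OF F less_imp_le[OF t] x] U] by blast
        then have "\<forall>\<^sub>F N in sequentially. (1::ennreal) \<le> indicator U (F N x)"
          by (rule eventually_mono) simp
        then have "1 \<le> liminf (\<lambda>N. indicator U (F N x) :: ennreal)" by (rule Liminf_bounded)
        then show ?thesis using True by simp
      qed simp
    qed
  qed
  also have "\<dots> \<le> liminf (\<lambda>N. \<integral>\<^sup>+x. indicator U (F N x) \<partial>lborel)"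
    by (rule nn_integral_liminf) measurable
  also have "\<dots> \<le> liminf (\<lambda>N. emeasure lborel U)"
  proof (rule Liminf_mono, rule always_eventually, rule allI)
    fix N
    have "(\<integral>\<^sup>+x. indicator U (F N x) \<partial>lborel) = emeasure lborel (F N -` U)"
      by (rule nn_integral_indicator_vimage[OF Fm]) simp
    also have "\<dots> \<le> emeasure lborel U" by (rule Fc) simp
    finally show "(\<integral>\<^sup>+x. indicator U (F N x) \<partial>lborel) \<le> emeasure lborel U" .
  qed
  also have "\<dots> = emeasure lborel U" by (rule Liminf_const) simp
  finally show ?thesis .
qed

theorem emeasure_flow_preimage_le:
  assumes t: "s \<le> t" and A: "A \<in> sets borel"
  shows "emeasure lborel (\<Phi> t -` A) \<le> emeasure lborel A"
proof (cases "s = t")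
  case True
  then have "\<Phi> t -` A = A" using \<Phi>_start by auto
  then show ?thesis by simp
next
  case False
  then have st: "s < t" using t by simp
  have \<Phi>m[measurable]: "\<Phi> t \<in> borel_measurable borel" by measurable
  show ?thesis
  proof (rule ennreal_le_epsilon)
    fix e :: real assume "e > 0"
    obtain U where U: "open U" "A \<subseteq> U" "emeasure lborel (U - A) < e"
      by (rule outer_regular_lborel[OF A \<open>e > 0\<close>])
    have "emeasure lborel (\<Phi> t -` A) \<le> emeasure lborel (\<Phi> t -` U)"
      by (rule emeasure_mono) (use U measurable_sets_borel[OF \<Phi>m, of U] in auto)
    also have "\<dots> \<le> emeasure lborel U" by (rule emeasure_flow_preimage_open_le[OF st U(1)])
    also have "\<dots> = emeasure lborel (A \<union> (U - A))" using U(2) by (simp add: Un_absorb1)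
    also have "\<dots> \<le> emeasure lborel A + emeasure lborel (U - A)"
      by (rule emeasure_subadditive) (use A U in auto)
    also have "\<dots> \<le> emeasure lborel A + ennreal e" using U(3) by (intro add_left_mono) auto
    finally show "emeasure lborel (\<Phi> t -` A) \<le> emeasure lborel A + ennreal e" .
  qed
qed

end

section \<open>A Borel version of the velocity field\<close>

lemma increasing_cadlag_mono: "increasing_cadlag \<psi> \<Longrightarrow> x \<le> y \<Longrightarrow> \<psi> x \<le> \<psi> y"
  unfolding increasing_cadlag_def by (auto dest: monoD)

lemma increasing_cadlag_right_continuous:
  assumes \<psi>: "increasing_cadlag \<psi>"
  shows "(\<psi> \<longlongrightarrow> \<psi> x) (at x within {y. x \<le> y})"
proof (rule vec_tendstoI, rule order_tendstoI)
  fix i a assume a: "a < \<psi> x $ i"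
  have "\<forall>\<^sub>F y in at x within {y. x \<le> y}. x \<le> y" by (auto simp: eventually_at_filter)
  then show "\<forall>\<^sub>F y in at x within {y. x \<le> y}. a < \<psi> y $ i"
    by (rule eventually_mono) (use increasing_cadlag_mono[OF \<psi>] a in \<open>force simp: less_eq_vec_def intro: less_le_trans\<close>)
next
  fix i a assume a: "\<psi> x $ i < a"
  have "Limsup (at x within {y. x \<le> y}) (\<lambda>y. ereal (\<psi> y $ i)) < ereal a"
    using \<psi> a unfolding increasing_cadlag_def by (metis less_ereal.simps(1))
  then have "\<forall>\<^sub>F y in at x within {y. x \<le> y}. ereal (\<psi> y $ i) < ereal a" by (rule Limsup_lessD)
  then show "\<forall>\<^sub>F y in at x within {y. x \<le> y}. \<psi> y $ i < a" by simp
qed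

lemma dense_right_sequence:
  fixes Q :: "(real^'n::finite) set"
  assumes "closure Q = UNIV"
  obtains q where "\<And>k::nat. q k \<in> Q" "\<And>k. x \<lless> q k" "q \<longlonglongrightarrow> x"
proof -
  have "\<exists>y\<in>Q. x \<lless> y \<and> dist y x < 1 / real (Suc k)" for k
  proof -
    define e where "e = 1 / real (Suc k) / (2 * real CARD('n))"
    have "e > 0" by (simp add: e_def)
    have half: "x / 2 < x" if "0 < x" for x :: real using that by simp
    have pk: "0 < 1 / real (Suc k)" by simp
    define V where "V = (\<Inter>i. {y. x $ i < y $ i}) \<inter> ball x (1 / real (Suc k))"
    have "open V" unfolding V_def
      by (intro open_Int open_INT finite ballI open_Collect_less continuous_intros open_ball)
    have "norm (e *\<^sub>R (1::real^'n)) \<le> real CARD('n) * e" using \<open>e > 0\<close> by (intro norm_le_card_mult) simp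
    also have "real CARD('n) * e = 1 / real (Suc k) / 2" by (simp add: e_def)
    also have "1 / real (Suc k) / 2 < 1 / real (Suc k)" by (rule half) (rule pk)
    finally have "x + e *\<^sub>R 1 \<in> V" using \<open>e > 0\<close> by (simp add: V_def dist_norm)
    then have "V \<inter> Q \<noteq> {}" using assms \<open>open V\<close> open_Int_closure_eq_empty[of V Q] by auto
    then obtain y where "y \<in> V" "y \<in> Q" by blast
    then show ?thesis by (intro bexI[of _ y]) (auto simp: V_def strictly_below_def dist_commute)
  qed
  then have "\<forall>k. \<exists>y. y \<in> Q \<and> x \<lless> y \<and> dist y x < 1 / real (Suc k)" by blast
  from choice[OF this] obtain q where q: "\<And>k. q k \<in> Q \<and> x \<lless> q k \<and> dist (q k) x < 1 / real (Suc k)" by blast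
  have "q \<longlonglongrightarrow> x"
  proof (rule metric_LIMSEQ_I)
    fix r :: real assume "r > 0"
    obtain m where m: "1 / real (Suc m) < r" using nat_approx_posE[OF \<open>r > 0\<close>] by blast
    show "\<exists>no. \<forall>n\<ge>no. dist (q n) x < r"
    proof (intro exI[of _ m] allI impI)
      fix n assume "m \<le> n"
      then have "1 / real (Suc n) \<le> 1 / real (Suc m)" by (simp add: frac_le)
      then show "dist (q n) x < r" using q[of n] m by linarith
    qed
  qed
  then show thesis using that q by blast
qed

text \<open>
  A velocity field with the properties required for almost every time or point, but now at all of them.
\<close>

locale regular_velocity =
  fixes \<beta> :: "real \<Rightarrow> real^'n::finite \<Rightarrow> real^'n" and c\<^sub>0 c\<^sub>1 :: "real \<Rightarrow> real"
  assumes \<beta>_measurable: "(\<lambda>p. \<beta> (fst p) (snd p)) \<in> borel_measurable (borel \<Otimes>\<^sub>M borel)"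
    and \<beta>_mono: "x \<le> y \<Longrightarrow> \<beta> t x + c\<^sub>1 t *\<^sub>R x \<le> \<beta> t y + c\<^sub>1 t *\<^sub>R y"
    and \<beta>_right_continuous: "(\<beta> t \<longlongrightarrow> \<beta> t x) (at x within {y. x \<le> y})"
    and \<beta>_growth: "norm (\<beta> t x) \<le> c\<^sub>0 t * (1 + norm x)"
    and c\<^sub>0_integrable: "integrable lborel c\<^sub>0" and c\<^sub>1_integrable: "integrable lborel c\<^sub>1"
    and c\<^sub>0_nonneg: "0 \<le> c\<^sub>0 t" and c\<^sub>1_nonneg: "0 \<le> c\<^sub>1 t"

lemma absolutely_integrable_borel_representative:
  fixes C :: "real \<Rightarrow> real"
  assumes "C absolutely_integrable_on A" and A[measurable]: "A \<in> sets borel"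
  obtains c' where "c' \<in> borel_measurable borel" "integrable lborel (\<lambda>t. indicator A t * c' t)"
    "AE t in lborel. t \<in> A \<longrightarrow> C t = c' t"
proof -
  have int: "integrable lebesgue (\<lambda>t. indicator A t *\<^sub>R C t)"
    using assms(1) by (simp add: set_integrable_def)
  then have "(\<lambda>t. indicator A t *\<^sub>R C t) \<in> borel_measurable lebesgue" by auto
  from completion_ex_borel_measurable_real[OF this] obtain c' where
    c'[measurable]: "c' \<in> borel_measurable lborel" and eq: "AE t in lborel. indicator A t *\<^sub>R C t = c' t" by blast
  have eq': "AE t in lborel. t \<in> A \<longrightarrow> C t = c' t" using eq by (rule eventually_mono) (auto simp: indicator_def)
  have "integrable lebesgue (\<lambda>t. indicator A t * c' t)"
    by (rule integrable_cong_AE_imp[OF int])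
      (use eq in \<open>auto intro!: measurable_completion AE_completion elim!: eventually_mono simp: indicator_def\<close>)
  then have "integrable lborel (\<lambda>t. indicator A t * c' t)"
    by (subst (asm) integrable_completion) auto
  moreover have "c' \<in> borel_measurable borel" by measurable
  ultimately show thesis using eq' by (intro that)
qed

text \<open>
  A Lebesgue measurable field agrees almost everywhere with a Borel function \<open>g\<close>, but not at the points
  that matter. By Fubini's theorem there is a countable dense set \<open>Q\<close> of space points at which both agree
  for almost every time. An increasing right-continuous map is the infimum of its values at the points of \<open>Q\<close> that are
  larger in every coordinate, and this recovers the field at all points by countably many Borel
  operations.
\<close>

lemma velocity_field_regular_version:
  fixes b :: "real \<Rightarrow> real^'n::finite \<Rightarrow> real^'n"
  assumes vf: "velocity_field T b C\<^sub>0 C\<^sub>1"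
  obtains \<beta> c\<^sub>0 c\<^sub>1 N where "regular_velocity \<beta> c\<^sub>0 c\<^sub>1" "N \<in> null_sets lborel"
    "\<And>t y. t \<in> {0..T} - N \<Longrightarrow> b t y = \<beta> t y" "\<And>t. t \<in> {0..T} - N \<Longrightarrow> C\<^sub>0 t = c\<^sub>0 t" "\<And>t. t \<in> {0..T} - N \<Longrightarrow> C\<^sub>1 t = c\<^sub>1 t"
proof -
  define S where "S = {0..T} \<times> (UNIV :: (real^'n) set)"
  have Sb: "S \<in> sets borel" unfolding S_def by (intro borel_closed closed_Times) auto
  then have S: "S \<in> sets lebesgue" by auto
  have fm: "(\<lambda>p. if p \<in> S then (case p of (t, y) \<Rightarrow> b t y) else 0) \<in> borel_measurable lebesgue"
    by (rule borel_measurable_if_I[OF _ S]) (use vf in \<open>simp add: velocity_field_def S_def\<close>)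
  have "\<forall>i. \<exists>g. g \<in> borel_measurable lborel \<and> (AE p in lborel. (if p \<in> S then (case p of (t, y) \<Rightarrow> b t y) else 0) $ i = g p)"
    using completion_ex_borel_measurable_real[OF borel_measurable_vec_nth_comp[OF fm]] by blast
  from choice[OF this] obtain g where g[measurable]: "\<And>i. g i \<in> borel_measurable borel"
    and geq: "\<And>i. AE p in lborel. (if p \<in> S then (case p of (t, y) \<Rightarrow> b t y) else 0) $ i = g i p"
    by auto
  obtain c0 where c0[measurable]: "c0 \<in> borel_measurable borel" "integrable lborel (\<lambda>t. indicator {0..T} t * c0 t)"
    "AE t in lborel. t \<in> {0..T} \<longrightarrow> C\<^sub>0 t = c0 t"
    by (rule absolutely_integrable_borel_representative[where C = C\<^sub>0 and A = "{0..T}"]) (use vf in \<open>auto simp: velocity_field_def\<close>)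
  obtain c1 where c1[measurable]: "c1 \<in> borel_measurable borel" "integrable lborel (\<lambda>t. indicator {0..T} t * c1 t)"
    "AE t in lborel. t \<in> {0..T} \<longrightarrow> C\<^sub>1 t = c1 t"
    by (rule absolutely_integrable_borel_representative[where C = C\<^sub>1 and A = "{0..T}"]) (use vf in \<open>auto simp: velocity_field_def\<close>)
  define Good where "Good p \<longleftrightarrow> (p \<in> S \<longrightarrow> (\<forall>i. b (fst p) (snd p) $ i = g i p) \<and> norm (b (fst p) (snd p)) \<le> C\<^sub>0 (fst p) * (1 + norm (snd p)))" for p
  have "AE p in lborel. p \<in> S \<longrightarrow> (case p of (t, y) \<Rightarrow> norm (b t y) \<le> C\<^sub>0 t * (1 + norm y))"
  proof -
    have "AE p in lebesgue_on S. (case p of (t, y) \<Rightarrow> norm (b t y) \<le> C\<^sub>0 t * (1 + norm y))"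
      using vf unfolding velocity_field_def S_def by (elim conjE)
    then have "AE p in lebesgue. p \<in> S \<longrightarrow> (case p of (t, y) \<Rightarrow> norm (b t y) \<le> C\<^sub>0 t * (1 + norm y))"
      by (subst (asm) AE_restrict_space_iff) (use S in auto)
    then show ?thesis by (simp add: AE_completion_iff)
  qed
  moreover have "AE p in lborel. \<forall>i. (if p \<in> S then (case p of (t, y) \<Rightarrow> b t y) else 0) $ i = g i p"
    using geq by (subst AE_all_countable) auto
  ultimately have "AE p in lborel. Good p"
    by eventually_elim (auto simp: Good_def split: prod.splits)
  then obtain M where M: "\<And>p. p \<notin> M \<Longrightarrow> Good p" "M \<in> null_sets (lborel :: (real \<times> (real^'n)) measure)"
    by (elim AE_E3) auto
  have Msets: "M \<in> sets (lborel \<Otimes>\<^sub>M lborel)" using M(2) unfolding lborel_prod by auto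
  have "AE p in lborel \<Otimes>\<^sub>M lborel. p \<notin> M" unfolding lborel_prod by (rule AE_not_in[OF M(2)])
  then have "AE t in lborel. AE y in lborel. (t, y) \<notin> M" by (rule lborel_pair.AE_pair)
  moreover have "{p \<in> space (lborel \<Otimes>\<^sub>M lborel). (fst p, snd p) \<notin> M} \<in> sets (lborel \<Otimes>\<^sub>M lborel)"
  proof -
    have "{p \<in> space (lborel \<Otimes>\<^sub>M lborel). (fst p, snd p) \<notin> M} = space (lborel \<Otimes>\<^sub>M lborel) - M" by auto
    then show ?thesis by (simp only: sets.compl_sets[OF Msets])
  qed
  ultimately have aeY: "AE y in lborel. AE t in lborel. (t, y) \<notin> M"
    using lborel_pair.AE_commute[of "\<lambda>t y. (t, y) \<notin> M"] by blast
  define Y where "Y = {y. AE t in lborel. (t, y) \<notin> M}"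
  have "closure Y = UNIV"
  proof -
    have "V \<inter> Y \<noteq> {}" if V: "open V" "V \<noteq> {}" for V
    proof
      assume "V \<inter> Y = {}"
      then have "AE y in lborel. y \<notin> V" using aeY by (auto simp: Y_def elim!: eventually_mono)
      then have "V \<in> null_sets lborel" using V by (subst (asm) AE_iff_null_sets[symmetric]) auto
      then have "negligible V" by (simp add: negligible_iff_null_sets null_sets_completionI)
      then show False using open_not_negligible V by blast
    qed
    from this[of "- closure Y"] show ?thesis using closure_subset[of Y] by blast
  qed
  obtain Q where Q: "countable Q" "Q \<subseteq> Y" "Y \<subseteq> closure Q" by (rule separable)
  have Qd: "closure Q = UNIV" using \<open>closure Y = UNIV\<close> Q(3) closure_minimal[OF Q(3) closed_closure] by auto
  have aeQ: "AE t in lborel. \<forall>q\<in>Q. (t, q) \<notin> M"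
    by (rule AE_ball_countable'[OF _ Q(1)]) (use Q(2) in \<open>auto simp: Y_def\<close>)
  define good where "good t \<longleftrightarrow> (t \<in> {0..T} \<longrightarrow> (\<forall>q\<in>Q. (t, q) \<notin> M) \<and> C\<^sub>0 t = c0 t \<and> C\<^sub>1 t = c1 t \<and> 0 \<le> C\<^sub>0 t \<and> 0 \<le> C\<^sub>1 t \<and>
      increasing_cadlag (\<lambda>x. b t x + C\<^sub>1 t *\<^sub>R x))" for t
  have "AE t in lborel. t \<in> {0..T} \<longrightarrow> 0 \<le> C\<^sub>0 t" "AE t in lborel. t \<in> {0..T} \<longrightarrow> 0 \<le> C\<^sub>1 t"
    "AE t in lborel. t \<in> {0..T} \<longrightarrow> increasing_cadlag (\<lambda>x. b t x + C\<^sub>1 t *\<^sub>R x)"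
    using vf unfolding velocity_field_def by (auto simp: AE_completion_iff)
  with aeQ c0(3) c1(3) have "AE t in lborel. good t"
    by eventually_elim (auto simp: good_def)
  then obtain N where N: "\<And>t. t \<notin> N \<Longrightarrow> good t" "N \<in> null_sets (lborel :: real measure)"
    by (elim AE_E3) auto
  have [measurable]: "N \<in> sets borel" using N(2) by auto
  define D where "D = {0..T} - N"
  have Dm[measurable]: "D \<in> sets borel" unfolding D_def by measurable
  have D: "C\<^sub>0 t = c0 t" "C\<^sub>1 t = c1 t" "0 \<le> C\<^sub>0 t" "0 \<le> C\<^sub>1 t" "increasing_cadlag (\<lambda>x. b t x + C\<^sub>1 t *\<^sub>R x)"
    "\<And>q i. q \<in> Q \<Longrightarrow> b t q $ i = g i (t, q)" "\<And>q. q \<in> Q \<Longrightarrow> norm (b t q) \<le> C\<^sub>0 t * (1 + norm q)"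
    if "t \<in> D" for t
    using N(1)[of t] M(1)[of "(t, _)"] that unfolding good_def D_def Good_def S_def by auto
  \<comment> \<open>The infimum takes the value \<open>\<infinity>\<close> for points of \<open>Q\<close> that are not above.\<close>
  define \<psi> where "\<psi> i p = (INF q\<in>Q. if \<forall>j. snd p $ j < q $ j then ereal (g i (fst p, q) + c1 (fst p) * q $ i) else \<infinity>)" for i and p :: "real \<times> (real^'n)"
  have \<psi>m[measurable]: "\<psi> i \<in> borel_measurable (borel \<Otimes>\<^sub>M borel)" for i
    unfolding \<psi>_def using Q(1) by measurable
  \<comment> \<open>At bad times, and outside the time interval, the field is zero.\<close>
  define \<beta> where "\<beta> t y = (if t \<in> D then (\<chi> i. real_of_ereal (\<psi> i (t, y)) - c1 t * y $ i) else 0)" for t y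
  have tend: "((\<lambda>y. b t y) \<longlongrightarrow> b t x) (at x within {y. x \<le> y})" if t: "t \<in> D" for t x
  proof -
    have "((\<lambda>y. (b t y + C\<^sub>1 t *\<^sub>R y) - C\<^sub>1 t *\<^sub>R y) \<longlongrightarrow> (b t x + C\<^sub>1 t *\<^sub>R x) - C\<^sub>1 t *\<^sub>R x) (at x within {y. x \<le> y})"
      by (intro tendsto_intros increasing_cadlag_right_continuous[OF D(5)[OF t]])
    then show ?thesis by simp
  qed
  have seq: "\<exists>q. (\<forall>k. q k \<in> Q \<and> x \<lless> q k) \<and> q \<longlonglongrightarrow> x \<and> (\<lambda>k. b t (q k)) \<longlonglongrightarrow> b t x" if t: "t \<in> D" for t x
  proof -
    obtain q where q: "\<And>k::nat. q k \<in> Q" "\<And>k. x \<lless> q k" "q \<longlonglongrightarrow> x" by (rule dense_right_sequence[OF Qd, where x = x]) blast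
    have "filterlim q (at x within {y. x \<le> y}) sequentially"
      unfolding filterlim_at
    proof (intro conjI always_eventually allI q(3))
      fix k
      show "q k \<in> {y. x \<le> y}" using q(2)[of k] by (auto simp: strictly_below_def less_eq_vec_def intro: less_imp_le)
      show "q k \<noteq> x" using q(2)[of k] by (auto simp: strictly_below_def)
    qed
    from filterlim_compose[OF tend[OF t] this] q show ?thesis by blast
  qed
  have \<psi>_eq: "\<psi> i (t, x) = ereal (b t x $ i + C\<^sub>1 t * x $ i)" if t: "t \<in> D" for t x i
  proof (rule antisym)
    show "ereal (b t x $ i + C\<^sub>1 t * x $ i) \<le> \<psi> i (t, x)"
      unfolding \<psi>_def
    proof (rule INF_greatest)
      fix q assume q: "q \<in> Q"
      show "ereal (b t x $ i + C\<^sub>1 t * x $ i) \<le> (if \<forall>j. snd (t, x) $ j < q $ j then ereal (g i (fst (t, x), q) + c1 (fst (t, x)) * q $ i) else \<infinity>)"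
      proof (cases "\<forall>j. x $ j < q $ j")
        case True
        then have "x \<le> q" by (auto simp: less_eq_vec_def intro: less_imp_le)
        from increasing_cadlag_mono[OF D(5)[OF t] this] show ?thesis
          using True D(2)[OF t] D(6)[OF t q] by (auto simp: less_eq_vec_def)
      qed auto
    qed
    from seq[OF t, of x] obtain q where q: "\<And>k. q k \<in> Q" "\<And>k. x \<lless> q k" "q \<longlonglongrightarrow> x" "(\<lambda>k. b t (q k)) \<longlonglongrightarrow> b t x" by blast
    have "(\<lambda>k. ereal (b t (q k) $ i + C\<^sub>1 t * q k $ i)) \<longlonglongrightarrow> ereal (b t x $ i + C\<^sub>1 t * x $ i)"
      using q by (intro tendsto_intros)
    then show "\<psi> i (t, x) \<le> ereal (b t x $ i + C\<^sub>1 t * x $ i)"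
    proof (rule LIMSEQ_le_const, intro exI[of _ 0] allI impI)
      fix k
      show "\<psi> i (t, x) \<le> ereal (b t (q k) $ i + C\<^sub>1 t * q k $ i)"
        unfolding \<psi>_def using q(2)[of k] D(2)[OF t] D(6)[OF t q(1)[of k]]
        by (intro INF_lower2[OF q(1)[of k]]) (auto simp: strictly_below_def)
    qed
  qed
  have \<beta>_eq: "\<beta> t y = b t y" if "t \<in> D" for t y
    using that by (simp add: \<beta>_def \<psi>_eq D(2) vec_eq_iff)
  have bD: "norm (b t x) \<le> C\<^sub>0 t * (1 + norm x)" if t: "t \<in> D" for t x
  proof -
    from seq[OF t, of x] obtain q where q: "\<And>k. q k \<in> Q" "q \<longlonglongrightarrow> x" "(\<lambda>k. b t (q k)) \<longlonglongrightarrow> b t x" by blast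
    show ?thesis
      by (rule LIMSEQ_le[of "\<lambda>k. norm (b t (q k))" _ "\<lambda>k. C\<^sub>0 t * (1 + norm (q k))"])
        (use q D(7)[OF t] in \<open>auto intro!: tendsto_intros\<close>)
  qed
  show thesis
  proof (rule that[of \<beta> "\<lambda>t. indicator D t * c0 t" "\<lambda>t. indicator D t * c1 t" N])
    show "regular_velocity \<beta> (\<lambda>t. indicator D t * c0 t) (\<lambda>t. indicator D t * c1 t)"
    proof
      have "(\<lambda>p. \<beta> (fst p) (snd p) $ i) \<in> borel_measurable (borel \<Otimes>\<^sub>M borel)" for i
      proof -
        have "(\<lambda>p. if fst p \<in> D then real_of_ereal (\<psi> i p) - c1 (fst p) * snd p $ i else 0) \<in> borel_measurable (borel \<Otimes>\<^sub>M borel)"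
          by measurable
        then show ?thesis by (rule measurable_cong[THEN iffD1, rotated]) (auto simp: \<beta>_def)
      qed
      moreover have "(\<lambda>p. \<beta> (fst p) (snd p)) = (\<lambda>p. \<Sum>i\<in>UNIV. (\<beta> (fst p) (snd p) $ i) *\<^sub>R axis i 1)"
        by (simp add: fun_eq_iff vec_eq_iff axis_def if_distrib cong: if_cong)
      ultimately show "(\<lambda>p. \<beta> (fst p) (snd p)) \<in> borel_measurable (borel \<Otimes>\<^sub>M borel)"
        by (simp only:) (intro borel_measurable_sum borel_measurable_scaleR borel_measurable_const)
      show "\<beta> t x + (indicator D t * c1 t) *\<^sub>R x \<le> \<beta> t y + (indicator D t * c1 t) *\<^sub>R y" if "x \<le> y" for t x y
      proof (cases "t \<in> D")
        case True
        from increasing_cadlag_mono[OF D(5)[OF True] that] show ?thesis using True by (simp add: \<beta>_eq D(2))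
      qed (simp add: \<beta>_def)
      show "(\<beta> t \<longlongrightarrow> \<beta> t x) (at x within {y. x \<le> y})" for t x
      proof (cases "t \<in> D")
        case True
        have "\<beta> t = b t" using \<beta>_eq[OF True] by auto
        then show ?thesis using tend[OF True] by simp
      next
        case False
        then have "\<beta> t = (\<lambda>_. 0)" by (auto simp: \<beta>_def)
        then show ?thesis by simp
      qed
      show "norm (\<beta> t x) \<le> indicator D t * c0 t * (1 + norm x)" for t x
      proof (cases "t \<in> D")
        case True
        then show ?thesis using bD[of t x] D(1)[of t] by (simp add: \<beta>_eq)
      qed (simp add: \<beta>_def)
      have int: "integrable lborel (\<lambda>t. indicator D t * c t)"
        if [measurable]: "c \<in> borel_measurable borel" and "integrable lborel (\<lambda>t. indicator {0..T} t * c t)" for c :: "real \<Rightarrow> real"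
        by (rule Bochner_Integration.integrable_bound[OF that(2)]) (auto simp: D_def indicator_def)
      show "integrable lborel (\<lambda>t. indicator D t * c0 t)" "integrable lborel (\<lambda>t. indicator D t * c1 t)"
        by (rule int[OF c0(1,2)], rule int[OF c1(1,2)])
      show "0 \<le> indicator D t * c0 t" "0 \<le> indicator D t * c1 t" for t
        using D(1-4)[of t] by (cases "t \<in> D"; simp)+
    qed
    show "N \<in> null_sets lborel" by (rule N(2))
    show "b t y = \<beta> t y" if "t \<in> {0..T} - N" for t y using \<beta>_eq[of t y] that by (simp add: D_def)
    show "C\<^sub>0 t = indicator D t * c0 t" "C\<^sub>1 t = indicator D t * c1 t" if "t \<in> {0..T} - N" for t
      using D(1,2)[of t] that by (auto simp: D_def)
  qed
qed

section \<open>The integrating factor\<close>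

lemma has_integral_vec_le_AE:
  fixes f g :: "'a::euclidean_space \<Rightarrow> real^'n::finite"
  assumes f: "(f has_integral I) S" and g: "(g has_integral J) S" and N: "negligible N"
    and le: "\<And>x. x \<in> S - N \<Longrightarrow> f x \<le> g x"
  shows "I \<le> J"
proof (rule has_integral_vec_le)
  show "((\<lambda>x. if x \<in> N then 0 else f x) has_integral I) S" by (rule has_integral_spike[OF N _ f]) auto
  show "((\<lambda>x. if x \<in> N then 0 else g x) has_integral J) S" by (rule has_integral_spike[OF N _ g]) auto
qed (use le in auto)

lemma emeasure_lborel_vimage_scaleR:
  fixes A :: "'a::euclidean_space set"
  assumes "a > 0" and A: "A \<in> sets borel"
  shows "emeasure lborel {y. (1 / a) *\<^sub>R y \<in> A} = ennreal (a ^ DIM('a)) * emeasure lborel A"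
proof -
  have "(\<lambda>y::'a. (1 / a) *\<^sub>R y) \<in> borel_measurable borel"
    by (intro borel_measurable_continuous_onI continuous_intros)
  from measurable_sets_borel[OF this A] have m: "{y. (1 / a) *\<^sub>R y \<in> A} \<in> sets borel" by (simp add: vimage_def)
  have "{y. (1 / a) *\<^sub>R y \<in> A} = (\<lambda>x. a *\<^sub>R x + 0) ` A"
  proof (intro set_eqI iffI)
    fix y assume "y \<in> {y. (1 / a) *\<^sub>R y \<in> A}"
    then have "(1 / a) *\<^sub>R y \<in> A" "y = a *\<^sub>R ((1 / a) *\<^sub>R y) + 0" using \<open>a > 0\<close> by auto
    then show "y \<in> (\<lambda>x. a *\<^sub>R x + 0) ` A" by blast
  qed (use \<open>a > 0\<close> in auto)
  then have "emeasure lebesgue {y. (1 / a) *\<^sub>R y \<in> A} = \<bar>a\<bar> ^ DIM('a) * emeasure lebesgue A"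
    using emeasure_lebesgue_affine[of a 0 A] by (simp add: add.commute)
  then show ?thesis using m A \<open>a > 0\<close> by simp
qed

text \<open>
  The field of the equation for \<open>exp (\<integral>\<^sub>s\<^sup>t c) \<gamma>(t)\<close> when \<open>\<gamma>\<close> follows \<open>\<beta>\<close>.
\<close>

definition rescaled_field :: "(real \<Rightarrow> real^'n::finite \<Rightarrow> real^'n) \<Rightarrow> (real \<Rightarrow> real) \<Rightarrow> real \<Rightarrow> real \<Rightarrow> real^'n \<Rightarrow> real^'n" where
  "rescaled_field \<beta> c s t y = exp (integral {s..t} c) *\<^sub>R
     (\<beta> t (exp (- integral {s..t} c) *\<^sub>R y) + c t *\<^sub>R (exp (- integral {s..t} c) *\<^sub>R y))"

lemma exp_neg_scaleR_exp: "exp (- a) *\<^sub>R exp a *\<^sub>R x = x" "exp a *\<^sub>R exp (- a) *\<^sub>R x = (x :: 'a::real_vector)"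
  by (simp_all flip: exp_add)

context regular_velocity
begin

lemma \<beta>_measurable_comp [measurable (raw)]:
  assumes [measurable]: "f \<in> borel_measurable M" "g \<in> borel_measurable M"
  shows "(\<lambda>x. \<beta> (f x) (g x)) \<in> borel_measurable M"
  using measurable_compose[OF measurable_Pair[OF assms] \<beta>_measurable] by simp

lemma c_measurable [measurable]: "c\<^sub>0 \<in> borel_measurable borel" "c\<^sub>1 \<in> borel_measurable borel"
  using c\<^sub>0_integrable c\<^sub>1_integrable by simp_all

lemma c_set_integrable:
  assumes "A \<in> sets borel"
  shows "set_integrable lborel A c\<^sub>0" "set_integrable lborel A c\<^sub>1"
  using set_integrable_subset[of lborel UNIV c\<^sub>0 A] set_integrable_subset[of lborel UNIV c\<^sub>1 A]
    c\<^sub>0_integrable c\<^sub>1_integrable assms by (simp_all add: set_integrable_def)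

lemma c_absolutely_integrable: "c\<^sub>0 absolutely_integrable_on {s..t}" "c\<^sub>1 absolutely_integrable_on {s..t}"
  by (intro set_integrable_lborel_imp_absolutely_integrable c_set_integrable; simp)+

lemma c_integrable_on: "c\<^sub>0 integrable_on {s..t}" "c\<^sub>1 integrable_on {s..t}"
  using c_absolutely_integrable absolutely_integrable_on_def by blast+

lemma integral_c_nonneg: "0 \<le> integral {s..t} c\<^sub>0" "0 \<le> integral {s..t} c\<^sub>1"
  by (intro integral_nonneg c_integrable_on c\<^sub>0_nonneg c\<^sub>1_nonneg)+

lemma integral_c1_eq: "integral {s..t} c\<^sub>1 = (LINT r:{s..t}|lborel. c\<^sub>1 r)"
  by (rule set_borel_integral_eq_integral(2)[OF c_set_integrable(2), symmetric]) simp

lemma integral_c1_le: "integral {s..t} c\<^sub>1 \<le> (LINT r|lborel. c\<^sub>1 r)"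
  unfolding integral_c1_eq set_lebesgue_integral_def
  by (rule integral_mono)
    (use c_set_integrable(2)[of "{s..t}"] c\<^sub>1_integrable c\<^sub>1_nonneg in \<open>auto simp: set_integrable_def indicator_def\<close>)

definition rescaled_growth :: "real \<Rightarrow> real" where
  "rescaled_growth t = exp (LINT r|lborel. c\<^sub>1 r) * (c\<^sub>0 t + c\<^sub>1 t)"

lemma increasing_field_rescaled: "increasing_field (rescaled_field \<beta> c\<^sub>1 s) rescaled_growth"
proof
  have [measurable]: "(\<lambda>t. integral {s..t} c\<^sub>1) \<in> borel_measurable borel"
    unfolding integral_c1_eq by measurable
  have [measurable (raw)]: "(\<lambda>x. integral {s..f x} c\<^sub>1) \<in> borel_measurable M" if [measurable]: "f \<in> borel_measurable M"
    for M and f :: "'c \<Rightarrow> real" by measurable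
  show "(\<lambda>p. rescaled_field \<beta> c\<^sub>1 s (fst p) (snd p)) \<in> borel_measurable (borel \<Otimes>\<^sub>M borel)"
    unfolding rescaled_field_def by measurable
next
  fix x y :: "real^'n" and t assume "x \<le> y"
  then have "exp (- integral {s..t} c\<^sub>1) *\<^sub>R x \<le> exp (- integral {s..t} c\<^sub>1) *\<^sub>R y"
    by (auto simp: less_eq_vec_def)
  from \<beta>_mono[OF this, of t] show "rescaled_field \<beta> c\<^sub>1 s t x \<le> rescaled_field \<beta> c\<^sub>1 s t y"
    by (auto simp: rescaled_field_def less_eq_vec_def)
next
  fix t and x :: "real^'n"
  define a where "a = exp (- integral {s..t} c\<^sub>1)"
  define z where "z k = a *\<^sub>R (x + (1 / real (Suc k)) *\<^sub>R 1)" for k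
  have "a > 0" by (simp add: a_def)
  have "(\<lambda>k. a *\<^sub>R (x + inverse (real (Suc k)) *\<^sub>R 1)) \<longlonglongrightarrow> a *\<^sub>R (x + 0 *\<^sub>R 1)"
    by (intro tendsto_intros LIMSEQ_inverse_real_of_nat)
  then have zlim: "z \<longlonglongrightarrow> a *\<^sub>R x" by (simp add: z_def[abs_def] divide_inverse)
  have "filterlim z (at (a *\<^sub>R x) within {y. a *\<^sub>R x \<le> y}) sequentially"
    unfolding filterlim_at
  proof (intro conjI always_eventually allI zlim)
    fix k
    show "z k \<in> {y. a *\<^sub>R x \<le> y}" using \<open>a > 0\<close> by (simp add: z_def less_eq_vec_def)
    show "z k \<noteq> a *\<^sub>R x" using \<open>a > 0\<close> by (auto simp: z_def vec_eq_iff)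
  qed
  from filterlim_compose[OF \<beta>_right_continuous this, of t]
  have "(\<lambda>k. \<beta> t (z k)) \<longlonglongrightarrow> \<beta> t (a *\<^sub>R x)" .
  then have "(\<lambda>k. exp (integral {s..t} c\<^sub>1) *\<^sub>R (\<beta> t (z k) + c\<^sub>1 t *\<^sub>R z k))
      \<longlonglongrightarrow> exp (integral {s..t} c\<^sub>1) *\<^sub>R (\<beta> t (a *\<^sub>R x) + c\<^sub>1 t *\<^sub>R (a *\<^sub>R x))"
    by (intro tendsto_intros zlim)
  then show "(\<lambda>k. rescaled_field \<beta> c\<^sub>1 s t (x + (1 / real (Suc k)) *\<^sub>R 1)) \<longlonglongrightarrow> rescaled_field \<beta> c\<^sub>1 s t x"
    by (simp add: rescaled_field_def z_def[abs_def] a_def)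
next
  fix t and x :: "real^'n"
  define w where "w = integral {s..t} c\<^sub>1"
  define m where "m = (LINT r|lborel. c\<^sub>1 r)"
  have w: "0 \<le> w" "w \<le> m" using integral_c_nonneg integral_c1_le by (auto simp: w_def m_def)
  have "norm (rescaled_field \<beta> c\<^sub>1 s t x) = exp w * norm (\<beta> t (exp (- w) *\<^sub>R x) + c\<^sub>1 t *\<^sub>R (exp (- w) *\<^sub>R x))"
    by (simp add: rescaled_field_def w_def)
  also have "\<dots> \<le> exp m * (c\<^sub>0 t * (1 + norm x) + c\<^sub>1 t * (1 + norm x))"
  proof (rule mult_mono)
    have le: "exp (- w) * norm x \<le> norm x" using w by (intro mult_left_le_one_le) auto
    have "norm (\<beta> t (exp (- w) *\<^sub>R x)) \<le> c\<^sub>0 t * (1 + exp (- w) * norm x)" using \<beta>_growth[of t "exp (- w) *\<^sub>R x"] by simp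
    also have "\<dots> \<le> c\<^sub>0 t * (1 + norm x)" using le c\<^sub>0_nonneg by (intro mult_left_mono) auto
    finally have 1: "norm (\<beta> t (exp (- w) *\<^sub>R x)) \<le> c\<^sub>0 t * (1 + norm x)" .
    have "norm (c\<^sub>1 t *\<^sub>R (exp (- w) *\<^sub>R x)) = c\<^sub>1 t * (exp (- w) * norm x)" using c\<^sub>1_nonneg[of t] by simp
    also have "\<dots> \<le> c\<^sub>1 t * (1 + norm x)" using le c\<^sub>1_nonneg[of t] by (intro mult_left_mono) auto
    finally have 2: "norm (c\<^sub>1 t *\<^sub>R (exp (- w) *\<^sub>R x)) \<le> c\<^sub>1 t * (1 + norm x)" .
    show "norm (\<beta> t (exp (- w) *\<^sub>R x) + c\<^sub>1 t *\<^sub>R (exp (- w) *\<^sub>R x)) \<le> c\<^sub>0 t * (1 + norm x) + c\<^sub>1 t * (1 + norm x)"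
      by (rule order_trans[OF norm_triangle_ineq add_mono[OF 1 2]])
  qed (use w in auto)
  also have "\<dots> = rescaled_growth t * (1 + norm x)" by (simp add: rescaled_growth_def m_def algebra_simps)
  finally show "norm (rescaled_field \<beta> c\<^sub>1 s t x) \<le> rescaled_growth t * (1 + norm x)" .
next
  show "integrable lborel rescaled_growth"
    unfolding rescaled_growth_def[abs_def] using c\<^sub>0_integrable c\<^sub>1_integrable by auto
qed

lemma rescaled_flow_exists: "\<exists>\<Phi>. increasing_flow (rescaled_field \<beta> c\<^sub>1 s) rescaled_growth s \<Phi>"
proof -
  interpret increasing_field "rescaled_field \<beta> c\<^sub>1 s" rescaled_growth by (rule increasing_field_rescaled)
  obtain \<Phi> where "(\<lambda>p. \<Phi> (fst p) (snd p)) \<in> borel_measurable (borel \<Otimes>\<^sub>M borel)"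
    "\<And>t x. continuous_on {s..t} (\<lambda>r. \<Phi> r x)"
    "\<And>t x. s \<le> t \<Longrightarrow> ((\<lambda>r. rescaled_field \<beta> c\<^sub>1 s r (\<Phi> r x)) has_integral (\<Phi> t x - x)) {s..t}"
    by (rule exact_solutions_exist[of s]) blast
  then have "increasing_flow (rescaled_field \<beta> c\<^sub>1 s) rescaled_growth s \<Phi>" by unfold_locales auto
  then show ?thesis by blast
qed

end

section \<open>The flow of the velocity field\<close>

locale regular_flow = regular_velocity \<beta> c\<^sub>0 c\<^sub>1 +
  rescaled: increasing_flow "rescaled_field \<beta> c\<^sub>1 s" "regular_velocity.rescaled_growth c\<^sub>0 c\<^sub>1" s \<Phi>
  for \<beta> :: "real \<Rightarrow> real^'n::finite \<Rightarrow> real^'n" and c\<^sub>0 c\<^sub>1 s \<Phi>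
begin

definition weight :: "real \<Rightarrow> real" where "weight t = integral {s..t} c\<^sub>1"

definition X :: "real \<Rightarrow> real^'n \<Rightarrow> real^'n" where "X t x = exp (- weight t) *\<^sub>R \<Phi> t x"

lemma weight_start [simp]: "weight s = 0"
  by (simp add: weight_def)

lemma X_start [simp]: "X s x = x"
  by (simp add: X_def)

lemma weight_absolutely_continuous: "absolutely_continuous_on {s..t} weight"
  unfolding weight_def[abs_def] by (rule absolutely_continuous_on_integral[OF c_absolutely_integrable(2)])

lemma weight_measurable [measurable]: "weight \<in> borel_measurable borel"
  unfolding weight_def[abs_def] integral_c1_eq by measurable

lemma X_measurable: "(\<lambda>p. X (fst p) (snd p)) \<in> borel_measurable (borel \<Otimes>\<^sub>M borel)"
  unfolding X_def by measurable

lemma X_measurable_comp [measurable (raw)]: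
  assumes [measurable]: "f \<in> borel_measurable M" "g \<in> borel_measurable M"
  shows "(\<lambda>x. X (f x) (g x)) \<in> borel_measurable M"
  using measurable_compose[OF measurable_Pair[OF assms] X_measurable] by simp

lemma X_solves:
  shows "absolutely_continuous_on {s..T} (\<lambda>t. X t x)"
    and "\<exists>N. negligible N \<and> (\<forall>t\<in>{s..T} - N. ((\<lambda>t. X t x) has_vector_derivative \<beta> t (X t x)) (at t within {s..T}))"
proof -
  have si: "set_integrable lborel {s..T} (\<lambda>r. rescaled_field \<beta> c\<^sub>1 s r (\<Phi> r x))"
    by (rule rescaled.B_integrable_continuous[OF rescaled.\<Phi>_continuous])
  have ai: "(\<lambda>r. rescaled_field \<beta> c\<^sub>1 s r (\<Phi> r x)) absolutely_integrable_on {s..T}"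
    by (rule set_integrable_lborel_imp_absolutely_integrable[OF si])
  have int: "(\<lambda>r. rescaled_field \<beta> c\<^sub>1 s r (\<Phi> r x)) integrable_on {s..T}"
    by (rule set_borel_integral_eq_integral(1)[OF si])
  have \<Phi>_eq: "\<Phi> t x = x + integral {s..t} (\<lambda>r. rescaled_field \<beta> c\<^sub>1 s r (\<Phi> r x))" if "t \<in> {s..T}" for t
    using integral_unique[OF rescaled.\<Phi>_solves[of t x]] that by simp
  have acI: "absolutely_continuous_on {s..T} (\<lambda>t. integral {s..t} (\<lambda>r. rescaled_field \<beta> c\<^sub>1 s r (\<Phi> r x)))"
    by (rule absolutely_continuous_on_integral[OF ai])
  have ac: "absolutely_continuous_on {s..T} (\<lambda>t. \<Phi> t x)"
    by (rule absolutely_continuous_on_dominated[OF acI acI, where K = 1]) (simp add: \<Phi>_eq)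
  show "absolutely_continuous_on {s..T} (\<lambda>t. X t x)"
    using absolutely_continuous_on_exp_scaleR[OF weight_absolutely_continuous ac, of "-1"] by (simp add: X_def)
  obtain N1 where N1: "negligible N1" "\<And>t. t \<in> {s..T} - N1 \<Longrightarrow>
      ((\<lambda>u. integral {s..u} (\<lambda>r. rescaled_field \<beta> c\<^sub>1 s r (\<Phi> r x))) has_vector_derivative rescaled_field \<beta> c\<^sub>1 s t (\<Phi> t x)) (at t within {s..T})"
    by (rule Lebesgue_differentiation_indefinite_integral[OF int]) blast
  obtain N2 where N2: "negligible N2" "\<And>t. t \<in> {s..T} - N2 \<Longrightarrow>
      (weight has_vector_derivative c\<^sub>1 t) (at t within {s..T})"
    unfolding weight_def[abs_def] by (rule Lebesgue_differentiation_indefinite_integral[OF c_integrable_on(2)]) blast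
  show "\<exists>N. negligible N \<and> (\<forall>t\<in>{s..T} - N. ((\<lambda>t. X t x) has_vector_derivative \<beta> t (X t x)) (at t within {s..T}))"
  proof (intro exI[of _ "N1 \<union> N2"] conjI ballI)
    show "negligible (N1 \<union> N2)" using N1 N2 by (intro negligible_Un)
    fix t assume t: "t \<in> {s..T} - (N1 \<union> N2)"
    have "((\<lambda>u. x + integral {s..u} (\<lambda>r. rescaled_field \<beta> c\<^sub>1 s r (\<Phi> r x))) has_vector_derivative 0 + rescaled_field \<beta> c\<^sub>1 s t (\<Phi> t x)) (at t within {s..T})"
      by (intro has_vector_derivative_add has_vector_derivative_const N1(2)) (use t in auto)
    then have "((\<lambda>u. x + integral {s..u} (\<lambda>r. rescaled_field \<beta> c\<^sub>1 s r (\<Phi> r x))) has_vector_derivative rescaled_field \<beta> c\<^sub>1 s t (\<Phi> t x)) (at t within {s..T})"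
      by simp
    then have "((\<lambda>u. \<Phi> u x) has_vector_derivative rescaled_field \<beta> c\<^sub>1 s t (\<Phi> t x)) (at t within {s..T})"
      by (rule has_vector_derivative_transform[rotated 2]) (use t \<Phi>_eq in auto)
    from has_vector_derivative_exp_scaleR[OF N2(2) this, of "-1"] t
    have "((\<lambda>t. X t x) has_vector_derivative
      exp (- weight t) *\<^sub>R rescaled_field \<beta> c\<^sub>1 s t (\<Phi> t x) - (c\<^sub>1 t * exp (- weight t)) *\<^sub>R \<Phi> t x) (at t within {s..T})"
      by (simp add: X_def)
    moreover have "exp (- weight t) *\<^sub>R rescaled_field \<beta> c\<^sub>1 s t (\<Phi> t x) - (c\<^sub>1 t * exp (- weight t)) *\<^sub>R \<Phi> t x = \<beta> t (X t x)"
      unfolding rescaled_field_def weight_def[symmetric] exp_neg_scaleR_exp by (simp add: X_def)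
    ultimately show "((\<lambda>t. X t x) has_vector_derivative \<beta> t (X t x)) (at t within {s..T})" by simp
  qed
qed

lemma X_continuous: "continuous_on {s..T} (\<lambda>t. X t x)"
  by (rule absolutely_continuous_on_imp_continuous_on[OF X_solves(1)])

lemma X_has_integral:
  assumes "s \<le> t"
  shows "((\<lambda>r. \<beta> r (X r x)) has_integral (X t x - x)) {s..t}"
proof -
  obtain N where "negligible N" "\<forall>r\<in>{s..t} - N. ((\<lambda>t. X t x) has_vector_derivative \<beta> r (X r x)) (at r within {s..t})"
    using X_solves(2) by blast
  with fundamental_theorem_of_calculus_absolutely_continuous[OF assms X_solves(1)] show ?thesis by fastforce
qed

lemma X_norm_bound:
  assumes st: "s \<le> t"
  shows "1 + norm (X t x) \<le> (1 + norm x) * exp (integral {s..t} c\<^sub>0)"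
proof (rule Gronwall_integrable[where g = "\<lambda>r. 1 + norm (X r x)", OF c_absolutely_integrable(1)])
  show cont: "continuous_on {s..t} (\<lambda>r. 1 + norm (X r x))" by (intro continuous_intros X_continuous)
  have "(\<lambda>r. (1 + norm (X r x)) * c\<^sub>0 r) absolutely_integrable_on {s..t}"
    by (rule absolutely_integrable_bounded_measurable_product_real[OF _ _ _ c_absolutely_integrable(1)])
      (auto intro!: continuous_imp_measurable_on_sets_lebesgue[OF cont] compact_imp_bounded compact_continuous_image[OF cont])
  then show int: "(\<lambda>r. c\<^sub>0 r * (1 + norm (X r x))) integrable_on {s..t}"
    by (simp add: absolutely_integrable_on_def mult.commute)
  fix v assume v: "v \<in> {s..t}"
  have "X v x = x + integral {s..v} (\<lambda>r. \<beta> r (X r x))"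
    using integral_unique[OF X_has_integral[of v x]] v by simp
  then have "norm (X v x) \<le> norm x + norm (integral {s..v} (\<lambda>r. \<beta> r (X r x)))" by (metis norm_triangle_ineq)
  also have "norm (integral {s..v} (\<lambda>r. \<beta> r (X r x))) \<le> integral {s..v} (\<lambda>r. c\<^sub>0 r * (1 + norm (X r x)))"
    by (rule integral_norm_bound_integral)
      (use v X_has_integral[of v x] integrable_on_subinterval[OF int, of s v] \<beta>_growth in auto)
  finally show "1 + norm (X v x) \<le> 1 + norm x + integral {s..v} (\<lambda>r. c\<^sub>0 r * (1 + norm (X r x)))" by simp
qed (use st c\<^sub>0_nonneg in auto)

lemma emeasure_X_preimage_le:
  assumes t: "s \<le> t" and A: "A \<in> sets borel"
  shows "emeasure lborel (X t -` A) \<le> ennreal (exp (real CARD('n) * weight t)) * emeasure lborel A"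
proof -
  define A' where "A' = {y. (1 / exp (weight t)) *\<^sub>R y \<in> A}"
  have "(\<lambda>y::real^'n. (1 / exp (weight t)) *\<^sub>R y) \<in> borel_measurable borel"
    by (intro borel_measurable_continuous_onI continuous_intros)
  from measurable_sets_borel[OF this A] have A': "A' \<in> sets borel" by (simp add: vimage_def A'_def)
  have "X t -` A = \<Phi> t -` A'" by (auto simp: X_def A'_def exp_minus divide_inverse)
  then have "emeasure lborel (X t -` A) \<le> emeasure lborel A'"
    using rescaled.emeasure_flow_preimage_le[OF t A'] by simp
  also have "\<dots> = ennreal (exp (weight t) ^ CARD('n)) * emeasure lborel A"
    unfolding A'_def by (subst emeasure_lborel_vimage_scaleR[OF _ A]) auto
  finally show ?thesis by (simp add: exp_of_nat_mult)
qed

text \<open>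
  The two inequalities are what membership in the box of envelopes means for a field that is right
  continuous and increasing up to the term with \<open>c\<^sub>1\<close>. After rescaling they compare the velocity of \<open>\<gamma>\<close> with that of exact
  solutions on either side of it.
\<close>

lemma differential_inequality_imp_eq_X:
  assumes ac: "absolutely_continuous_on {s..t} \<gamma>" and x: "\<gamma> s = x" and st: "s \<le> t" and N: "negligible N"
    and der: "\<And>r. r \<in> {s..t} - N \<Longrightarrow> (\<gamma> has_vector_derivative v r) (at r within {s..t})"
    and up: "\<And>r. r \<in> {s..t} - N \<Longrightarrow> v r \<le> \<beta> r (\<gamma> r)"
    and lo: "\<And>r y. r \<in> {s..t} - N \<Longrightarrow> y \<lless> \<gamma> r \<Longrightarrow> \<beta> r y + c\<^sub>1 r *\<^sub>R y \<le> v r + c\<^sub>1 r *\<^sub>R \<gamma> r"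
    and jf: "rescaled.jump_free t x"
  shows "\<gamma> t = X t x"
proof -
  \<comment> \<open>The rescaled curve is compared with the exact solutions of the rescaled field.\<close>
  define \<Gamma> where "\<Gamma> r = exp (weight r) *\<^sub>R \<gamma> r" for r
  obtain N2 where N2: "negligible N2" "\<And>r. r \<in> {s..t} - N2 \<Longrightarrow>
      (weight has_vector_derivative c\<^sub>1 r) (at r within {s..t})"
    unfolding weight_def[abs_def] by (rule Lebesgue_differentiation_indefinite_integral[OF c_integrable_on(2)]) blast
  define M where "M = N \<union> N2"
  have M: "negligible M" unfolding M_def by (intro negligible_Un N N2)
  define V where "V r = exp (weight r) *\<^sub>R (v r + c\<^sub>1 r *\<^sub>R \<gamma> r)" for r
  have \<Gamma>ac: "absolutely_continuous_on {s..t} \<Gamma>"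
    using absolutely_continuous_on_exp_scaleR[OF weight_absolutely_continuous ac, of 1] by (simp add: \<Gamma>_def[abs_def])
  have \<Gamma>der: "(\<Gamma> has_vector_derivative V r) (at r within {s..t})" if "r \<in> {s..t} - M" for r
    using has_vector_derivative_exp_scaleR[OF N2(2) der, of r 1] that
    by (simp add: \<Gamma>_def[abs_def] V_def M_def algebra_simps)
  have \<Gamma>int: "(V has_integral \<Gamma> u - \<Gamma> s) {s..u}" if u: "u \<in> {s..t}" for u
  proof (rule fundamental_theorem_of_calculus_absolutely_continuous[OF _ _ M])
    show "absolutely_continuous_on {s..u} \<Gamma>" by (rule absolutely_continuous_on_subset[OF \<Gamma>ac]) (use u in auto)
    show "(\<Gamma> has_vector_derivative V r) (at r within {s..u})" if "r \<in> {s..u} - M" for r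
      by (rule has_vector_derivative_within_subset[OF \<Gamma>der]) (use that u in auto)
  qed (use u in auto)
  have \<Gamma>s: "\<Gamma> s = x" by (simp add: \<Gamma>_def x)
  have \<Gamma>c: "continuous_on {s..t} \<Gamma>" by (rule absolutely_continuous_on_imp_continuous_on[OF \<Gamma>ac])
  have \<gamma>\<Gamma>: "exp (- weight r) *\<^sub>R \<Gamma> r = \<gamma> r" for r unfolding \<Gamma>_def by (rule exp_neg_scaleR_exp)
  have V_le: "V r \<le> rescaled_field \<beta> c\<^sub>1 s r y" if r: "r \<in> {s..t} - M" and y: "\<Gamma> r \<lless> y" for r y
  proof -
    have "\<gamma> r \<le> exp (- weight r) *\<^sub>R y" unfolding \<gamma>\<Gamma>[symmetric] using y by (auto simp: strictly_below_def less_eq_vec_def intro: less_imp_le)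
    from \<beta>_mono[OF this, of r] up[of r] r
    have "v r + c\<^sub>1 r *\<^sub>R \<gamma> r \<le> \<beta> r (exp (- weight r) *\<^sub>R y) + c\<^sub>1 r *\<^sub>R (exp (- weight r) *\<^sub>R y)"
      by (auto simp: M_def less_eq_vec_def) (smt (verit))
    then show ?thesis by (auto simp: V_def rescaled_field_def weight_def[symmetric] less_eq_vec_def)
  qed
  have V_ge: "rescaled_field \<beta> c\<^sub>1 s r y \<le> V r" if r: "r \<in> {s..t} - M" and y: "y \<lless> \<Gamma> r" for r y
  proof -
    have "exp (- weight r) *\<^sub>R y \<lless> \<gamma> r" unfolding \<gamma>\<Gamma>[symmetric] using y by (auto simp: strictly_below_def)
    from lo[OF _ this] r
    have "\<beta> r (exp (- weight r) *\<^sub>R y) + c\<^sub>1 r *\<^sub>R (exp (- weight r) *\<^sub>R y) \<le> v r + c\<^sub>1 r *\<^sub>R \<gamma> r"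
      by (auto simp: M_def)
    then show ?thesis by (auto simp: V_def rescaled_field_def weight_def[symmetric] less_eq_vec_def)
  qed
  have above: "\<Gamma> t \<le> \<Phi> t (x + d *\<^sub>R 1)" if "d > 0" for d
  proof -
    have "\<Gamma> t - \<Gamma> s \<le> \<Phi> t (x + d *\<^sub>R 1) - (x + d *\<^sub>R 1)"
    proof (rule rescaled.upper_comparison[OF st \<Gamma>c, where \<rho> = 0])
      show "\<Gamma> s $ i + 0 < (x + d *\<^sub>R 1) $ i" for i using that by (simp add: \<Gamma>s)
      show "\<Gamma> u - \<Gamma> s \<le> \<Phi> u (x + d *\<^sub>R 1) - (x + d *\<^sub>R 1)"
        if u: "u \<in> {s..t}" "\<And>r i. r \<in> {s..u} \<Longrightarrow> \<Gamma> r $ i + 0 < \<Phi> r (x + d *\<^sub>R 1) $ i" for u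
        by (rule has_integral_vec_le_AE[OF \<Gamma>int[OF u(1)] rescaled.\<Phi>_solves M])
          (use u in \<open>auto intro!: V_le simp: strictly_below_def\<close>)
    qed
    then show ?thesis using that by (auto simp: \<Gamma>s less_eq_vec_def) (smt (verit))
  qed
  have below: "\<Phi> t (x - d *\<^sub>R 1) \<le> \<Gamma> t" if "d > 0" for d
  proof -
    have "\<Phi> t (x - d *\<^sub>R 1) - (x - d *\<^sub>R 1) \<le> \<Gamma> t - \<Gamma> s"
    proof (rule rescaled.lower_comparison[OF st \<Gamma>c, where \<rho> = 0])
      show "(x - d *\<^sub>R 1) $ i + 0 < \<Gamma> s $ i" for i using that by (simp add: \<Gamma>s)
      show "\<Phi> u (x - d *\<^sub>R 1) - (x - d *\<^sub>R 1) \<le> \<Gamma> u - \<Gamma> s"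
        if u: "u \<in> {s..t}" "\<And>r i. r \<in> {s..u} \<Longrightarrow> \<Phi> r (x - d *\<^sub>R 1) $ i + 0 < \<Gamma> r $ i" for u
        by (rule has_integral_vec_le_AE[OF rescaled.\<Phi>_solves \<Gamma>int[OF u(1)] M])
          (use u in \<open>auto intro!: V_ge simp: strictly_below_def\<close>)
    qed
    then show ?thesis using that by (auto simp: \<Gamma>s less_eq_vec_def) (smt (verit))
  qed
  have mid: "\<Phi> t (x - d *\<^sub>R 1) \<le> \<Phi> t x" "\<Phi> t x \<le> \<Phi> t (x + d *\<^sub>R 1)" if "d > 0" for d
    using that by (auto intro!: rescaled.\<Phi>_strictly_increasing st simp: strictly_below_def)
  have "\<Gamma> t = \<Phi> t x"
    by (rule rescaled.squeezed_eq_flow[OF jf above below mid(2) mid(1)])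
  then show ?thesis using \<gamma>\<Gamma>[of t] by (simp add: X_def)
qed

end

section \<open>Integral solutions and solutions of the inclusion\<close>

lemma velocity_in_envelope_box: "f y \<in> envelope_box f y"
proof -
  have "lsc_envelope f y i \<le> ereal (f y $ i)" for i
    unfolding lsc_envelope_def Liminf_def
    by (rule SUP_least) (auto dest: eventually_nhds_x_imp_x intro!: INF_lower)
  moreover have "ereal (f y $ i) \<le> usc_envelope f y i" for i
    unfolding usc_envelope_def Limsup_def
    by (rule INF_greatest) (auto dest: eventually_nhds_x_imp_x intro!: SUP_upper)
  ultimately show ?thesis by (simp add: envelope_box_def)
qed

lemma AE_lebesgue_negligible:
  assumes "AE t in lebesgue. P t"
  obtains N where "negligible N" "\<And>t. t \<notin> N \<Longrightarrow> P t"
proof -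
  from assms obtain N where "N \<in> null_sets lebesgue" "{t \<in> space lebesgue. \<not> P t} \<subseteq> N"
    unfolding eventually_ae_filter by blast
  then show thesis by (intro that[of N]) (auto simp: negligible_iff_null_sets)
qed

lemma AE_lebesgue_not_in_negligible: "negligible N \<Longrightarrow> AE t in lebesgue. t \<notin> N"
  by (rule AE_not_in) (simp add: negligible_iff_null_sets)

lemma integral_solution_imp_inclusion_solution:
  assumes \<gamma>: "integral_solution b s T x \<gamma>" and sT: "s \<le> T"
  shows "inclusion_solution b s T x \<gamma>"
proof -
  define f where "f r = b r (\<gamma> r)" for r
  have ac: "absolutely_continuous_on {s..T} \<gamma>" and f: "f absolutely_integrable_on {s..T}"
    and eq: "\<And>t. t \<in> {s..T} \<Longrightarrow> \<gamma> t = x + (LINT r:{s..t}|lebesgue. f r)"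
    using \<gamma> unfolding integral_solution_def f_def by auto
  have eq': "\<gamma> t = x + integral {s..t} f" if "t \<in> {s..T}" for t
  proof -
    have "f absolutely_integrable_on {s..t}"
      by (rule absolutely_integrable_on_subinterval[OF f]) (use that in auto)
    from set_lebesgue_integral_eq_integral(2)[OF this] eq[OF that] show ?thesis by simp
  qed
  have fi: "f integrable_on {s..T}" using f absolutely_integrable_on_def by blast
  obtain N where N: "negligible N" "\<And>t. t \<in> {s..T} - N \<Longrightarrow>
      ((\<lambda>u. integral {s..u} f) has_vector_derivative f t) (at t within {s..T})"
    by (rule Lebesgue_differentiation_indefinite_integral[OF fi]) blast
  have der: "(\<gamma> has_vector_derivative f t) (at t within {s..T})" if t: "t \<in> {s..T} - N" for t
  proof -
    have "((\<lambda>u. x + integral {s..u} f) has_vector_derivative 0 + f t) (at t within {s..T})"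
      by (intro has_vector_derivative_add has_vector_derivative_const N(2) t)
    then have "((\<lambda>u. x + integral {s..u} f) has_vector_derivative f t) (at t within {s..T})" by simp
    then show ?thesis by (rule has_vector_derivative_transform[rotated 2]) (use t eq' in auto)
  qed
  show ?thesis unfolding inclusion_solution_def
  proof (intro conjI ac)
    show "\<gamma> s = x" using eq'[of s] sT by simp
    show "AE t\<in>{s..T} in lebesgue. \<exists>v\<in>envelope_box (b t) (\<gamma> t). (\<gamma> has_vector_derivative v) (at t within {s..T})"
      using AE_lebesgue_not_in_negligible[OF N(1)]
    proof (rule eventually_mono, intro impI)
      fix t assume "t \<notin> N" "t \<in> {s..T}"
      then show "\<exists>v\<in>envelope_box (b t) (\<gamma> t). (\<gamma> has_vector_derivative v) (at t within {s..T})"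
        using der[of t] velocity_in_envelope_box[of "b t" "\<gamma> t"] by (auto simp: f_def)
    qed
  qed
qed

context regular_velocity
begin

text \<open>
  Right continuity makes \<open>\<beta> t\<close> upper semicontinuous: near \<open>y\<close> all points are below \<open>y + \<delta>1\<close>, and the
  value there is close to that at \<open>y\<close>.
\<close>

lemma envelope_box_upper:
  assumes v: "v \<in> envelope_box (\<beta> t) y"
  shows "v \<le> \<beta> t y"
  unfolding less_eq_vec_def
proof
  fix i
  show "v $ i \<le> \<beta> t y $ i"
  proof (rule field_le_epsilon)
    fix e :: real assume "e > 0"
    define z where "z k = y + inverse (real (Suc k)) *\<^sub>R 1" for k
    have zl: "z \<longlonglongrightarrow> y + 0 *\<^sub>R 1" unfolding z_def[abs_def] by (intro tendsto_intros LIMSEQ_inverse_real_of_nat)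
    have "filterlim z (at y within {u. y \<le> u}) sequentially"
      unfolding filterlim_at
    proof (intro conjI always_eventually allI)
      show "z \<longlonglongrightarrow> y" using zl by simp
      show "z k \<in> {u. y \<le> u}" for k by (simp add: z_def less_eq_vec_def)
      show "z k \<noteq> y" for k by (auto simp: z_def vec_eq_iff)
    qed
    from filterlim_compose[OF \<beta>_right_continuous this, of t]
    have "(\<lambda>k. \<beta> t (z k)) \<longlonglongrightarrow> \<beta> t y" .
    \<comment> \<open>The term with \<open>c\<^sub>1\<close> is the price for \<open>\<beta> t\<close> being increasing only after adding \<open>c\<^sub>1 t\<close> times the identity.\<close>
    then have "(\<lambda>k. \<beta> t (z k) $ i + 2 * c\<^sub>1 t * inverse (real (Suc k))) \<longlonglongrightarrow> \<beta> t y $ i + 2 * c\<^sub>1 t * 0"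
      by (intro tendsto_intros LIMSEQ_inverse_real_of_nat)
    then have "\<forall>\<^sub>F k in sequentially. \<beta> t (z k) $ i + 2 * c\<^sub>1 t * inverse (real (Suc k)) < \<beta> t y $ i + e"
      by (rule order_tendstoD) (use \<open>e > 0\<close> in simp)
    then obtain k where k: "\<beta> t (z k) $ i + 2 * c\<^sub>1 t * inverse (real (Suc k)) < \<beta> t y $ i + e"
      by (auto simp: eventually_sequentially)
    define \<delta> where "\<delta> = inverse (real (Suc k))"
    have "\<delta> > 0" by (simp add: \<delta>_def)
    have "\<forall>\<^sub>F u in nhds y. dist u y < \<delta>"
      using eventually_nhds_metric \<open>\<delta> > 0\<close> by blast
    then have "\<forall>\<^sub>F u in nhds y. ereal (\<beta> t u $ i) \<le> ereal (\<beta> t y $ i + e)"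
    proof (rule eventually_mono)
      fix u assume "dist u y < \<delta>"
      then have near: "\<bar>u $ j - y $ j\<bar> < \<delta>" for j
        using component_le_norm_cart[of "u - y" j] by (simp add: dist_norm)
      have "u \<le> z k" unfolding less_eq_vec_def z_def \<delta>_def[symmetric] using near by (auto simp: abs_less_iff) (smt (verit))
      from \<beta>_mono[OF this, of t] have "\<beta> t u $ i + c\<^sub>1 t * u $ i \<le> \<beta> t (z k) $ i + c\<^sub>1 t * z k $ i"
        by (auto simp: less_eq_vec_def)
      moreover have "c\<^sub>1 t * (z k $ i - u $ i) \<le> c\<^sub>1 t * (2 * \<delta>)"
        using near[of i] c\<^sub>1_nonneg by (intro mult_left_mono) (auto simp: z_def \<delta>_def abs_less_iff)
      ultimately show "ereal (\<beta> t u $ i) \<le> ereal (\<beta> t y $ i + e)"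
        using k[folded \<delta>_def] by (simp add: algebra_simps)
    qed
    then have "Limsup (nhds y) (\<lambda>u. ereal (\<beta> t u $ i)) \<le> ereal (\<beta> t y $ i + e)" by (rule Limsup_bounded)
    moreover have "ereal (v $ i) \<le> Limsup (nhds y) (\<lambda>u. ereal (\<beta> t u $ i))"
      using v unfolding envelope_box_def usc_envelope_def by blast
    ultimately have "ereal (v $ i) \<le> ereal (\<beta> t y $ i + e)" by (rule order_trans[rotated])
    then show "v $ i \<le> \<beta> t y $ i + e" by simp
  qed
qed

lemma envelope_box_lower:
  assumes v: "v \<in> envelope_box (\<beta> t) y" and w: "w \<lless> y"
  shows "\<beta> t w + c\<^sub>1 t *\<^sub>R w \<le> v + c\<^sub>1 t *\<^sub>R y"
  unfolding less_eq_vec_def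
proof
  fix i
  have "\<beta> t w $ i + c\<^sub>1 t * w $ i - c\<^sub>1 t * y $ i \<le> v $ i"
  proof (rule field_le_epsilon)
    fix e :: real assume "e > 0"
    have "((\<lambda>u. c\<^sub>1 t * u $ i) \<longlongrightarrow> c\<^sub>1 t * y $ i) (nhds y)" by (intro tendsto_intros filterlim_ident)
    then have 1: "\<forall>\<^sub>F u in nhds y. c\<^sub>1 t * u $ i < c\<^sub>1 t * y $ i + e" by (rule order_tendstoD) (use \<open>e > 0\<close> in simp)
    have "\<forall>\<^sub>F u in nhds y. w $ j < u $ j" for j
      by (rule order_tendstoD[OF tendsto_vec_nth[OF filterlim_ident]]) (use w in \<open>simp add: strictly_below_def\<close>)
    then have 2: "\<forall>\<^sub>F u in nhds y. \<forall>j. w $ j < u $ j" by (intro eventually_all_finite) auto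
    have "\<forall>\<^sub>F u in nhds y. ereal (\<beta> t w $ i + c\<^sub>1 t * w $ i - c\<^sub>1 t * y $ i - e) \<le> ereal (\<beta> t u $ i)"
      using 1 2
    proof eventually_elim
      case (elim u)
      have "w \<le> u" using elim(2) by (auto simp: less_eq_vec_def intro: less_imp_le)
      from \<beta>_mono[OF this, of t] have "\<beta> t w $ i + c\<^sub>1 t * w $ i \<le> \<beta> t u $ i + c\<^sub>1 t * u $ i"
        by (auto simp: less_eq_vec_def)
      then show ?case using elim(1) by simp
    qed
    then have "ereal (\<beta> t w $ i + c\<^sub>1 t * w $ i - c\<^sub>1 t * y $ i - e) \<le> Liminf (nhds y) (\<lambda>u. ereal (\<beta> t u $ i))"
      by (rule Liminf_bounded)
    also have "\<dots> \<le> ereal (v $ i)"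
      using v unfolding envelope_box_def lsc_envelope_def by auto
    finally show "\<beta> t w $ i + c\<^sub>1 t * w $ i - c\<^sub>1 t * y $ i \<le> v $ i + e" by simp
  qed
  then show "(\<beta> t w + c\<^sub>1 t *\<^sub>R w) $ i \<le> (v + c\<^sub>1 t *\<^sub>R y) $ i" by simp
qed

end

context regular_flow
begin

lemma velocity_along_X_integrable: "(\<lambda>r. \<beta> r (X r x)) absolutely_integrable_on {s..T}"
proof -
  have "bounded ((\<lambda>r. X r x) ` {s..T})" by (intro compact_imp_bounded compact_continuous_image X_continuous compact_Icc)
  then obtain K where K: "\<forall>r\<in>{s..T}. norm (X r x) \<le> K" by (auto simp: bounded_iff)
  have "set_integrable lborel {s..T} (\<lambda>r. \<beta> r (X r x))"
  proof (rule set_integrable_bound)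
    show "set_integrable lborel {s..T} (\<lambda>r. (1 + \<bar>K\<bar>) * c\<^sub>0 r)"
      using c_set_integrable(1)[of "{s..T}"] by (intro set_integrable_mult_right) auto
    show "set_borel_measurable lborel {s..T} (\<lambda>r. \<beta> r (X r x))"
      unfolding set_borel_measurable_def by measurable
    show "AE r in lborel. r \<in> {s..T} \<longrightarrow> norm (\<beta> r (X r x)) \<le> norm ((1 + \<bar>K\<bar>) * c\<^sub>0 r)"
    proof (intro AE_I2 impI)
      fix r assume r: "r \<in> {s..T}"
      have "norm (\<beta> r (X r x)) \<le> c\<^sub>0 r * (1 + norm (X r x))" by (rule \<beta>_growth)
      also have "\<dots> \<le> c\<^sub>0 r * (1 + \<bar>K\<bar>)" using K r c\<^sub>0_nonneg by (intro mult_left_mono) force+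
      finally show "norm (\<beta> r (X r x)) \<le> norm ((1 + \<bar>K\<bar>) * c\<^sub>0 r)"
        using c\<^sub>0_nonneg[of r] by (simp add: abs_mult mult.commute)
    qed
  qed
  then show ?thesis
    by (rule set_integrable_lborel_imp_absolutely_integrable)
qed

lemma integral_solution_X:
  assumes N: "negligible N" and b: "\<And>t y. t \<in> {s..T} - N \<Longrightarrow> b t y = \<beta> t y"
  shows "integral_solution b s T x (\<lambda>t. X t x)"
  unfolding integral_solution_def
proof (intro conjI ballI)
  show "absolutely_continuous_on {s..T} (\<lambda>t. X t x)" by (rule X_solves(1))
  show ai: "(\<lambda>r. b r (X r x)) absolutely_integrable_on {s..T}"
    by (rule absolutely_integrable_spike[OF velocity_along_X_integrable N]) (simp add: b)
  fix t assume t: "t \<in> {s..T}"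
  have "(\<lambda>r. b r (X r x)) absolutely_integrable_on {s..t}"
    by (rule absolutely_integrable_on_subinterval[OF ai]) (use t in auto)
  then have "(LINT r:{s..t}|lebesgue. b r (X r x)) = integral {s..t} (\<lambda>r. b r (X r x))"
    by (rule set_lebesgue_integral_eq_integral(2))
  also have "\<dots> = integral {s..t} (\<lambda>r. \<beta> r (X r x))"
    by (rule integral_spike[OF N]) (use b t in auto)
  also have "\<dots> = X t x - x" using integral_unique[OF X_has_integral[of t x]] t by simp
  finally show "X t x = x + (LINT r:{s..t}|lebesgue. b r (X r x))" by simp
qed

lemma inclusion_solution_eq_X:
  assumes N: "negligible N" and b: "\<And>t y. t \<in> {s..T} - N \<Longrightarrow> b t y = \<beta> t y"
    and \<gamma>: "inclusion_solution b s T x \<gamma>" and t: "t \<in> {s..T}" and jf: "rescaled.jump_free t x"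
  shows "\<gamma> t = X t x"
proof -
  have ac: "absolutely_continuous_on {s..T} \<gamma>" and "\<gamma> s = x"
    and "AE t in lebesgue. t \<in> {s..T} \<longrightarrow> (\<exists>v\<in>envelope_box (b t) (\<gamma> t). (\<gamma> has_vector_derivative v) (at t within {s..T}))"
    using \<gamma> unfolding inclusion_solution_def by auto
  then obtain M where M: "negligible M" "\<And>t. t \<in> {s..T} - M \<Longrightarrow>
      \<exists>v\<in>envelope_box (b t) (\<gamma> t). (\<gamma> has_vector_derivative v) (at t within {s..T})"
    by (elim AE_lebesgue_negligible) blast
  then have "\<forall>t. \<exists>v. t \<in> {s..T} - M \<longrightarrow> v \<in> envelope_box (b t) (\<gamma> t) \<and> (\<gamma> has_vector_derivative v) (at t within {s..T})"
    by blast
  from choice[OF this] obtain v where v: "\<And>t. t \<in> {s..T} - M \<Longrightarrow> v t \<in> envelope_box (b t) (\<gamma> t)"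
    "\<And>t. t \<in> {s..T} - M \<Longrightarrow> (\<gamma> has_vector_derivative v t) (at t within {s..T})" by blast
  have sub: "{s..t} \<subseteq> {s..T}" using t by auto
  have box: "v r \<in> envelope_box (\<beta> r) (\<gamma> r)" if "r \<in> {s..t} - (M \<union> N)" for r
  proof -
    have "b r = \<beta> r" using b[of r] that sub by auto
    then show ?thesis using v(1)[of r] that sub by auto
  qed
  show ?thesis
  proof (rule differential_inequality_imp_eq_X[where N = "M \<union> N" and v = v])
    show "absolutely_continuous_on {s..t} \<gamma>" by (rule absolutely_continuous_on_subset[OF ac sub])
    show "negligible (M \<union> N)" by (intro negligible_Un M N)
    show "(\<gamma> has_vector_derivative v r) (at r within {s..t})" if "r \<in> {s..t} - (M \<union> N)" for r
      by (rule has_vector_derivative_within_subset[OF v(2) sub]) (use that sub in auto)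
    show "v r \<le> \<beta> r (\<gamma> r)" if "r \<in> {s..t} - (M \<union> N)" for r
      by (rule envelope_box_upper[OF box[OF that]])
    show "\<beta> r y + c\<^sub>1 r *\<^sub>R y \<le> v r + c\<^sub>1 r *\<^sub>R \<gamma> r" if "r \<in> {s..t} - (M \<union> N)" "y \<lless> \<gamma> r" for r y
      by (rule envelope_box_lower[OF box[OF that(1)] that(2)])
  qed (use t jf \<open>\<gamma> s = x\<close> in auto)
qed

text \<open>
  The exceptional set may not depend on the time, hence the passage through a countable dense set of times.
\<close>

lemma AE_inclusion_solution_eq_X:
  assumes N: "negligible N" and b: "\<And>t y. t \<in> {s..T} - N \<Longrightarrow> b t y = \<beta> t y"
  shows "AE x in lebesgue. \<forall>\<gamma>. inclusion_solution b s T x \<gamma> \<longrightarrow> (\<forall>t\<in>{s..T}. \<gamma> t = X t x)"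
proof -
  obtain Q where Q: "countable Q" "Q \<subseteq> {s..T}" "{s..T} \<subseteq> closure Q" by (rule separable)
  have cl: "closure Q = {s..T}" using Q closure_minimal[OF Q(2) closed_atLeastAtMost] by auto
  have "AE x in lborel. \<forall>q\<in>Q. rescaled.jump_free q x"
    by (rule AE_ball_countable'[OF rescaled.AE_jump_free Q(1)]) (use Q in auto)
  then have "AE x in lebesgue. \<forall>q\<in>Q. rescaled.jump_free q x" by (rule AE_completion)
  then show ?thesis
  proof (rule eventually_mono, intro allI impI ballI)
    fix x \<gamma> t assume jf: "\<forall>q\<in>Q. rescaled.jump_free q x" and \<gamma>: "inclusion_solution b s T x \<gamma>" and t: "t \<in> {s..T}"
    have "\<gamma> t - X t x = 0"
    proof (rule continuous_constant_on_closure[of Q "\<lambda>t. \<gamma> t - X t x"])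
      show "continuous_on (closure Q) (\<lambda>t. \<gamma> t - X t x)" unfolding cl
        by (intro continuous_intros X_continuous absolutely_continuous_on_imp_continuous_on)
          (use \<gamma> in \<open>simp add: inclusion_solution_def\<close>)
      show "\<gamma> q - X q x = 0" if "q \<in> Q" for q
        using inclusion_solution_eq_X[OF N b \<gamma>, of q] that Q(2) jf by auto
      show "t \<in> closure Q" using t cl by simp
    qed
    then show "\<gamma> t = X t x" by simp
  qed
qed

end

section \<open>Composition with locally integrable functions\<close>

lemma borel_measurable_lebesgue_AE_eq:
  fixes f g :: "'a::euclidean_space \<Rightarrow> 'b::euclidean_space"
  assumes g: "g \<in> borel_measurable (lebesgue_on S)" and N: "N \<in> null_sets lebesgue" and eq: "\<And>x. x \<in> S - N \<Longrightarrow> f x = g x"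
    and S: "S \<in> sets lebesgue"
  shows "f \<in> borel_measurable (lebesgue_on S)"
proof -
  have "(\<lambda>x. if x \<in> S then f x else 0) \<in> borel_measurable lebesgue"
  proof (rule borel_measurableI)
    fix U :: "'b set" assume "open U"
    define f' where "f' x = (if x \<in> S then f x else 0)" for x
    define g' where "g' x = (if x \<in> S then g x else 0)" for x
    have "g' \<in> borel_measurable lebesgue"
      unfolding g'_def by (rule borel_measurable_if_I[OF g S])
    from measurable_sets[OF this borel_open[OF \<open>open U\<close>]] have gU: "g' -` U \<in> sets lebesgue" by simp
    have Nm: "A \<in> sets lebesgue" if "A \<subseteq> N" for A
      using N that by (meson negligible_iff_null_sets negligible_subset null_setsD2)
    have "f' -` U = (g' -` U - N) \<union> (f' -` U \<inter> N)"
      using eq by (auto simp: f'_def g'_def split: if_splits)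
    also have "\<dots> \<in> sets lebesgue"
      by (intro sets.Un sets.Diff gU Nm null_setsD2[OF N]) auto
    finally show "(\<lambda>x. if x \<in> S then f x else 0) -` U \<inter> space lebesgue \<in> sets lebesgue" by (simp add: f'_def[abs_def])
  qed
  then show ?thesis using borel_measurable_if[OF S] by blast
qed

text \<open>
  Composition with \<open>f\<close> respects equality almost everywhere because preimages of null sets are null.
  So \<open>h\<close> can be cut off outside the larger ball and replaced by a Borel function; its norm is compared
  through the image measure of Lebesgue measure under \<open>G\<close>.
\<close>

lemma L1_ball_composition:
  fixes f G :: "'a::euclidean_space \<Rightarrow> 'a" and E R R' :: real
  assumes G[measurable]: "G \<in> borel_measurable borel" and E: "0 \<le> E"
    and cmp: "\<And>A. A \<in> sets borel \<Longrightarrow> emeasure lborel (G -` A) \<le> ennreal E * emeasure lborel A"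
    and eq: "AE x in lebesgue. f x = G x" and rad: "\<And>x. norm x < R \<Longrightarrow> norm (G x) < R'"
    and h: "L1loc h"
  shows "(\<lambda>x. h (f x)) absolutely_integrable_on ball 0 R"
    and "L1_ball R (\<lambda>x. h (f x)) \<le> E * L1_ball R' h"
proof -
  have hc: "h absolutely_integrable_on cball 0 R'" using h by (simp add: L1loc_def)
  have hR: "h absolutely_integrable_on ball 0 R'"
    by (rule set_integrable_subset[OF hc]) auto
  \<comment> \<open>Only the values of \<open>h\<close> on the larger ball are seen by \<open>f\<close> on the smaller one.\<close>
  define u where "u x = indicator (ball 0 R') x *\<^sub>R h x" for x
  have uint: "integrable lebesgue u" using hR by (simp add: set_integrable_def u_def[abs_def])
  then have "u \<in> borel_measurable lebesgue" by auto
  from completion_ex_borel_measurable_real[OF this] obtain u' where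
    u'm: "u' \<in> borel_measurable lborel" and ueq: "AE x in lborel. u x = u' x" by blast
  have u'[measurable]: "u' \<in> borel_measurable borel" using u'm by simp
  have u'leb: "u' \<in> borel_measurable lebesgue" by (intro measurable_completion u'm)
  have ueq': "AE x in lebesgue. u x = u' x" by (rule AE_completion[OF ueq])
  have u'int_leb: "integrable lebesgue u'"
    by (rule integrable_cong_AE_imp[OF uint u'leb]) (use ueq' in \<open>auto elim: eventually_mono\<close>)
  then have u'int: "integrable lborel u'" by (simp add: integrable_completion)
  obtain N0 where N0: "\<And>x. x \<notin> N0 \<Longrightarrow> u x = u' x" "N0 \<in> null_sets lborel"
    using ueq by (elim AE_E3) auto
  have "emeasure lborel (G -` N0) \<le> ennreal E * emeasure lborel N0" by (rule cmp) (use N0 in auto)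
  then have "emeasure lborel (G -` N0) = 0" using N0(2) by auto
  moreover have "G -` N0 \<in> sets borel" by (rule measurable_sets_borel[OF G]) (use N0 in auto)
  ultimately have GN0: "negligible (G -` N0)" by (simp add: negligible_iff_null_sets null_setsI null_sets_completionI)
  obtain N1 where N1: "negligible N1" "\<And>x. x \<notin> N1 \<Longrightarrow> f x = G x" by (rule AE_lebesgue_negligible[OF eq]) blast
  define S where "S = G -` N0 \<union> N1"
  have S: "negligible S" unfolding S_def by (intro negligible_Un GN0 N1)
  have hf: "h (f x) = u' (G x)" if "x \<in> ball 0 R - S" for x
  proof -
    have "h (f x) = h (G x)" using N1(2)[of x] that by (simp add: S_def)
    also have "\<dots> = u (G x)" using rad[of x] that by (simp add: u_def)
    also have "\<dots> = u' (G x)" using N0(1)[of "G x"] that by (simp add: S_def)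
    finally show ?thesis .
  qed
  define D where "D = distr lborel borel G"
  have nn: "(\<integral>\<^sup>+x. ennreal \<bar>u' (G x)\<bar> \<partial>lborel) \<le> ennreal (E * (LINT x|lborel. \<bar>u' x\<bar>))"
  proof -
    have "(\<integral>\<^sup>+x. ennreal \<bar>u' (G x)\<bar> \<partial>lborel) = (\<integral>\<^sup>+x. ennreal \<bar>u' x\<bar> \<partial>D)"
      unfolding D_def by (subst nn_integral_distr) auto
    also have "\<dots> \<le> (\<integral>\<^sup>+x. ennreal \<bar>u' x\<bar> \<partial>scale_measure (ennreal E) lborel)"
    proof (rule nn_integral_mono_measure)
      show s: "sets D = sets (scale_measure (ennreal E) lborel)" by (simp add: D_def)
      show "D \<le> scale_measure (ennreal E) lborel"
        unfolding le_measure[OF s]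
      proof
        fix A assume "A \<in> sets D"
        then have A: "A \<in> sets borel" by (simp add: D_def)
        then have "emeasure D A = emeasure lborel (G -` A)" unfolding D_def by (simp add: emeasure_distr)
        also have "\<dots> \<le> ennreal E * emeasure lborel A" by (rule cmp[OF A])
        finally show "emeasure D A \<le> emeasure (scale_measure (ennreal E) lborel) A" by simp
      qed
    qed
    also have "\<dots> = ennreal E * (\<integral>\<^sup>+x. ennreal \<bar>u' x\<bar> \<partial>lborel)"
      by (rule nn_integral_scale_measure) measurable
    also have "(\<integral>\<^sup>+x. ennreal \<bar>u' x\<bar> \<partial>lborel) = ennreal (LINT x|lborel. \<bar>u' x\<bar>)"
      by (rule nn_integral_eq_integral) (use u'int in auto)
    finally show ?thesis using E by (simp add: ennreal_mult)
  qed
  have "integrable lborel (\<lambda>x. u' (G x))"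
    by (rule integrableI_bounded) (use nn in \<open>auto simp: le_less_trans\<close>)
  then have intG: "integrable lebesgue (\<lambda>x. u' (G x))" by (subst integrable_completion) auto
  have aiG: "(\<lambda>x. u' (G x)) absolutely_integrable_on ball 0 R"
    unfolding set_integrable_def by (rule integrable_mult_indicator[OF _ intG]) simp
  show ai: "(\<lambda>x. h (f x)) absolutely_integrable_on ball 0 R"
    by (rule absolutely_integrable_spike[OF aiG S hf])
  have "L1_ball R (\<lambda>x. h (f x)) = integral (ball 0 R) (\<lambda>x. \<bar>h (f x)\<bar>)"
    unfolding L1_ball_def using absolutely_integrable_norm[OF ai]
    by (intro set_lebesgue_integral_eq_integral(2)) (simp add: comp_def)
  also have "\<dots> = integral (ball 0 R) (\<lambda>x. \<bar>u' (G x)\<bar>)"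
    by (rule integral_spike[OF S]) (simp add: hf)
  also have "\<dots> = (LINT x:ball 0 R|lebesgue. \<bar>u' (G x)\<bar>)"
    using absolutely_integrable_norm[OF aiG]
    by (intro set_lebesgue_integral_eq_integral(2)[symmetric]) (simp add: comp_def)
  also have "\<dots> \<le> (LINT x|lebesgue. \<bar>u' (G x)\<bar>)"
    unfolding set_lebesgue_integral_def
  proof (rule integral_mono)
    show "integrable lebesgue (\<lambda>x. indicator (ball 0 R) x *\<^sub>R \<bar>u' (G x)\<bar>)"
      by (rule integrable_mult_indicator) (use intG in auto)
  qed (use intG in \<open>auto simp: indicator_def\<close>)
  also have "\<dots> = (LINT x|lborel. \<bar>u' (G x)\<bar>)" by (rule integral_completion) measurable
  also have "\<dots> \<le> E * (LINT x|lborel. \<bar>u' x\<bar>)"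
  proof (rule integral_real_bounded)
    show "0 \<le> E * (LINT x|lborel. \<bar>u' x\<bar>)" using E by (intro mult_nonneg_nonneg integral_nonneg_AE) auto
    show "(\<integral>\<^sup>+x. ennreal \<bar>u' (G x)\<bar> \<partial>lborel) \<le> ennreal (E * (LINT x|lborel. \<bar>u' x\<bar>))" by (rule nn)
  qed
  also have "(LINT x|lborel. \<bar>u' x\<bar>) = (LINT x|lebesgue. \<bar>u' x\<bar>)" by (rule integral_completion[symmetric]) measurable
  also have "\<dots> = (LINT x|lebesgue. \<bar>u x\<bar>)"
    by (rule integral_cong_AE) (use ueq' u'leb uint in \<open>auto elim: eventually_mono\<close>)
  also have "\<dots> = L1_ball R' h"
    unfolding L1_ball_def set_lebesgue_integral_def u_def by (rule Bochner_Integration.integral_cong) (auto simp: indicator_def)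
  finally show "L1_ball R (\<lambda>x. h (f x)) \<le> E * L1_ball R' h" .
qed

lemma L1loc_if_balls:
  assumes "\<And>R. R > 0 \<Longrightarrow> h absolutely_integrable_on ball 0 R"
  shows "L1loc h"
  unfolding L1loc_def
proof (intro allI impI)
  fix K :: "'a set" assume "compact K"
  then obtain B where B: "\<And>x. x \<in> K \<Longrightarrow> norm x \<le> B" using compact_imp_bounded bounded_iff by metis
  have "K \<subseteq> ball 0 (\<bar>B\<bar> + 1)" using B by fastforce
  then show "h absolutely_integrable_on K"
    by (rule set_integrable_subset[OF assms, rotated 2]) (use \<open>compact K\<close> lmeasurable_compact in \<open>auto simp: fmeasurableD\<close>)
qed

lemma cumulative_diff_eq:
  assumes C: "C absolutely_integrable_on {0..T}" and N: "negligible N" and eq: "\<forall>t\<in>{0..T} - N. C t = c t"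
    and st: "0 \<le> s" "s \<le> t" "t \<le> T"
  shows "cumulative C t - cumulative C s = integral {s..t} c"
proof -
  have sub: "C absolutely_integrable_on {u..v}" if "0 \<le> u" "v \<le> T" for u v
    by (rule absolutely_integrable_on_subinterval[OF C]) (use that in auto)
  have cum: "cumulative C v = integral {0..v} C" if "v \<le> T" for v
    unfolding cumulative_def by (rule set_lebesgue_integral_eq_integral(2)[OF sub]) (use that in auto)
  have "integral {0..s} C + integral {s..t} C = integral {0..t} C"
    by (rule Henstock_Kurzweil_Integration.integral_combine)
      (use st sub[of 0 t] in \<open>auto simp: absolutely_integrable_on_def\<close>)
  moreover have "integral {s..t} C = integral {s..t} c"
    by (rule integral_spike[OF N]) (use eq st in auto)
  ultimately show ?thesis using cum[of t] cum[of s] st by simp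
qed

lemma L1loc_L1_cong_AE:
  fixes F G :: "real \<Rightarrow> 'a::euclidean_space \<Rightarrow> 'b::euclidean_space"
  assumes G: "L1loc_L1 {a..b} G" and eq: "AE x in lebesgue. \<forall>t\<in>{a..b}. F t x = G t x"
  shows "L1loc_L1 {a..b} F"
proof -
  have "AE x in lborel. \<forall>t\<in>{a..b}. F t x = G t x" using eq by (simp add: AE_completion_iff)
  then obtain N where N: "\<And>x. x \<notin> N \<Longrightarrow> \<forall>t\<in>{a..b}. F t x = G t x" "N \<in> null_sets lborel"
    by (elim AE_E3) auto
  have Nn: "negligible N" using N(2) by (simp add: negligible_iff_null_sets null_sets_completionI)
  have S: "{a..b} \<times> (UNIV :: 'a set) \<in> sets lebesgue"
    by (rule sets_completionI_sets) (auto intro!: borel_closed closed_Times)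
  have int: "(LINT t:{a..b}|lebesgue. norm (F t x)) = (LINT t:{a..b}|lebesgue. norm (G t x))" if "x \<notin> N" for x
    by (rule set_lebesgue_integral_cong) (use N(1)[OF that] in auto)
  show ?thesis unfolding L1loc_L1_def
  proof (intro conjI)
    show "(\<lambda>(t, x). F t x) \<in> borel_measurable (lebesgue_on ({a..b} \<times> (UNIV :: 'a set)))"
    proof (rule borel_measurable_lebesgue_AE_eq[OF _ _ _ S])
      show "(\<lambda>(t, x). G t x) \<in> borel_measurable (lebesgue_on ({a..b} \<times> (UNIV :: 'a set)))"
        using G by (simp add: L1loc_L1_def)
      have "(UNIV :: real set) \<times> N \<in> null_sets (lborel \<Otimes>\<^sub>M lborel)"
        by (rule lborel.times_in_null_sets2[OF _ N(2)]) simp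
      then show "(UNIV :: real set) \<times> N \<in> null_sets lebesgue"
        unfolding lborel_prod by (rule null_sets_completionI)
    qed (use N(1) in auto)
    have "AE x in lebesgue. (\<lambda>t. G t x) absolutely_integrable_on {a..b}" using G by (simp add: L1loc_L1_def)
    with eq show "AE x in lebesgue. (\<lambda>t. F t x) absolutely_integrable_on {a..b}"
    proof eventually_elim
      case (elim x)
      show ?case by (rule absolutely_integrable_spike[OF elim(2) negligible_empty]) (use elim(1) in auto)
    qed
    show "L1loc (\<lambda>x. LINT t:{a..b}|lebesgue. norm (F t x))"
      unfolding L1loc_def
    proof (intro allI impI)
      fix K :: "'a set" assume "compact K"
      then have "(\<lambda>x. LINT t:{a..b}|lebesgue. norm (G t x)) absolutely_integrable_on K"
        using G by (simp add: L1loc_L1_def L1loc_def)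
      then show "(\<lambda>x. LINT t:{a..b}|lebesgue. norm (F t x)) absolutely_integrable_on K"
        by (rule absolutely_integrable_spike[OF _ Nn]) (simp add: int)
    qed
  qed
qed

text \<open>
  What the choice of one solution for each initial point at the initial time \<open>s\<close> provides. By the third
  condition every inclusion flow agrees with \<open>X\<close> for almost every initial point.
\<close>

definition canonical_flow ::
  "real \<Rightarrow> (real \<Rightarrow> real^'n::finite \<Rightarrow> real^'n) \<Rightarrow> (real \<Rightarrow> real) \<Rightarrow> (real \<Rightarrow> real) \<Rightarrow> real \<Rightarrow>
    (real \<Rightarrow> real^'n \<Rightarrow> real^'n) \<Rightarrow> bool" where
  "canonical_flow T b C\<^sub>0 C\<^sub>1 s X \<longleftrightarrow>
    (\<lambda>p. X (fst p) (snd p)) \<in> borel_measurable (borel \<Otimes>\<^sub>M borel) \<and>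
    (\<forall>x. integral_solution b s T x (\<lambda>t. X t x)) \<and>
    (AE x in lebesgue. \<forall>\<gamma>. inclusion_solution b s T x \<gamma> \<longrightarrow> (\<forall>t\<in>{s..T}. \<gamma> t = X t x)) \<and>
    (\<forall>t\<in>{s..T}. \<forall>A\<in>sets borel. emeasure lborel (X t -` A) \<le>
        ennreal (exp (real CARD('n) * (cumulative C\<^sub>1 t - cumulative C\<^sub>1 s))) * emeasure lborel A) \<and>
    (\<forall>t\<in>{s..T}. \<forall>x. 1 + norm (X t x) \<le> (1 + norm x) * exp (cumulative C\<^sub>0 t - cumulative C\<^sub>0 s)) \<and>
    0 \<le> cumulative C\<^sub>0 s \<and> (\<forall>u v. 0 \<le> u \<longrightarrow> u \<le> v \<longrightarrow> v \<le> T \<longrightarrow> cumulative C\<^sub>0 u \<le> cumulative C\<^sub>0 v) \<and>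
    L1loc_L1 {s..T} (\<lambda>t x. b t (X t x))"

lemma canonical_flow_exists:
  fixes b :: "real \<Rightarrow> real^'n::finite \<Rightarrow> real^'n"
  assumes vf: "velocity_field T b C\<^sub>0 C\<^sub>1" and s: "s \<in> {0..T}"
  shows "\<exists>X. canonical_flow T b C\<^sub>0 C\<^sub>1 s X"
proof -
  obtain \<beta> c\<^sub>0 c\<^sub>1 N where reg: "regular_velocity \<beta> c\<^sub>0 c\<^sub>1" and N: "N \<in> null_sets lborel"
    and b: "\<And>t y. t \<in> {0..T} - N \<Longrightarrow> b t y = \<beta> t y" and C0: "\<And>t. t \<in> {0..T} - N \<Longrightarrow> C\<^sub>0 t = c\<^sub>0 t"
    and C1: "\<And>t. t \<in> {0..T} - N \<Longrightarrow> C\<^sub>1 t = c\<^sub>1 t"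
    by (rule velocity_field_regular_version[OF vf]) blast
  interpret regular_velocity \<beta> c\<^sub>0 c\<^sub>1 by (rule reg)
  obtain \<Phi> where "increasing_flow (rescaled_field \<beta> c\<^sub>1 s) rescaled_growth s \<Phi>" using rescaled_flow_exists by blast
  then interpret flow: increasing_flow "rescaled_field \<beta> c\<^sub>1 s" rescaled_growth s \<Phi> .
  interpret regular_flow \<beta> c\<^sub>0 c\<^sub>1 s \<Phi> by unfold_locales
  have Nn: "negligible N" using N by (simp add: negligible_iff_null_sets null_sets_completionI)
  have ai: "C\<^sub>0 absolutely_integrable_on {0..T}" "C\<^sub>1 absolutely_integrable_on {0..T}"
    using vf by (auto simp: velocity_field_def)
  have b': "b t y = \<beta> t y" if "t \<in> {s..T} - N" for t y using b that s by auto
  have "\<forall>t\<in>{0..T} - N. C\<^sub>0 t = c\<^sub>0 t" "\<forall>t\<in>{0..T} - N. C\<^sub>1 t = c\<^sub>1 t" using C0 C1 by blast+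
  note cum0 = cumulative_diff_eq[OF ai(1) Nn this(1)] and cum1 = cumulative_diff_eq[OF ai(2) Nn this(2)]
  have c0_mono: "cumulative C\<^sub>0 u \<le> cumulative C\<^sub>0 v" if "0 \<le> u" "u \<le> v" "v \<le> T" for u v
    using cum0[OF that] integral_c_nonneg(1)[of u v] by simp
  have zero: "cumulative C\<^sub>0 0 = 0"
    using set_lebesgue_integral_eq_integral(2)[of "{0..0}" C\<^sub>0] absolutely_integrable_on_subinterval[OF ai(1), of 0 0] s
    by (simp add: cumulative_def)
  have bound: "1 + norm (X t x) \<le> (1 + norm x) * exp (cumulative C\<^sub>0 t - cumulative C\<^sub>0 s)" if "t \<in> {s..T}" for t x
    using X_norm_bound[of t x] cum0[of s t] that s by simp
  have sol: "integral_solution b s T x (\<lambda>t. X t x)" for x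
    by (rule integral_solution_X[OF Nn b'])
  have L1: "L1loc_L1 {s..T} (\<lambda>t x. b t (X t x))"
    unfolding L1loc_L1_def
  proof (intro conjI)
    have S: "{s..T} \<times> (UNIV :: (real^'n) set) \<in> sets lebesgue"
      by (rule sets_completionI_sets) (auto intro!: borel_closed closed_Times)
    show "(\<lambda>(t, x). b t (X t x)) \<in> borel_measurable (lebesgue_on ({s..T} \<times> (UNIV :: (real^'n) set)))"
    proof (rule borel_measurable_lebesgue_AE_eq[OF _ _ _ S])
      have "(\<lambda>p. \<beta> (fst p) (X (fst p) (snd p))) \<in> borel_measurable (lborel :: (real \<times> (real^'n)) measure)"
        unfolding lborel_prod[symmetric] by measurable
      then show "(\<lambda>p. \<beta> (fst p) (X (fst p) (snd p))) \<in> borel_measurable (lebesgue_on ({s..T} \<times> (UNIV :: (real^'n) set)))"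
        by (intro measurable_restrict_space1 measurable_completion)
      have "N \<times> (UNIV :: (real^'n) set) \<in> null_sets (lborel \<Otimes>\<^sub>M lborel)"
        by (rule lborel.times_in_null_sets1[OF N]) simp
      then show "N \<times> (UNIV :: (real^'n) set) \<in> null_sets lebesgue"
        unfolding lborel_prod by (rule null_sets_completionI)
      fix p assume p: "p \<in> {s..T} \<times> UNIV - N \<times> (UNIV :: (real^'n) set)"
      have "b (fst p) (X (fst p) (snd p)) = \<beta> (fst p) (X (fst p) (snd p))"
        by (rule b') (use p in auto)
      then show "(case p of (t, x) \<Rightarrow> b t (X t x)) = \<beta> (fst p) (X (fst p) (snd p))"
        by (simp add: split_beta)
    qed
    show "AE x in lebesgue. (\<lambda>t. b t (X t x)) absolutely_integrable_on {s..T}"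
      using sol by (simp add: integral_solution_def)
    define I where "I x = (LINT t:{s..T}|lborel. norm (\<beta> t (X t x)))" for x
    have nai: "(\<lambda>t. norm (\<beta> t (X t x))) absolutely_integrable_on {s..T}" for x
      using absolutely_integrable_norm[OF velocity_along_X_integrable] by (simp add: comp_def)
    have I_eq: "I x = integral {s..T} (\<lambda>t. norm (\<beta> t (X t x)))" for x
    proof -
      have "integrable lebesgue (\<lambda>t. indicator {s..T} t *\<^sub>R norm (\<beta> t (X t x)))" using nai by (simp add: set_integrable_def)
      then have "set_integrable lborel {s..T} (\<lambda>t. norm (\<beta> t (X t x)))"
        unfolding set_integrable_def by (subst (asm) integrable_completion) measurable
      then show ?thesis unfolding I_def by (rule set_borel_integral_eq_integral(2))
    qed
    have bI: "(LINT t:{s..T}|lebesgue. norm (b t (X t x))) = I x" for x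
    proof -
      have "(\<lambda>t. norm (b t (X t x))) absolutely_integrable_on {s..T}"
        by (rule absolutely_integrable_spike[OF nai Nn]) (simp add: b')
      then have "(LINT t:{s..T}|lebesgue. norm (b t (X t x))) = integral {s..T} (\<lambda>t. norm (b t (X t x)))"
        by (rule set_lebesgue_integral_eq_integral(2))
      also have "\<dots> = I x" unfolding I_eq by (rule integral_spike[OF Nn]) (simp add: b')
      finally show ?thesis .
    qed
    have I_meas: "I \<in> borel_measurable borel" unfolding I_def by measurable
    define K where "K R = (1 + R) * exp (cumulative C\<^sub>0 T - cumulative C\<^sub>0 s)" for R
    have I_bound: "norm (I x) \<le> integral {s..T} (\<lambda>r. c\<^sub>0 r * K R)" if x: "x \<in> ball 0 R" for x R
    proof -
      have "0 \<le> I x" unfolding I_eq by (rule integral_nonneg) (use nai in \<open>auto simp: absolutely_integrable_on_def\<close>)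
      moreover have "I x \<le> integral {s..T} (\<lambda>r. c\<^sub>0 r * K R)"
        unfolding I_eq
      proof (rule integral_le)
        show "(\<lambda>t. norm (\<beta> t (X t x))) integrable_on {s..T}" using nai by (auto simp: absolutely_integrable_on_def)
        show "(\<lambda>r. c\<^sub>0 r * K R) integrable_on {s..T}" by (rule integrable_on_mult_left[OF c_integrable_on(1)])
        fix t assume t: "t \<in> {s..T}"
        have "1 + norm (X t x) \<le> (1 + norm x) * exp (cumulative C\<^sub>0 t - cumulative C\<^sub>0 s)" by (rule bound[OF t])
        also have "\<dots> \<le> K R" unfolding K_def
          using c0_mono[of t T] t s x norm_ge_zero[of x] by (intro mult_mono) (auto simp del: norm_ge_zero)
        finally show "norm (\<beta> t (X t x)) \<le> c\<^sub>0 t * K R"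
          using \<beta>_growth[of t "X t x"] mult_left_mono[OF _ c\<^sub>0_nonneg[of t]] order_trans by blast
      qed
      ultimately show ?thesis by simp
    qed
    show "L1loc (\<lambda>x. LINT t:{s..T}|lebesgue. norm (b t (X t x)))"
      unfolding bI
    proof (rule L1loc_if_balls)
      fix R :: real assume "R > 0"
      show "I absolutely_integrable_on ball 0 R"
      proof (rule measurable_bounded_by_integrable_imp_absolutely_integrable)
        show "I \<in> borel_measurable (lebesgue_on (ball 0 R))"
          using I_meas by (intro measurable_restrict_space1 measurable_completion) simp
        show "(\<lambda>_. integral {s..T} (\<lambda>r. c\<^sub>0 r * K R)) integrable_on ball (0::real^'n) R"
          by (intro integrable_on_const) simp
      qed (use I_bound in auto)
    qed
  qed
  have compress: "emeasure lborel (X t -` A) \<le>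
        ennreal (exp (real CARD('n) * (cumulative C\<^sub>1 t - cumulative C\<^sub>1 s))) * emeasure lborel A"
    if "t \<in> {s..T}" "A \<in> sets borel" for t A
    using emeasure_X_preimage_le[of t A] that cum1[of s t] s by (simp add: weight_def)
  have "0 \<le> cumulative C\<^sub>0 s" using c0_mono[of 0 s] zero s by simp
  then show ?thesis unfolding canonical_flow_def
    using X_measurable sol AE_inclusion_solution_eq_X[OF Nn b'] compress bound c0_mono L1
    by (intro exI[of _ X]) blast
qed

section \<open>Regular Lagrangian flows\<close>

lemma inclusion_solution_restrict:
  assumes \<gamma>: "inclusion_solution b r T x \<gamma>" and s: "r \<le> s" "s \<le> T"
  shows "inclusion_solution b s T (\<gamma> s) \<gamma>"
  unfolding inclusion_solution_def
proof (intro conjI)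
  have sub: "{s..T} \<subseteq> {r..T}" using s by auto
  show "absolutely_continuous_on {s..T} \<gamma>"
    using \<gamma> sub absolutely_continuous_on_subset unfolding inclusion_solution_def by blast
  have "AE t\<in>{r..T} in lebesgue. \<exists>v\<in>envelope_box (b t) (\<gamma> t). (\<gamma> has_vector_derivative v) (at t within {r..T})"
    using \<gamma> by (simp add: inclusion_solution_def)
  then show "AE t\<in>{s..T} in lebesgue. \<exists>v\<in>envelope_box (b t) (\<gamma> t). (\<gamma> has_vector_derivative v) (at t within {s..T})"
    by (rule eventually_mono) (use sub has_vector_derivative_within_subset[OF _ sub] in blast)
qed simp

text \<open>
  Turns the exponential growth \<open>(1 + |x|) exp \<Delta>\<close> given by Gronwall's inequality into a growth of the radius
  that is linear in \<open>\<Delta>\<close>. The bound \<open>M\<close> on the mass of \<open>C\<^sub>0\<close> enters the constant here.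
\<close>

lemma exp_radius_le:
  fixes \<Delta> M R \<rho> :: real
  assumes "0 \<le> \<Delta>" "\<Delta> \<le> M" "0 \<le> \<rho>" "\<rho> < R"
  shows "(1 + \<rho>) * exp \<Delta> < 1 + (R + exp M * (1 + R) * \<Delta>)"
proof -
  have "exp \<Delta> - 1 \<le> exp M * \<Delta>"
  proof -
    have "exp \<Delta> * (1 - exp (- \<Delta>)) \<le> exp \<Delta> * \<Delta>"
      using exp_ge_add_one_self[of "- \<Delta>"] by (intro mult_left_mono) auto
    also have "\<dots> \<le> exp M * \<Delta>" using assms by (intro mult_right_mono) auto
    finally show ?thesis by (simp add: right_diff_distrib flip: exp_add)
  qed
  then have "(1 + R) * (exp \<Delta> - 1) \<le> (1 + R) * (exp M * \<Delta>)" using assms by (intro mult_left_mono) auto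
  moreover have "(1 + \<rho>) * exp \<Delta> < (1 + R) * exp \<Delta>" using assms by (intro mult_strict_right_mono) auto
  moreover have "(1 + R) * exp \<Delta> = (1 + R) * (exp \<Delta> - 1) + 1 + R" "(1 + R) * (exp M * \<Delta>) = exp M * (1 + R) * \<Delta>"
    by (simp_all add: algebra_simps)
  ultimately show ?thesis by linarith
qed

lemma L1loc_diff:
  assumes "L1loc g" "L1loc h" shows "L1loc (\<lambda>x. h x - g x)"
  using assms set_integral_diff(1) unfolding L1loc_def by blast

lemma composition_continuous_L1loc_extension:
  fixes f :: "'a::euclidean_space \<Rightarrow> 'a"
  assumes loc: "\<And>h. L1loc h \<Longrightarrow> L1loc (\<lambda>x. h (f x))"
    and le: "\<And>R h. R > 0 \<Longrightarrow> L1loc h \<Longrightarrow> L1_ball R (\<lambda>x. h (f x)) \<le> E * L1_ball (\<rho> R) h"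
    and E: "E > 0" and \<rho>: "\<And>R. R > 0 \<Longrightarrow> \<rho> R > 0"
  shows "continuous_L1loc_extension (\<lambda>h x. h (f x)) (\<lambda>h x. h (f x))"
  unfolding continuous_L1loc_extension_def L1loc_continuous_def
proof (intro conjI allI impI)
  show "L1loc (\<lambda>x. h (f x))" if "L1loc h" for h by (rule loc[OF that])
  fix g :: "'a \<Rightarrow> real" and R \<epsilon> :: real assume g: "L1loc g" and R: "R > 0" and \<epsilon>: "\<epsilon> > 0"
  show "\<exists>R'>0. \<exists>\<delta>>0. \<forall>h. L1loc h \<and> L1_ball R' (\<lambda>x. h x - g x) < \<delta> \<longrightarrow> L1_ball R (\<lambda>x. h (f x) - g (f x)) < \<epsilon>"
  proof (rule exI[of _ "\<rho> R"], rule conjI[OF \<rho>[OF R]], rule exI[of _ "\<epsilon> / E"], intro conjI allI impI)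
    show "0 < \<epsilon> / E" using \<epsilon> E by simp
    fix h :: "'a \<Rightarrow> real" assume h: "L1loc h \<and> L1_ball (\<rho> R) (\<lambda>x. h x - g x) < \<epsilon> / E"
    have "L1_ball R (\<lambda>x. h (f x) - g (f x)) \<le> E * L1_ball (\<rho> R) (\<lambda>x. h x - g x)"
      using le[OF R L1loc_diff[OF g, of h]] h by simp
    also have "\<dots> < \<epsilon>" using h E by (simp add: pos_less_divide_eq mult.commute)
    finally show "L1_ball R (\<lambda>x. h (f x) - g (f x)) < \<epsilon>" .
  qed
qed simp

theorem theorem3p1:
  fixes T M :: real
  assumes "T > 0"
  shows "\<exists>C>0. \<forall>(b :: real \<Rightarrow> real^'n::finite \<Rightarrow> real^'n) C\<^sub>0 C\<^sub>1.
    velocity_field T b C\<^sub>0 C\<^sub>1 \<and> cumulative C\<^sub>0 T \<le> M \<longrightarrow>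
      (\<forall>s\<in>{0..T}. AE x in lebesgue. \<exists>\<gamma>. unique_curve {s..T} (inclusion_solution b s T x) \<gamma>) \<and>
      (\<forall>\<phi>. inclusion_flow b T \<phi> \<longrightarrow>
        (\<forall>s\<in>{0..T}.
          (\<forall>t\<in>{s..T}.
            (\<exists>\<Phi>. continuous_L1loc_extension (\<lambda>h x. h (\<phi> t s x)) \<Phi> \<and>
                 (\<forall>h. L1loc h \<longrightarrow> (AE x in lebesgue. \<Phi> h x = h (\<phi> t s x)))) \<and>
            (\<forall>R>0. \<forall>h. L1loc h \<longrightarrow>
               L1loc (\<lambda>x. h (\<phi> t s x)) \<and>
               L1_ball R (\<lambda>x. h (\<phi> t s x)) \<le>
                 exp (real CARD('n) * (cumulative C\<^sub>1 t - cumulative C\<^sub>1 s)) *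
                 L1_ball (R + C * (1 + R) * (cumulative C\<^sub>0 t - cumulative C\<^sub>0 s)) h)) \<and>
          L1loc_L1 {s..T} (\<lambda>t x. b t (\<phi> t s x)) \<and>
          (AE x in lebesgue.
             unique_curve {s..T} (integral_solution b s T x) (\<lambda>t. \<phi> t s x))) \<and>
        (\<forall>r s t. 0 \<le> r \<and> r \<le> s \<and> s \<le> t \<and> t \<le> T \<longrightarrow>
          (\<forall>N\<in>null_sets lebesgue. AE x in lebesgue. \<phi> s r x \<notin> N) \<and>
          (AE x in lebesgue. \<phi> t s (\<phi> s r x) = \<phi> t r x)))"
proof (intro exI[of _ "exp M"] conjI allI impI)
  \<comment> \<open>The solutions move with the velocity \<open>b\<close> itself, whose norm is bounded directly; so the constant does not depend on the dimension.\<close>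
  show "exp M > 0" by simp
  fix b :: "real \<Rightarrow> real^'n \<Rightarrow> real^'n" and C\<^sub>0 C\<^sub>1 :: "real \<Rightarrow> real"
  assume A: "velocity_field T b C\<^sub>0 C\<^sub>1 \<and> cumulative C\<^sub>0 T \<le> M"
  then have vf: "velocity_field T b C\<^sub>0 C\<^sub>1" by simp
  have "\<forall>s. \<exists>X. s \<in> {0..T} \<longrightarrow> canonical_flow T b C\<^sub>0 C\<^sub>1 s X"
    using canonical_flow_exists[OF vf] by blast
  from choice[OF this] obtain X where X: "\<And>s. s \<in> {0..T} \<Longrightarrow> canonical_flow T b C\<^sub>0 C\<^sub>1 s (X s)" by blast
  have X_meas: "(\<lambda>p. X s (fst p) (snd p)) \<in> borel_measurable (borel \<Otimes>\<^sub>M borel)"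
    and X_sol: "integral_solution b s T x (\<lambda>t. X s t x)"
    and X_unique: "AE x in lebesgue. \<forall>\<gamma>. inclusion_solution b s T x \<gamma> \<longrightarrow> (\<forall>t\<in>{s..T}. \<gamma> t = X s t x)"
    and X_compress: "t \<in> {s..T} \<Longrightarrow> A \<in> sets borel \<Longrightarrow> emeasure lborel (X s t -` A) \<le>
        ennreal (exp (real CARD('n) * (cumulative C\<^sub>1 t - cumulative C\<^sub>1 s))) * emeasure lborel A"
    and X_bound: "t \<in> {s..T} \<Longrightarrow> 1 + norm (X s t x) \<le> (1 + norm x) * exp (cumulative C\<^sub>0 t - cumulative C\<^sub>0 s)"
    and X_L1: "L1loc_L1 {s..T} (\<lambda>t x. b t (X s t x))"
    if "s \<in> {0..T}" for s t x A
    using X[OF that] unfolding canonical_flow_def by blast+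
  have cum_nonneg: "0 \<le> cumulative C\<^sub>0 s" if "s \<in> {0..T}" for s
    using X[OF that] unfolding canonical_flow_def by blast
  have cum_mono: "cumulative C\<^sub>0 u \<le> cumulative C\<^sub>0 v" if "0 \<le> u" "u \<le> v" "v \<le> T" for u v
    using X[of 0] \<open>T > 0\<close> that unfolding canonical_flow_def by auto
  have X_incl: "inclusion_solution b s T x (\<lambda>t. X s t x)" if "s \<in> {0..T}" for s x
    by (rule integral_solution_imp_inclusion_solution[OF X_sol[OF that]]) (use that in auto)
  have unique: "unique_curve {s..T} (inclusion_solution b s T x) (\<lambda>t. X s t x)"
    if "s \<in> {0..T}" "\<forall>\<gamma>. inclusion_solution b s T x \<gamma> \<longrightarrow> (\<forall>t\<in>{s..T}. \<gamma> t = X s t x)" for s x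
    using X_incl[OF that(1)] that(2) by (auto simp: unique_curve_def)
  show "\<forall>s\<in>{0..T}. AE x in lebesgue. \<exists>\<gamma>. unique_curve {s..T} (inclusion_solution b s T x) \<gamma>"
  proof
    fix s assume s: "s \<in> {0..T}"
    show "AE x in lebesgue. \<exists>\<gamma>. unique_curve {s..T} (inclusion_solution b s T x) \<gamma>"
      using X_unique[OF s] by (rule eventually_mono) (use unique[OF s] in blast)
  qed
  fix \<phi> assume \<phi>: "inclusion_flow b T \<phi>"
  have \<phi>X: "AE x in lebesgue. \<forall>t\<in>{s..T}. \<phi> t s x = X s t x" if s: "s \<in> {0..T}" for s
  proof -
    have "AE x in lebesgue. inclusion_solution b s T x (\<lambda>t. \<phi> t s x)" using \<phi> s by (simp add: inclusion_flow_def)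
    with X_unique[OF s] show ?thesis by eventually_elim blast
  qed
  have Xt_meas: "X s t \<in> borel_measurable borel" if "s \<in> {0..T}" for s t
    using measurable_compose[OF measurable_Pair[of "\<lambda>_. t" borel borel "\<lambda>x. x" borel] X_meas[OF that]] by simp
  show "\<forall>s\<in>{0..T}.
          (\<forall>t\<in>{s..T}.
            (\<exists>\<Phi>. continuous_L1loc_extension (\<lambda>h x. h (\<phi> t s x)) \<Phi> \<and>
                 (\<forall>h. L1loc h \<longrightarrow> (AE x in lebesgue. \<Phi> h x = h (\<phi> t s x)))) \<and>
            (\<forall>R>0. \<forall>h. L1loc h \<longrightarrow>
               L1loc (\<lambda>x. h (\<phi> t s x)) \<and>
               L1_ball R (\<lambda>x. h (\<phi> t s x)) \<le>
                 exp (real CARD('n) * (cumulative C\<^sub>1 t - cumulative C\<^sub>1 s)) *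
                 L1_ball (R + exp M * (1 + R) * (cumulative C\<^sub>0 t - cumulative C\<^sub>0 s)) h)) \<and>
          L1loc_L1 {s..T} (\<lambda>t x. b t (\<phi> t s x)) \<and>
          (AE x in lebesgue.
             unique_curve {s..T} (integral_solution b s T x) (\<lambda>t. \<phi> t s x))"
  proof (intro ballI conjI)
    fix s assume s: "s \<in> {0..T}"
    show "L1loc_L1 {s..T} (\<lambda>t x. b t (\<phi> t s x))"
      by (rule L1loc_L1_cong_AE[OF X_L1[OF s]]) (use \<phi>X[OF s] in \<open>auto elim: eventually_mono\<close>)
    show "AE x in lebesgue. unique_curve {s..T} (integral_solution b s T x) (\<lambda>t. \<phi> t s x)"
      using \<phi>X[OF s] X_unique[OF s]
    proof eventually_elim
      case (elim x)
      have "integral_solution b s T x (\<lambda>t. \<phi> t s x)"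
      proof -
        have ac: "absolutely_continuous_on {s..T} (\<lambda>t. \<phi> t s x)"
        proof (rule absolutely_continuous_on_dominated[where K = 1 and g = "\<lambda>t. X s t x" and h = "\<lambda>t. X s t x"])
          show "absolutely_continuous_on {s..T} (\<lambda>t. X s t x)" "absolutely_continuous_on {s..T} (\<lambda>t. X s t x)"
            using X_sol[OF s, of x] by (auto simp: integral_solution_def)
        qed (use elim(1) in auto)
        have ai: "(\<lambda>r. b r (\<phi> r s x)) absolutely_integrable_on {s..T}"
          by (rule absolutely_integrable_spike[where f = "\<lambda>r. b r (X s r x)" and S = "{}"])
            (use X_sol[OF s, of x] elim(1) in \<open>auto simp: integral_solution_def\<close>)
        have "\<phi> t s x = x + (LINT r:{s..t}|lebesgue. b r (\<phi> r s x))" if t: "t \<in> {s..T}" for t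
        proof -
          have "(LINT r:{s..t}|lebesgue. b r (\<phi> r s x)) = (LINT r:{s..t}|lebesgue. b r (X s r x))"
            by (rule set_lebesgue_integral_cong) (use elim(1) t in auto)
          then show ?thesis using X_sol[OF s, of x] t elim(1) by (auto simp: integral_solution_def)
        qed
        with ac ai show ?thesis by (simp add: integral_solution_def)
      qed
      moreover have "\<gamma> t = \<phi> t s x" if "integral_solution b s T x \<gamma>" "t \<in> {s..T}" for \<gamma> t
        using integral_solution_imp_inclusion_solution[OF that(1)] elim that(2) s by auto
      ultimately show ?case by (simp add: unique_curve_def)
    qed
    fix t assume t: "t \<in> {s..T}"
    define \<Delta> where "\<Delta> = cumulative C\<^sub>0 t - cumulative C\<^sub>0 s"
    define E where "E = exp (real CARD('n) * (cumulative C\<^sub>1 t - cumulative C\<^sub>1 s))"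
    have \<Delta>: "0 \<le> \<Delta>" "\<Delta> \<le> M"
      using cum_mono[of s t] cum_mono[of t T] cum_nonneg[OF s] s t A by (auto simp: \<Delta>_def)
    have eq: "AE x in lebesgue. \<phi> t s x = X s t x"
      using \<phi>X[OF s] by (rule eventually_mono) (use t in blast)
    have rad: "norm (X s t x) < R + exp M * (1 + R) * \<Delta>" if "norm x < R" for x R
      using X_bound[OF s t, of x] exp_radius_le[OF \<Delta> norm_ge_zero that] by (simp add: \<Delta>_def)
    have comp: "(\<lambda>x. h (\<phi> t s x)) absolutely_integrable_on ball 0 R"
      "L1_ball R (\<lambda>x. h (\<phi> t s x)) \<le> E * L1_ball (R + exp M * (1 + R) * \<Delta>) h" if "L1loc h" for h R
      by (rule L1_ball_composition[OF Xt_meas[OF s] _ _ eq rad that, where E = E];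
          (use X_compress[OF s t] in \<open>auto simp: E_def\<close>))+
    have loc: "L1loc (\<lambda>x. h (\<phi> t s x))" if "L1loc h" for h
      by (rule L1loc_if_balls) (rule comp(1)[OF that])
    have "continuous_L1loc_extension (\<lambda>h x. h (\<phi> t s x)) (\<lambda>h x. h (\<phi> t s x))"
    proof (rule composition_continuous_L1loc_extension[where E = E and \<rho> = "\<lambda>R. R + exp M * (1 + R) * \<Delta>"])
      show "E > 0" by (simp add: E_def)
      show "R + exp M * (1 + R) * \<Delta> > 0" if "R > 0" for R
        using that \<Delta>(1) by (intro add_pos_nonneg) auto
    qed (use loc comp(2) in auto)
    then show "\<exists>\<Phi>. continuous_L1loc_extension (\<lambda>h x. h (\<phi> t s x)) \<Phi> \<and>
                 (\<forall>h. L1loc h \<longrightarrow> (AE x in lebesgue. \<Phi> h x = h (\<phi> t s x)))"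
      by (intro exI[of _ "\<lambda>h x. h (\<phi> t s x)"]) auto
    show "\<forall>R>0. \<forall>h. L1loc h \<longrightarrow>
               L1loc (\<lambda>x. h (\<phi> t s x)) \<and>
               L1_ball R (\<lambda>x. h (\<phi> t s x)) \<le>
                 exp (real CARD('n) * (cumulative C\<^sub>1 t - cumulative C\<^sub>1 s)) *
                 L1_ball (R + exp M * (1 + R) * (cumulative C\<^sub>0 t - cumulative C\<^sub>0 s)) h"
      using loc comp(2) unfolding E_def \<Delta>_def by blast
  qed
  fix r s t assume rst: "0 \<le> r \<and> r \<le> s \<and> s \<le> t \<and> t \<le> T"
  have r: "r \<in> {0..T}" and s: "s \<in> {0..T}" and sr: "s \<in> {r..T}" and ts: "t \<in> {s..T}" using rst by auto
  have null: "AE x in lebesgue. \<phi> s r x \<notin> N" if N: "N \<in> null_sets lebesgue" for N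
  proof -
    obtain N' where N': "N' \<in> null_sets lborel" "N \<subseteq> N'"
      using N unfolding null_sets_completion_iff2 by blast
    have "emeasure lborel (X r s -` N') \<le> ennreal (exp (real CARD('n) * (cumulative C\<^sub>1 s - cumulative C\<^sub>1 r))) * emeasure lborel N'"
      by (rule X_compress[OF r sr]) (use N' in auto)
    then have "emeasure lborel (X r s -` N') = 0" using N'(1) by auto
    moreover have "X r s -` N' \<in> sets borel" by (rule measurable_sets_borel[OF Xt_meas[OF r]]) (use N' in auto)
    ultimately have "X r s -` N' \<in> null_sets lborel" by (simp add: null_setsI)
    then have "AE x in lebesgue. x \<notin> X r s -` N'" by (intro AE_completion AE_not_in)
    with \<phi>X[OF r] show ?thesis by eventually_elim (use N' sr in auto)
  qed
  then show "\<forall>N\<in>null_sets lebesgue. AE x in lebesgue. \<phi> s r x \<notin> N" by blast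
  \<comment> \<open>Almost every trajectory from time \<open>r\<close> is at time \<open>s\<close> at a point where the flow is determined.\<close>
  have "AE y in lebesgue. (\<forall>u\<in>{s..T}. \<phi> u s y = X s u y) \<and>
      (\<forall>\<gamma>. inclusion_solution b s T y \<gamma> \<longrightarrow> (\<forall>u\<in>{s..T}. \<gamma> u = X s u y))"
    using \<phi>X[OF s] X_unique[OF s] by eventually_elim blast
  then obtain N where N: "negligible N" "\<And>y. y \<notin> N \<Longrightarrow> (\<forall>u\<in>{s..T}. \<phi> u s y = X s u y) \<and>
      (\<forall>\<gamma>. inclusion_solution b s T y \<gamma> \<longrightarrow> (\<forall>u\<in>{s..T}. \<gamma> u = X s u y))"
    by (elim AE_lebesgue_negligible) blast
  have "AE x in lebesgue. \<phi> s r x \<notin> N" by (rule null) (use N in \<open>simp add: negligible_iff_null_sets\<close>)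
  moreover have "AE x in lebesgue. inclusion_solution b r T x (\<lambda>t. \<phi> t r x)"
    using \<phi> r by (simp add: inclusion_flow_def)
  ultimately show "AE x in lebesgue. \<phi> t s (\<phi> s r x) = \<phi> t r x"
  proof eventually_elim
    case (elim x)
    have "inclusion_solution b s T (\<phi> s r x) (\<lambda>t. \<phi> t r x)"
      using inclusion_solution_restrict[OF elim(2), of s] rst by simp
    with N(2)[OF elim(1)] ts show ?case by auto
  qed
qed

end
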